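(* Let $u$ be a generalized solution to the equation $u_t=(\varphi'(u_x))_x$ with homogeneous Neumann boundary conditions in the interval $(0,1)$, obtained through semi-discrete approximation, with corresponding sequences $\{n_k\}$ and $\{u_k\}$. Let $v\in L^\infty((0,+\infty)\times(0,1))$ be the weak* limit in $L^\infty((0,+\infty)\times(0,1))$, as $k\to+\infty$, of the functions $(t,x)\mapsto v_k(t,\lceil n_kx\rceil)$, where $$v_k(t,i):=\varphi'\left(D_{n_k}^+u_k(t,i)\right)\qquad\forall t\ge0,\ \forall i\in\{1,\dots,n_k\}.$$ Then the pair $(u,v)$ is a $uv$-evolution with homogeneous Neumann boundary conditions in $(0,1)$.
   Context: Standing assumptions on $\varphi$: $\varphi:\mathbb{R}\to\mathbb{R}$ is an even function of class $C^2$ with bounded second derivative, $\varphi(0)=0$, $\varphi''(0)>0$; there exists $\sigma_1>0$ such that $\varphi'$ is nondecreasing in $[0,\sigma_1]$ and nonincreasing in $[\sigma_1,+\infty)$; and $\lim_{\sigma\to+\infty}\varphi'(\sigma)=0$. Discrete notation: for a function $w$ of a discrete index and a positive integer $n$, $[D_n^+w](i):=n(w(i+1)-w(i))$ and $[D_n^-w](i):=n(w(i)-w(i-1))$. For $w:\{1,\dots,n\}\to\mathbb{R}$, $\|w\|_\infty:=\max_{1\le i\le n}|w(i)|$ and $TV(w):=\sum_{i=1}^{n-1}|w(i+1)-w(i)|$. Generalized solution: a generalized solution to $u_t=(\varphi'(u_x))_x$ with homogeneous Neumann boundary conditions in $(0,1)$, obtained through semi-discrete approximation, is any $u\in C^0([0,+\infty);L^2((0,1)))$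 for which there exist an increasing sequence $\{n_k\}$ of positive integers and functions $u_k:[0,+\infty)\times\{1,\dots,n_k\}\to\mathbb{R}$ such that: (a) there exists $M\in\mathbb{R}$ with $\|u_k(0,\cdot)\|_\infty+TV(u_k(0,\cdot))\le M$ for every $k\ge1$; (b) for every $k$, $u_k$ is differentiable with respect to the first variable and $$u_k'(t,i)=D_{n_k}^-\left(\varphi'\left(D_{n_k}^+u_k(t,i)\right)\right)=n_k\left\{\varphi'(D^+_{n_k}u_k(t,i))-\varphi'(D^+_{n_k}u_k(t,i-1))\right\}$$ for all $t\ge0$, $i\in\{1,\dots,n_k\}$, where $u_k$ is extended by $u_k(t,0)=u_k(t,1)$ and $u_k(t,n_k+1)=u_k(t,n_k)$ (here $'$ on $u_k$ denotes the time derivative); (c) for every $T>0$, $\lim_{k\to+\infty}\sup_{t\in[0,T]}\|u_k(t,\lceil n_kx\rceil)-u(t,x)\|_{L^2((0,1))}=0$. Known facts (from earlier work) about such $u$: $u$ has a weak time derivative $u_t\in L^2((0,+\infty)\times(0,1))$; $u(t,\cdot)\in BV((0,1))$ with $\|u(t,\cdot)\|_\infty+TV(u(t,\cdot))\le M$ for every $t\ge0$; the weak* limit $v$ above exists, has a weak derivative $v_x$ that is the weak limit of $D^-_{n_k}v_k(t,\lceil n_kx\rceil)$ in $L^2((0,+\infty)\times(0,1))$, and $u_t=v_x$ as elements of $L^2((0,+\infty)\times(0,1))$; for almost every $t\ge0$, $v(t,\cdot)\in H^1((0,1))$ and $v(t,0)=v(t,1)=0$. A $uv$-evolution with homogeneous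 Neumann boundary conditions in an interval $(a,b)$ is a pair of measurable functions $u,v:(0,+\infty)\times(a,b)\to\mathbb{R}$ such that: - (time regularity) $u$ admits a weak derivative $u_t$ with respect to time, and $u_t\in L^1((0,T)\times(a,b))$ for every $T>0$; - (space regularity) for almost every $t>0$, $x\mapsto u(t,x)$ is in $BV((a,b))$ and $x\mapsto v(t,x)$ is in $W^{1,1}((a,b))$; - (evolution equation) $u_t(t,x)=v_x(t,x)$ in $(0,+\infty)\times(a,b)$; - (Neumann boundary conditions) for almost every $t>0$, $v(t,a)=v(t,b)=0$; - (sign condition) for almost every $t>0$, $v(t,x)\cdot Du(t,x)\ge0$ as a measure in $(a,b)$, where $Du$ is the distributional derivative of $x\mapsto u(t,x)$ (a signed measure), multiplied by the continuous function $v(t,\cdot)$. *)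

theory Defs
  imports "HOL-Analysis.Analysis"
begin

definition admissible_phi :: "(real \<Rightarrow> real) \<Rightarrow> bool" where
  "admissible_phi \<phi> \<longleftrightarrow>
     (\<forall>s. \<phi> (- s) = \<phi> s) \<and>
     (\<forall>s. \<phi> differentiable (at s)) \<and>
     (\<forall>s. deriv \<phi> differentiable (at s)) \<and>
     continuous_on UNIV (deriv (deriv \<phi>)) \<and>
     bounded (range (deriv (deriv \<phi>))) \<and>
     \<phi> 0 = 0 \<and>
     deriv (deriv \<phi>) 0 > 0 \<and>
     (\<exists>\<sigma>1>0. mono_on {0..\<sigma>1} (deriv \<phi>) \<and> antimono_on {\<sigma>1..} (deriv \<phi>)) \<and>
     (deriv \<phi> \<longlongrightarrow> 0) at_top"

primrec Ck :: "nat \<Rightarrow> ('a::euclidean_space \<Rightarrow> real) \<Rightarrow> bool" where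
  "Ck 0 f \<longleftrightarrow> continuous_on UNIV f"
| "Ck (Suc k) f \<longleftrightarrow>
     (\<forall>p. f differentiable (at p)) \<and> (\<forall>b\<in>Basis. Ck k (\<lambda>p. frechet_derivative f (at p) b))"

definition test_function :: "'a::euclidean_space set \<Rightarrow> ('a \<Rightarrow> real) \<Rightarrow> bool" where
  "test_function \<Omega> \<eta> \<longleftrightarrow>
     (\<forall>k. Ck k \<eta>) \<and> compact (closure {p. \<eta> p \<noteq> 0}) \<and> closure {p. \<eta> p \<noteq> 0} \<subseteq> \<Omega>"

definition L1_loc :: "'a::euclidean_space set \<Rightarrow> ('a \<Rightarrow> real) \<Rightarrow> bool" where
  "L1_loc \<Omega> f \<longleftrightarrow> (\<forall>K. compact K \<longrightarrow> K \<subseteq> \<Omega> \<longrightarrow> integrable (lebesgue_on K) f)"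

definition weak_deriv ::
  "'a::euclidean_space set \<Rightarrow> 'a \<Rightarrow> ('a \<Rightarrow> real) \<Rightarrow> ('a \<Rightarrow> real) \<Rightarrow> bool" where
  "weak_deriv \<Omega> b f g \<longleftrightarrow> L1_loc \<Omega> f \<and> L1_loc \<Omega> g \<and>
     (\<forall>\<eta>. test_function \<Omega> \<eta> \<longrightarrow>
        (LINT p|lebesgue_on \<Omega>. f p * frechet_derivative \<eta> (at p) b)
          = - (LINT p|lebesgue_on \<Omega>. g p * \<eta> p))"

definition W11 :: "real \<Rightarrow> real \<Rightarrow> (real \<Rightarrow> real) \<Rightarrow> bool" where
  "W11 a b f \<longleftrightarrow> integrable (lebesgue_on {a<..<b}) f \<and>
     (\<exists>g. integrable (lebesgue_on {a<..<b}) g \<and> weak_deriv {a<..<b} 1 f g)"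

text \<open>Functions in \<open>W11\<close> are classes modulo null sets. Their boundary values, and their products
  with measures, are those of the continuous representative on the closed interval, which is unique.\<close>

definition cont_rep :: "real \<Rightarrow> real \<Rightarrow> (real \<Rightarrow> real) \<Rightarrow> (real \<Rightarrow> real) \<Rightarrow> bool" where
  "cont_rep a b f w \<longleftrightarrow>
     continuous_on {a..b} w \<and> (AE x in lebesgue_on {a<..<b}. f x = w x)"

text \<open>A finite signed Borel measure on the open interval is encoded as a difference \<open>P - N\<close> of two
  finite measures (not necessarily the Jordan decomposition). The predicate states that \<open>P - N\<close> is
  the distributional derivative of \<open>f\<close>; as a signed measure, \<open>P - N\<close> is determined by \<open>f\<close>.\<close>

definition distr_deriv ::
  "real \<Rightarrow> real \<Rightarrow> (real \<Rightarrow> real) \<Rightarrow> real measure \<Rightarrow> real measure \<Rightarrow> bool" where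
  "distr_deriv a b f P N \<longleftrightarrow>
     finite_measure P \<and> sets P = sets (restrict_space borel {a<..<b}) \<and>
     finite_measure N \<and> sets N = sets (restrict_space borel {a<..<b}) \<and>
     (\<forall>\<eta>. test_function {a<..<b} \<eta> \<longrightarrow>
        (LINT x|lebesgue_on {a<..<b}. f x * deriv \<eta> x) = - ((LINT x|P. \<eta> x) - (LINT x|N. \<eta> x)))"

definition BV :: "real \<Rightarrow> real \<Rightarrow> (real \<Rightarrow> real) \<Rightarrow> bool" where
  "BV a b f \<longleftrightarrow> integrable (lebesgue_on {a<..<b}) f \<and> (\<exists>P N. distr_deriv a b f P N)"

text \<open>Points of space-time are pairs \<open>(t, x)\<close>. The function \<open>ut\<close> is the weak time derivative of
  \<open>u\<close>; the evolution equation says that \<open>ut t\<close> is the weak derivative of the \<open>W11\<close> function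
  \<open>v t\<close>, for almost every \<open>t\<close>. In the last two clauses \<open>w\<close> is the continuous representative of
  \<open>v t\<close> and \<open>P - N\<close> is the distributional derivative of \<open>u t\<close>. Both are uniquely determined.\<close>

definition uv_evolution ::
  "real \<Rightarrow> real \<Rightarrow> (real \<Rightarrow> real \<Rightarrow> real) \<Rightarrow> (real \<Rightarrow> real \<Rightarrow> real) \<Rightarrow> bool" where
  "uv_evolution a b u v \<longleftrightarrow>
     case_prod u \<in> borel_measurable (lebesgue_on ({0<..} \<times> {a<..<b})) \<and>
     case_prod v \<in> borel_measurable (lebesgue_on ({0<..} \<times> {a<..<b})) \<and>
     (\<exists>ut. weak_deriv ({0<..} \<times> {a<..<b}) (1, 0) (case_prod u) (case_prod ut) \<and>
           (\<forall>T>0. integrable (lebesgue_on ({0<..<T} \<times> {a<..<b})) (case_prod ut)) \<and>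
           (AE t in lebesgue_on {0<..}. weak_deriv {a<..<b} 1 (v t) (ut t))) \<and>
     (AE t in lebesgue_on {0<..}. BV a b (u t) \<and> W11 a b (v t)) \<and>
     (AE t in lebesgue_on {0<..}. \<exists>w. cont_rep a b (v t) w \<and> w a = 0 \<and> w b = 0) \<and>
     (AE t in lebesgue_on {0<..}. \<exists>w P N. cont_rep a b (v t) w \<and> distr_deriv a b (u t) P N \<and>
        (\<forall>E\<in>sets (restrict_space borel {a<..<b}). (LINT x:E|P. w x) - (LINT x:E|N. w x) \<ge> 0))"

text \<open>Discrete indices are integers, so that \<open>i - 1\<close> is not truncated.\<close>

definition Dplus :: "nat \<Rightarrow> (int \<Rightarrow> real) \<Rightarrow> int \<Rightarrow> real" where
  "Dplus n w i = real n * (w (i + 1) - w i)"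

definition Dminus :: "nat \<Rightarrow> (int \<Rightarrow> real) \<Rightarrow> int \<Rightarrow> real" where
  "Dminus n w i = real n * (w i - w (i - 1))"

definition sup_norm :: "nat \<Rightarrow> (int \<Rightarrow> real) \<Rightarrow> real" where
  "sup_norm n w = Max ((\<lambda>i. \<bar>w i\<bar>) ` {1..int n})"

definition TV :: "nat \<Rightarrow> (int \<Rightarrow> real) \<Rightarrow> real" where
  "TV n w = (\<Sum>i = 1..int n - 1. \<bar>w (i + 1) - w i\<bar>)"

definition neumann_ext :: "nat \<Rightarrow> (int \<Rightarrow> real) \<Rightarrow> int \<Rightarrow> real" where
  "neumann_ext n w i = (if i = 0 then w 1 else if i = int n + 1 then w (int n) else w i)"

definition flux :: "(real \<Rightarrow> real) \<Rightarrow> nat \<Rightarrow> (int \<Rightarrow> real) \<Rightarrow> int \<Rightarrow> real" where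
  "flux \<phi> n w i = deriv \<phi> (Dplus n (neumann_ext n w) i)"

definition L2_norm01 :: "(real \<Rightarrow> real) \<Rightarrow> real" where
  "L2_norm01 f = sqrt (LINT x|lebesgue_on {0<..<1}. (f x)\<^sup>2)"

definition in_L2_01 :: "(real \<Rightarrow> real) \<Rightarrow> bool" where
  "in_L2_01 f \<longleftrightarrow> f \<in> borel_measurable (lebesgue_on {0<..<1}) \<and>
     integrable (lebesgue_on {0<..<1}) (\<lambda>x. (f x)\<^sup>2)"

text \<open>Here \<open>u t\<close> stands for its class in \<open>L2\<close>, for each \<open>t\<close> separately; no joint measurability in
  \<open>(t, x)\<close> is implied.\<close>

definition C0_L2 :: "(real \<Rightarrow> real \<Rightarrow> real) \<Rightarrow> bool" where
  "C0_L2 u \<longleftrightarrow> (\<forall>t\<ge>0. in_L2_01 (u t)) \<and>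
     (\<forall>t\<ge>0. ((\<lambda>s. L2_norm01 (\<lambda>x. u s x - u t x)) \<longlongrightarrow> 0) (at t within {0..}))"

definition generalized_solution ::
  "(real \<Rightarrow> real) \<Rightarrow> (nat \<Rightarrow> nat) \<Rightarrow> (nat \<Rightarrow> real \<Rightarrow> int \<Rightarrow> real) \<Rightarrow> (real \<Rightarrow> real \<Rightarrow> real) \<Rightarrow> bool" where
  "generalized_solution \<phi> n uk u \<longleftrightarrow>
     C0_L2 u \<and> strict_mono n \<and> (\<forall>k. n k > 0) \<and>
     (\<exists>M. \<forall>k. sup_norm (n k) (uk k 0) + TV (n k) (uk k 0) \<le> M) \<and>
     (\<forall>k. \<forall>t\<ge>0. \<forall>i\<in>{1..int (n k)}.
        ((\<lambda>s. uk k s i) has_real_derivative Dminus (n k) (flux \<phi> (n k) (uk k t)) i)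
          (at t within {0..})) \<and>
     (\<forall>T>0. (\<lambda>k. SUP t\<in>{0..T}. L2_norm01 (\<lambda>x. uk k t \<lceil>real (n k) * x\<rceil> - u t x))
        \<longlonglongrightarrow> 0)"

text \<open>A curve in \<open>L2\<close>, regarded as a (class of a) measurable function on space-time.\<close>

definition spacetime_rep :: "(real \<Rightarrow> real \<Rightarrow> real) \<Rightarrow> (real \<Rightarrow> real \<Rightarrow> real) \<Rightarrow> bool" where
  "spacetime_rep u U \<longleftrightarrow>
     case_prod U \<in> borel_measurable (lebesgue_on ({0<..} \<times> {0<..<1})) \<and>
     (AE t in lebesgue_on {0<..}. AE x in lebesgue_on {0<..<1}. U t x = u t x)"

definition Linfty :: "'a::euclidean_space set \<Rightarrow> ('a \<Rightarrow> real) \<Rightarrow> bool" where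
  "Linfty \<Omega> f \<longleftrightarrow> f \<in> borel_measurable (lebesgue_on \<Omega>) \<and>
     (\<exists>C. AE p in lebesgue_on \<Omega>. \<bar>f p\<bar> \<le> C)"

definition weak_star_limit ::
  "'a::euclidean_space set \<Rightarrow> (nat \<Rightarrow> 'a \<Rightarrow> real) \<Rightarrow> ('a \<Rightarrow> real) \<Rightarrow> bool" where
  "weak_star_limit \<Omega> F f \<longleftrightarrow> Linfty \<Omega> f \<and>
     (\<forall>\<psi>. integrable (lebesgue_on \<Omega>) \<psi> \<longrightarrow>
        (\<lambda>k. LINT p|lebesgue_on \<Omega>. F k p * \<psi> p) \<longlonglongrightarrow> (LINT p|lebesgue_on \<Omega>. f p * \<psi> p))"

end

theory Submission
  imports Defs "HOL-Probability.Helly_Selection"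
begin

text \<open>Let \<open>u\<^sub>k\<close> be the semidiscrete solutions, \<open>v\<^sub>k\<close> their fluxes and \<open>f\<^sub>k = D\<^sup>- v\<^sub>k\<close> their time
derivatives, all regarded as step functions of \<open>x\<close>. Three facts about the scheme are used. The total
variation of \<open>u\<^sub>k\<close> does not increase (\<open>TV_nonincreasing\<close>); its mean is conserved, so \<open>u\<^sub>k\<close> is uniformly
bounded (\<open>uniform_bound\<close>); and the discrete energy decreases at the rate given by the square of the norm
of \<open>f\<^sub>k\<close>, so the \<open>f\<^sub>k\<close> are bounded in \<open>L\<^sup>2\<close> of space-time (\<open>energy_dissipation\<close>).

A bounded sequence in \<open>L\<^sup>2\<close> has convex combinations of its tails that converge strongly
(\<open>L2_bounded_tail_mixtures\<close>); this replaces weak compactness and produces the limit \<open>g\<close> of the time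
derivatives. Strong convergence in space-time gives convergence in \<open>L\<^sup>2((0,1))\<close> on almost every time
slice. Everything that concerns one time is therefore proved on a slice, for all test functions at once,
so that the exceptional null set of times does not depend on the test function.

On a slice, the primitive of \<open>f\<^sub>k\<close> interpolates the flux \<open>v\<^sub>k\<close> at the nodes and vanishes at both ends. Mixing
and passing to the limit, the primitive of \<open>g(t,\<cdot>)\<close> is the limit of the mixed fluxes and vanishes at both
ends; the weak* limit \<open>v\<close> has to agree with it (\<open>flux_limit\<close>, \<open>weak_limit_eq\<close>). This is at once the
\<open>W\<^sup>1\<^sup>,\<^sup>1\<close> regularity of \<open>v(t,\<cdot>)\<close>, its boundary condition and the equation \<open>u\<^sub>t = v\<^sub>x\<close>, once \<open>g\<close> is known
to be the weak time derivative of \<open>u\<close>, which is linear in \<open>u\<^sub>k\<close> and so survives mixing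
(\<open>weak_time_derivative\<close>). The bound on the total variation and Helly's selection theorem give the
representation of \<open>u(t,\<cdot>)\<close> by two finite measures (\<open>bounded_variation_limit\<close>).

The sign condition is not linear: the mixtures of \<open>u\<^sub>k\<close> and \<open>v\<^sub>k\<close> do not inherit it. For \<open>\<eta> \<ge> 0\<close>, however, the
nonnegative sum of \<open>\<eta> v\<^sub>k\<close> against the jumps of \<open>u\<^sub>k\<close> equals \<open>- \<integral> u\<^sub>k (\<eta> V\<^sub>k)'\<close> exactly, where \<open>V\<^sub>k\<close> is the
primitive of \<open>f\<^sub>k\<close> (\<open>discrete_sign\<close>). Along a subsequence \<open>u\<^sub>k\<close> approaches \<open>u\<close> faster than the norm of
\<open>f\<^sub>k\<close> can grow on almost every slice, so \<open>u\<^sub>k\<close> may be replaced by \<open>u\<close>; what is left is linear in \<open>f\<^sub>k\<close>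
and can be mixed (\<open>limit_sign\<close>). The limit says that \<open>v(t,\<cdot>) Du(t,\<cdot>)\<close> is nonnegative against every
\<open>\<eta> \<ge> 0\<close>, and letting \<open>\<eta>\<close> tend to indicators of intervals gives the inequality on all Borel sets
(\<open>signed_measure_nonneg\<close>).\<close>

section \<open>The nonlinearity and the semidiscrete flow\<close>

lemma admissible_phi_DERIV:
  assumes "admissible_phi \<phi>"
  shows "(\<phi> has_real_derivative deriv \<phi> s) (at s)"
    and "(deriv \<phi> has_real_derivative deriv (deriv \<phi>) s) (at s)"
  using assms unfolding admissible_phi_def
  by (auto simp: DERIV_deriv_iff_real_differentiable)

lemma admissible_phi_deriv_odd:
  assumes "admissible_phi \<phi>"
  shows "deriv \<phi> (- s) = - deriv \<phi> s"
proof -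
  have "((\<lambda>x. \<phi> (- x)) has_real_derivative deriv \<phi> (- s) * (- 1)) (at s)"
    by (rule DERIV_chain2[where f = \<phi>])
       (auto intro!: derivative_eq_intros admissible_phi_DERIV[OF assms])
  moreover have "(\<lambda>x. \<phi> (- x)) = \<phi>"
    using assms unfolding admissible_phi_def by auto
  ultimately show ?thesis
    using admissible_phi_DERIV(1)[OF assms, of s] by (auto dest: DERIV_unique)
qed

lemma admissible_phi_deriv_0:
  assumes "admissible_phi \<phi>"
  shows "deriv \<phi> 0 = 0"
  using admissible_phi_deriv_odd[OF assms, of 0] by simp

lemma admissible_phi_deriv_bounds:
  assumes "admissible_phi \<phi>"
  obtains C where "C \<ge> 0" "\<And>s. \<bar>deriv \<phi> s\<bar> \<le> C" "\<And>s. 0 \<le> s \<Longrightarrow> 0 \<le> deriv \<phi> s"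
proof -
  obtain \<sigma> where \<sigma>: "\<sigma> > 0" "mono_on {0..\<sigma>} (deriv \<phi>)" "antimono_on {\<sigma>..} (deriv \<phi>)"
    and lim: "(deriv \<phi> \<longlongrightarrow> 0) at_top"
    using assms unfolding admissible_phi_def by auto
  have nonneg: "0 \<le> deriv \<phi> s" if "0 \<le> s" for s
  proof (cases "s \<le> \<sigma>")
    case True
    then show ?thesis
      using mono_onD[OF \<sigma>(2), of 0 s] that admissible_phi_deriv_0[OF assms] by auto
  next
    case False
    have "eventually (\<lambda>y. deriv \<phi> y \<le> deriv \<phi> s) at_top"
      using \<sigma>(3) False
      by (intro eventually_mono[OF eventually_ge_at_top[of s]]) (auto simp: monotone_on_def)
    then show ?thesis
      by (rule tendsto_upperbound[OF lim]) simp
  qed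
  have upper: "deriv \<phi> s \<le> deriv \<phi> \<sigma>" if "0 \<le> s" for s
  proof (cases "s \<le> \<sigma>")
    case True
    then show ?thesis
      using mono_onD[OF \<sigma>(2), of s \<sigma>] that by auto
  next
    case False
    then show ?thesis
      using \<sigma>(3) by (auto simp: monotone_on_def)
  qed
  have "\<bar>deriv \<phi> s\<bar> \<le> deriv \<phi> \<sigma>" for s
  proof (cases "0 \<le> s")
    case True
    then show ?thesis using nonneg upper by auto
  next
    case False
    then show ?thesis
      using nonneg[of "- s"] upper[of "- s"] by (auto simp: admissible_phi_deriv_odd[OF assms])
  qed
  moreover have "deriv \<phi> \<sigma> \<ge> 0" using nonneg \<sigma> by auto
  ultimately show thesis using nonneg that by blast
qed

lemma admissible_phi_deriv_sign:
  assumes "admissible_phi \<phi>"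
  shows "0 \<le> deriv \<phi> s * s"
proof -
  obtain C where C: "\<And>s. 0 \<le> s \<Longrightarrow> 0 \<le> deriv \<phi> s"
    using admissible_phi_deriv_bounds[OF assms] by blast
  show ?thesis
    using C[of s] C[of "- s"] admissible_phi_deriv_odd[OF assms, of s]
    by (cases "0 \<le> s") (auto simp: zero_le_mult_iff)
qed

lemma admissible_phi_deriv_Lipschitz:
  assumes "admissible_phi \<phi>"
  obtains L where "L \<ge> 0" "\<And>s. \<bar>deriv \<phi> s\<bar> \<le> L * \<bar>s\<bar>"
proof -
  obtain L where L: "\<And>s. norm (deriv (deriv \<phi>) s) \<le> L"
    using assms unfolding admissible_phi_def bounded_iff by auto
  have "norm (deriv \<phi> s - deriv \<phi> 0) \<le> L * norm (s - 0)" for s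
    by (rule field_differentiable_bound[of UNIV])
       (use L in \<open>auto intro!: DERIV_subset[OF admissible_phi_DERIV(2)[OF assms]]\<close>)
  then have "\<bar>deriv \<phi> s\<bar> \<le> L * \<bar>s\<bar>" for s
    using admissible_phi_deriv_0[OF assms] by auto
  moreover have "0 \<le> L" using L[of 0] norm_ge_zero order_trans by blast
  ultimately show thesis using that by blast
qed

lemma admissible_phi_nonneg:
  assumes "admissible_phi \<phi>"
  shows "0 \<le> \<phi> s"
proof -
  obtain C where C: "\<And>s. 0 \<le> s \<Longrightarrow> 0 \<le> deriv \<phi> s"
    using admissible_phi_deriv_bounds[OF assms] by blast
  have *: "\<phi> 0 \<le> \<phi> s" if "0 \<le> s" for s
    by (rule DERIV_nonneg_imp_nondecreasing[OF that])
       (use C admissible_phi_DERIV(1)[OF assms] in blast)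
  have "\<phi> 0 = 0" "\<phi> (- s) = \<phi> s"
    using assms by (auto simp: admissible_phi_def)
  then show ?thesis using *[of s] *[of "- s"] by (cases "0 \<le> s") auto
qed

lemma admissible_phi_growth:
  assumes "admissible_phi \<phi>" "\<And>s. \<bar>deriv \<phi> s\<bar> \<le> C"
  shows "\<phi> s \<le> C * \<bar>s\<bar>"
proof -
  have "norm (\<phi> s - \<phi> 0) \<le> C * norm (s - 0)"
    by (rule field_differentiable_bound[of UNIV])
       (use assms(2) in \<open>auto intro!: DERIV_subset[OF admissible_phi_DERIV(1)[OF assms(1)]]\<close>)
  then show ?thesis using assms(1) by (auto simp: admissible_phi_def)
qed

lemma sum_int_telescope:
  fixes f :: "int \<Rightarrow> real"
  assumes "a - 1 \<le> b"
  shows "(\<Sum>i=a..b. f i - f (i - 1)) = f b - f (a - 1)"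
  using assms
proof (induction b rule: int_ge_induct)
  case base
  then show ?case by simp
next
  case (step b)
  then have "{a..b + 1} = insert (b + 1) {a..b}" by auto
  with step show ?case by simp
qed

lemma sum_int_shift:
  fixes f :: "int \<Rightarrow> 'a::comm_monoid_add"
  shows "(\<Sum>i=a..b. f (i + 1)) = (\<Sum>i=a+1..b+1. f i)"
  by (rule sum.reindex_bij_witness[of _ "\<lambda>i. i - 1" "\<lambda>i. i + 1"]) auto

text \<open>The derivative at \<open>0\<close> is one-sided, because the scheme is only posed for nonnegative times.\<close>

lemma mean_value_bound_within:
  fixes f :: "real \<Rightarrow> real"
  assumes "0 \<le> T" "\<And>t. 0 \<le> t \<Longrightarrow> (f has_real_derivative f' t) (at t within {0..})"
    and "\<And>t. 0 \<le> t \<Longrightarrow> f' t \<le> K"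
  shows "f T \<le> f 0 + K * T"
proof -
  have "\<exists>x\<in>{0..T}. f T - f 0 = f' x * (T - 0)"
    by (rule mvt_very_simple[OF assms(1)])
       (auto intro!: has_derivative_subset[OF assms(2)[unfolded has_field_derivative_def]])
  then obtain x where "0 \<le> x" "f T - f 0 = f' x * T" by auto
  then show ?thesis
    using mult_right_mono[OF assms(3)[of x] assms(1)] by simp
qed

text \<open>One solution of the scheme on a fixed mesh. Values of \<open>w\<close> at negative times or outside \<open>{1..n}\<close> are
arbitrary. The time derivative of \<open>w\<close> is the function \<open>rate\<close> introduced below.\<close>

locale semidiscrete_flow =
  fixes \<phi> :: "real \<Rightarrow> real" and n :: nat and w :: "real \<Rightarrow> int \<Rightarrow> real"
  assumes adm: "admissible_phi \<phi>" and n_pos: "0 < n"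
    and ode: "\<And>t i. 0 \<le> t \<Longrightarrow> i \<in> {1..int n} \<Longrightarrow>
      ((\<lambda>s. w s i) has_real_derivative Dminus n (flux \<phi> n (w t)) i) (at t within {0..})"
begin

abbreviation v where "v t \<equiv> flux \<phi> n (w t)"
abbreviation rate where "rate t \<equiv> Dminus n (v t)"

lemma flux_inner: "i \<in> {1..int n - 1} \<Longrightarrow> v t i = deriv \<phi> (n * (w t (i + 1) - w t i))"
  by (auto simp: flux_def Dplus_def neumann_ext_def)

lemma flux_boundary: "v t 0 = 0" "v t (int n) = 0"
  using n_pos admissible_phi_deriv_0[OF adm]
  by (auto simp: flux_def Dplus_def neumann_ext_def)

lemma flux_sign: "i \<in> {1..int n - 1} \<Longrightarrow> 0 \<le> v t i * (w t (i + 1) - w t i)"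
  using admissible_phi_deriv_sign[OF adm, of "n * (w t (i + 1) - w t i)"] n_pos
  by (auto simp: flux_inner zero_le_mult_iff mult_le_0_iff)

lemma continuous_w: "i \<in> {1..int n} \<Longrightarrow> continuous_on {0..} (\<lambda>t. w t i)"
  by (rule DERIV_continuous_on) (use ode in auto)

lemma continuous_flux:
  assumes "i \<in> {0..int n}"
  shows "continuous_on {0..} (\<lambda>t. v t i)"
proof -
  consider "i = 0" | "i = int n" | "i \<in> {1..int n - 1}" using assms by fastforce
  then show ?thesis
  proof cases
    case 3
    have "continuous_on UNIV (deriv \<phi>)"
      by (rule DERIV_continuous_on) (use admissible_phi_DERIV(2)[OF adm] in auto)
    then show ?thesis
      using 3 unfolding flux_inner[OF 3]
      by (auto intro!: continuous_on_compose2[of UNIV "deriv \<phi>" _ "\<lambda>t. real n * (w t (i + 1) - w t i)"]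
          continuous_on_mult continuous_on_diff continuous_on_const continuous_w)
  qed (auto simp: flux_boundary)
qed

lemma continuous_rate: "i \<in> {1..int n} \<Longrightarrow> continuous_on {0..} (\<lambda>t. rate t i)"
  unfolding Dminus_def by (intro continuous_intros continuous_flux) auto

lemma ode_difference:
  assumes "0 \<le> t" "i \<in> {1..int n - 1}"
  shows "((\<lambda>s. w s (i + 1) - w s i) has_real_derivative
     (rate t (i + 1) - rate t i)) (at t within {0..})"
  using assms by (intro DERIV_diff ode) auto

text \<open>A jump \<open>w(i+1) - w(i)\<close> has the sign of its flux \<open>v(i)\<close>. Differentiating the sum of the absolute jumps
formally, the own flux of a jump pulls it towards zero with full strength, while the neighbouring fluxes
can push it away at most by their absolute values; the second differences of \<open>\<bar>v\<bar>\<close> add up to something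
nonpositive. Since the absolute value is not differentiable at zero, it is replaced by
\<open>sqrt (s\<^sup>2 + \<epsilon>\<^sup>2)\<close>, which costs only a multiple of \<open>\<epsilon>\<close> because the flux is Lipschitz in the jump.\<close>

lemma TV_nonincreasing:
  assumes T: "0 \<le> T"
  shows "TV n (w T) \<le> TV n (w 0)"
proof -
  obtain L where L: "L \<ge> 0" "\<And>s. \<bar>deriv \<phi> s\<bar> \<le> L * \<bar>s\<bar>"
    using admissible_phi_deriv_Lipschitz[OF adm] by blast
  let ?I = "{1..int n - 1}"
  define D where "D t i = w t (i + 1) - w t i" for t i
  define K where "K = real n * (\<Sum>i\<in>?I. 2 * (L * real n))"
  have regularised: "TV n (w T) \<le> TV n (w 0) + \<epsilon> * (real (card ?I) + K * T)" if \<epsilon>: "0 < \<epsilon>" for \<epsilon>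
  proof -
    define S where "S t i = sqrt ((D t i)\<^sup>2 + \<epsilon>\<^sup>2)" for t i
    have pos: "0 < (D t i)\<^sup>2 + \<epsilon>\<^sup>2" for t i
      using \<epsilon> by (simp add: add_nonneg_pos)
    have S_pos: "0 < S t i" for t i unfolding S_def using pos by simp
    have S_lower: "\<bar>D t i\<bar> \<le> S t i" for t i
      unfolding S_def by (rule real_le_rsqrt) simp
    have S_upper: "S t i \<le> \<bar>D t i\<bar> + \<epsilon>" for t i
      using sqrt_add_le_add_sqrt[of "(D t i)\<^sup>2" "\<epsilon>\<^sup>2"] \<epsilon> by (simp add: S_def)
    define J where "J t = (\<Sum>i\<in>?I. S t i)" for t
    define J' where "J' t = (\<Sum>i\<in>?I. (rate t (i + 1) - rate t i) * (D t i / S t i))" for t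
    have der: "(J has_real_derivative J' t) (at t within {0..})" if "0 \<le> t" for t
      unfolding J_def J'_def
    proof (rule DERIV_sum)
      fix i assume i: "i \<in> ?I"
      have "(((\<lambda>s. (D s i)\<^sup>2 + \<epsilon>\<^sup>2)) has_real_derivative
          2 * D t i * (rate t (i + 1) - rate t i)) (at t within {0..})"
        unfolding D_def by (rule derivative_eq_intros ode_difference that i refl | simp)+
      from DERIV_chain2[OF DERIV_real_sqrt[OF pos] this]
      show "((\<lambda>t. S t i) has_real_derivative
          (rate t (i + 1) - rate t i) * (D t i / S t i)) (at t within {0..})"
        unfolding S_def by (rule DERIV_cong) (simp add: divide_simps)
    qed
    have "J' t \<le> \<epsilon> * K" for t
    proof -
      have "(rate t (i + 1) - rate t i) * (D t i / S t i) \<le>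
         real n * ((\<bar>v t (i + 1)\<bar> - \<bar>v t i\<bar>) - (\<bar>v t i\<bar> - \<bar>v t (i - 1)\<bar>)) + real n * (2 * (\<epsilon> * (L * real n)))"
        if i: "i \<in> ?I" for i
      proof -
        define q where "q = D t i / S t i"
        have q: "\<bar>q\<bar> \<le> 1" unfolding q_def using S_lower[of t i] S_pos[of t i] by (simp add: abs_divide)
        have vq: "v t i * q = \<bar>v t i\<bar> * \<bar>q\<bar>"
        proof -
          have "0 \<le> v t i * q"
            using flux_sign[OF i, of t] S_pos[of t i] unfolding q_def D_def
            by (metis divide_nonneg_pos times_divide_eq_right)
          then show ?thesis by (metis abs_mult abs_of_nonneg)
        qed
        have "\<bar>v t i\<bar> \<le> L * (real n * \<bar>D t i\<bar>)"
          using L(2)[of "n * (w t (i + 1) - w t i)"] unfolding flux_inner[OF i] D_def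
          by (simp add: abs_mult)
        also have "\<dots> \<le> L * (real n * S t i)"
          using L(1) S_lower by (intro mult_left_mono) auto
        finally have "\<bar>v t i\<bar> * (1 - \<bar>q\<bar>) \<le> L * (real n * S t i) * (1 - \<bar>q\<bar>)"
          using q by (intro mult_right_mono) auto
        also have "\<dots> = L * real n * (S t i - \<bar>D t i\<bar>)"
          unfolding q_def using S_pos[of t i] by (simp add: abs_divide field_simps)
        \<comment> \<open>For small jumps the regularised sign \<open>q\<close> is weak, but then the flux is small as well.\<close>
        also have "\<dots> \<le> L * real n * \<epsilon>"
          using S_upper[of t i] L(1) by (intro mult_left_mono) auto
        finally have defect: "\<bar>v t i\<bar> - v t i * q \<le> \<epsilon> * (L * real n)"
          unfolding vq by (simp add: algebra_simps)
        have nb: "v t j * q \<le> \<bar>v t j\<bar>" for j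
        proof -
          have "\<bar>v t j * q\<bar> \<le> \<bar>v t j\<bar> * 1" unfolding abs_mult by (intro mult_left_mono q) auto
          then show ?thesis by simp
        qed
        have "(rate t (i + 1) - rate t i) * q
           = real n * (v t (i + 1) * q + v t (i - 1) * q - 2 * (v t i * q))"
          unfolding Dminus_def by (simp add: algebra_simps)
        also have "\<dots> \<le> real n * (\<bar>v t (i + 1)\<bar> + \<bar>v t (i - 1)\<bar> - 2 * (\<bar>v t i\<bar> - \<epsilon> * (L * real n)))"
          using nb[of "i+1"] nb[of "i-1"] defect by (intro mult_left_mono) auto
        finally show ?thesis unfolding q_def by (simp add: algebra_simps)
      qed
      then have "J' t \<le> (\<Sum>i\<in>?I. real n * ((\<bar>v t (i + 1)\<bar> - \<bar>v t i\<bar>) - (\<bar>v t i\<bar> - \<bar>v t (i - 1)\<bar>))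
          + real n * (2 * (\<epsilon> * (L * real n))))"
        unfolding J'_def by (intro sum_mono) auto
      also have "\<dots> = real n * (\<Sum>i\<in>?I. ((\<bar>v t (i + 1)\<bar> - \<bar>v t i\<bar>) - (\<bar>v t (i - 1 + 1)\<bar> - \<bar>v t (i - 1)\<bar>)))
          + \<epsilon> * K"
        unfolding K_def sum.distrib sum_distrib_left[symmetric] by (simp add: algebra_simps)
      also have "(\<Sum>i\<in>?I. ((\<bar>v t (i + 1)\<bar> - \<bar>v t i\<bar>) - (\<bar>v t (i - 1 + 1)\<bar> - \<bar>v t (i - 1)\<bar>)))
          = (\<bar>v t (int n - 1 + 1)\<bar> - \<bar>v t (int n - 1)\<bar>) - (\<bar>v t (1 - 1 + 1)\<bar> - \<bar>v t (1 - 1)\<bar>)"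
        using sum_int_telescope[of 1 "int n - 1" "\<lambda>i. \<bar>v t (i + 1)\<bar> - \<bar>v t i\<bar>"] n_pos by simp
      also have "real n * \<dots> \<le> 0"
        by (intro mult_nonneg_nonpos) (auto simp: flux_boundary)
      finally show ?thesis by simp
    qed
    from mean_value_bound_within[OF T der this]
    have "J T \<le> J 0 + \<epsilon> * K * T" by simp
    moreover have "TV n (w T) \<le> J T"
      unfolding TV_def J_def using S_lower by (intro sum_mono) (auto simp: D_def)
    moreover have "J 0 \<le> TV n (w 0) + \<epsilon> * real (card ?I)"
    proof -
      have "J 0 \<le> (\<Sum>i\<in>?I. \<bar>D 0 i\<bar> + \<epsilon>)"
        unfolding J_def using S_upper by (intro sum_mono) auto
      then show ?thesis by (simp add: sum.distrib TV_def D_def mult.commute)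
    qed
    ultimately show ?thesis by (simp add: algebra_simps)
  qed
  have "((\<lambda>\<epsilon>. TV n (w 0) + \<epsilon> * (real (card ?I) + K * T)) \<longlongrightarrow> TV n (w 0) + 0 * (real (card ?I)
      + K * T)) (at_right 0)"
    by (intro tendsto_intros)
  then have "TV n (w T) \<le> TV n (w 0) + 0 * (real (card ?I) + K * T)"
    by (rule tendsto_lowerbound)
       (rule eventually_mono[OF eventually_at_right_less[of "0::real"]], erule regularised, simp)
  then show ?thesis by simp
qed

text \<open>The rates telescope to the difference of the two boundary fluxes, which vanish.\<close>

lemma mean_conserved:
  assumes "0 \<le> T"
  shows "(\<Sum>i=1..int n. w T i) = (\<Sum>i=1..int n. w 0 i)"
proof -
  have sum0: "(\<Sum>i=1..int n. rate t i) = 0" for t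
    unfolding Dminus_def sum_distrib_left[symmetric]
    by (subst sum_int_telescope) (auto simp: flux_boundary)
  have der: "((\<lambda>t. \<Sum>i=1..int n. c * w t i) has_real_derivative 0) (at t within {0..})" if "0 \<le> t" for t c
  proof -
    have "((\<lambda>t. \<Sum>i=1..int n. c * w t i) has_real_derivative (\<Sum>i=1..int n. c * rate t i)) (at t within {0..})"
      by (intro DERIV_sum DERIV_cmult ode that)
    then show ?thesis by (simp add: sum_distrib_left[symmetric] sum0)
  qed
  have "(\<Sum>i=1..int n. c * w T i) \<le> (\<Sum>i=1..int n. c * w 0 i)" for c
    using mean_value_bound_within[OF assms der, of 0 c] by simp
  from this[of 1] this[of "- 1"] show ?thesis by (simp add: sum_negf)
qed

end

lemma TV_diff_le:
  assumes "i \<in> {1..int n}" "j \<in> {1..int n}"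
  shows "\<bar>a i - a j\<bar> \<le> TV n a"
proof -
  have *: "\<bar>a q - a p\<bar> \<le> TV n a" if "p \<le> q" "p \<in> {1..int n}" "q \<in> {1..int n}" for p q
  proof -
    have "a q - a p = (\<Sum>i=p+1..q. a i - a (i - 1))"
      using sum_int_telescope[of "p + 1" q a] that by simp
    also have "\<dots> = (\<Sum>i=p..q-1. a (i + 1) - a i)"
      using sum_int_shift[of "\<lambda>i. a i - a (i - 1)" p "q - 1"] by simp
    finally have "\<bar>a q - a p\<bar> \<le> (\<Sum>i=p..q-1. \<bar>a (i + 1) - a i\<bar>)"
      by (metis sum_abs)
    also have "\<dots> \<le> TV n a"
      unfolding TV_def using that by (intro sum_mono2) auto
    finally show ?thesis .
  qed
  show ?thesis
    using *[of i j] *[of j i] assms by (cases "i \<le> j") (auto simp: abs_minus_commute)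
qed

lemma sup_norm_nonneg: "0 < n \<Longrightarrow> 0 \<le> sup_norm n a"
  unfolding sup_norm_def by (rule order_trans[OF abs_ge_zero[of "a 1"] Max_ge]) auto

lemma sup_norm_ge: "i \<in> {1..int n} \<Longrightarrow> \<bar>a i\<bar> \<le> sup_norm n a"
  unfolding sup_norm_def by (rule Max_ge) auto

context semidiscrete_flow
begin

text \<open>A function differs from its mean by at most its total variation, and the mean is conserved.\<close>

lemma uniform_bound:
  assumes "0 \<le> T" "i \<in> {1..int n}"
  shows "\<bar>w T i\<bar> \<le> sup_norm n (w 0) + TV n (w 0)"
proof -
  have "real n * \<bar>w T i\<bar> = \<bar>\<Sum>j=1..int n. w T i\<bar>"
    by (simp add: abs_mult)
  also have "(\<Sum>j=1..int n. w T i) = (\<Sum>j=1..int n. w T i - w T j) + (\<Sum>j=1..int n. w 0 j)"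
    using mean_conserved[OF assms(1)] by (simp add: sum_subtractf)
  also have "\<bar>\<dots>\<bar> \<le> (\<Sum>j=1..int n. \<bar>w T i - w T j\<bar>) + (\<Sum>j=1..int n. \<bar>w 0 j\<bar>)"
    by (intro order_trans[OF abs_triangle_ineq] add_mono sum_abs)
  also have "\<dots> \<le> (\<Sum>j=1..int n. TV n (w 0)) + (\<Sum>j=1..int n. sup_norm n (w 0))"
    using TV_diff_le[OF assms(2)] TV_nonincreasing[OF assms(1)]
    by (intro add_mono sum_mono sup_norm_ge) (auto intro: order_trans)
  also have "\<dots> = real n * (sup_norm n (w 0) + TV n (w 0))"
    by (simp add: algebra_simps)
  finally show ?thesis using n_pos by simp
qed

text \<open>The discretisation of the integral of \<open>\<phi>(u\<^sub>x)\<close>, of which the scheme is the gradient flow.\<close>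

definition energy where
  "energy t = (\<Sum>i=1..int n - 1. \<phi> (n * (w t (i + 1) - w t i))) / n"

text \<open>Summation by parts: the boundary terms vanish because the flux does at both ends.\<close>

lemma energy_DERIV:
  assumes "0 \<le> t"
  shows "(energy has_real_derivative - ((\<Sum>i=1..int n. (rate t i)\<^sup>2) / n)) (at t within {0..})"
proof -
  let ?I = "{1..int n - 1}"
  have "((\<lambda>t. \<phi> (n * (w t (i + 1) - w t i))) has_real_derivative
      v t i * (n * (rate t (i + 1) - rate t i))) (at t within {0..})" if "i \<in> ?I" for i
    unfolding flux_inner[OF that]
    by (rule DERIV_chain2[OF admissible_phi_DERIV(1)[OF adm]] DERIV_cmult ode_difference assms that)+
  then have "(energy has_real_derivative (\<Sum>i\<in>?I. v t i * (n * (rate t (i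
      + 1) - rate t i))) / n) (at t within {0..})"
    unfolding energy_def by (intro DERIV_cdivide DERIV_sum)
  moreover have "(\<Sum>i\<in>?I. v t i * (n * (rate t (i + 1) - rate t i))) = - (\<Sum>i=1..int n. (rate t i)\<^sup>2)"
  proof -
    have "(\<Sum>i=1..int n. (rate t i)\<^sup>2) = (\<Sum>i\<in>?I. (rate t i)\<^sup>2) + (rate t (int n))\<^sup>2"
    proof -
      have "{1..int n} = insert (int n) ?I" using n_pos by auto
      then show ?thesis by simp
    qed
    also have "(rate t (int n))\<^sup>2 = - n * (v t (int n - 1) * rate t (int n))"
      by (simp add: power2_eq_square Dminus_def flux_boundary)
    also have "v t (int n - 1) * rate t (int n) =
      (\<Sum>i\<in>?I. v t i * rate t (i + 1) - v t (i - 1) * rate t (i - 1 + 1))"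
      using sum_int_telescope[of 1 "int n - 1" "\<lambda>i. v t i * rate t (i + 1)"] n_pos
      by (simp add: flux_boundary)
    finally have "(\<Sum>i=1..int n. (rate t i)\<^sup>2) =
       (\<Sum>i\<in>?I. (rate t i)\<^sup>2 - n * (v t i * rate t (i + 1) - v t (i - 1) * rate t i))"
      by (simp add: sum_subtractf flip: sum_distrib_left)
    also have "\<dots> = (\<Sum>i\<in>?I. - (v t i * (n * (rate t (i + 1) - rate t i))))"
      by (intro sum.cong refl) (simp add: Dminus_def power2_eq_square algebra_simps)
    finally show ?thesis by (simp add: sum_negf)
  qed
  ultimately show ?thesis by simp
qed

lemma energy_nonneg: "0 \<le> energy t"
  unfolding energy_def by (intro divide_nonneg_nonneg sum_nonneg admissible_phi_nonneg[OF adm]) auto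

lemma energy_le:
  assumes "\<And>s. \<bar>deriv \<phi> s\<bar> \<le> C"
  shows "energy t \<le> C * TV n (w t)"
proof -
  have "energy t \<le> (\<Sum>i=1..int n - 1. C * \<bar>n * (w t (i + 1) - w t i)\<bar>) / n"
    unfolding energy_def
    by (intro divide_right_mono sum_mono admissible_phi_growth adm assms) auto
  also have "\<dots> = C * TV n (w t)"
    using n_pos unfolding TV_def by (simp add: abs_mult sum_distrib_left sum_divide_distrib)
  finally show ?thesis .
qed

text \<open>The energy is nonnegative and at most \<open>C\<close> times the total variation, since \<open>\<phi>\<close> grows at most linearly.
The bound therefore depends on the mesh only through the initial total variation.\<close>

lemma energy_dissipation:
  assumes "\<And>s. \<bar>deriv \<phi> s\<bar> \<le> C"
  shows "(\<integral>\<^sup>+t. indicator {0<..} t * ennreal ((\<Sum>i=1..int n. (rate t i)\<^sup>2) / n) \<partial>lborel)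
    \<le> ennreal (C * TV n (w 0))"
proof -
  define Q where "Q t = (\<Sum>i=1..int n. (rate t i)\<^sup>2) / n" for t
  have Q0: "0 \<le> Q t" for t unfolding Q_def by (intro divide_nonneg_nonneg sum_nonneg) auto
  have contQ: "continuous_on {0..} Q"
    unfolding Q_def by (intro continuous_intros continuous_rate) (use n_pos in auto)
  have int: "((\<lambda>t. Q t) has_integral (energy 0 - energy T)) {0..T}" if "0 \<le> T" for T
  proof -
    have "(Q has_integral (- energy T - - energy 0)) {0..T}"
    proof (rule fundamental_theorem_of_calculus[OF that])
      fix t assume t: "t \<in> {0..T}"
      have "(energy has_real_derivative - Q t) (at t within {0..})"
        using energy_DERIV[of t] t unfolding Q_def by auto
      then have "((\<lambda>t. - energy t) has_real_derivative Q t) (at t within {0..})"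
        using DERIV_minus by fastforce
      then show "((\<lambda>t. - energy t) has_vector_derivative Q t) (at t within {0..T})"
        unfolding has_real_derivative_iff_has_vector_derivative
        by (rule has_vector_derivative_within_subset) auto
    qed
    then show ?thesis by simp
  qed
  have meas: "(\<lambda>t. indicator {0..} t *\<^sub>R Q t) \<in> borel_measurable borel"
    by (rule borel_measurable_continuous_on_indicator) (use contQ in auto)
  have bound: "(\<integral>\<^sup>+t. ennreal (indicator {0..real m} t * Q t) \<partial>lborel) \<le> ennreal (C * TV n (w 0))"
      for m :: nat
  proof -
    have "(\<integral>\<^sup>+t. ennreal (indicator {0..real m} t * Q t) \<partial>lborel) = ennreal (energy 0 - energy (real m))"
    proof (rule nn_integral_has_integral_lborel)
      have "(\<lambda>t. indicator {0..real m} t * (indicator {0..} t *\<^sub>R Q t)) \<in> borel_measurable borel"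
        using meas by measurable
      then show "(\<lambda>t. indicator {0..real m} t * Q t) \<in> borel_measurable borel"
        by (rule measurable_cong[THEN iffD1, rotated]) (auto simp: indicator_def)
      show "0 \<le> indicator {0..real m} t * Q t" for t using Q0 by auto
      show "((\<lambda>t. indicator {0..real m} t * Q t) has_integral energy 0 - energy (real m)) UNIV"
        using has_integral_restrict_UNIV[of "{0..real m}" Q, THEN iffD2, OF int[of m]]
        by (rule has_integral_cong[THEN iffD1, rotated]) (auto simp: indicator_def)
    qed
    also have "\<dots> \<le> ennreal (C * TV n (w 0))"
      using energy_le[OF assms, of 0] energy_nonneg[of m] by (intro ennreal_leI) auto
    finally show ?thesis .
  qed
  have "(\<integral>\<^sup>+t. indicator {0<..} t * ennreal (Q t) \<partial>lborel) \<le>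
    (\<integral>\<^sup>+t. (SUP m::nat. ennreal (indicator {0..real m} t * Q t)) \<partial>lborel)"
  proof (rule nn_integral_mono)
    fix t :: real
    obtain m :: nat where "t \<le> real m" using real_arch_simple by blast
    then show "indicator {0<..} t * ennreal (Q t) \<le> (SUP m::nat. ennreal (indicator {0..real m} t * Q t))"
      by (intro SUP_upper2[of m]) (auto simp: indicator_def)
  qed
  also have "\<dots> = (SUP m::nat. \<integral>\<^sup>+t. ennreal (indicator {0..real m} t * Q t) \<partial>lborel)"
  proof (rule nn_integral_monotone_convergence_SUP)
    show "incseq (\<lambda>m t. ennreal (indicator {0..real m} t * Q t))"
      using Q0 by (auto simp: incseq_def le_fun_def indicator_def intro!: ennreal_leI)
    show "(\<lambda>t. ennreal (indicator {0..real m} t * Q t)) \<in> borel_measurable lborel" for m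
    proof -
      have "(\<lambda>t. indicator {0..real m} t * (indicator {0..} t *\<^sub>R Q t)) \<in> borel_measurable borel"
        using meas by measurable
      then have "(\<lambda>t. indicator {0..real m} t * Q t) \<in> borel_measurable borel"
        by (rule measurable_cong[THEN iffD1, rotated]) (auto simp: indicator_def)
      then show ?thesis by simp
    qed
  qed
  also have "\<dots> \<le> ennreal (C * TV n (w 0))" using bound by (intro SUP_least)
  finally show ?thesis unfolding Q_def .
qed

end

section \<open>Convex combinations of tails and strong limits in \<open>L\<^sup>2\<close>\<close>

lemma square_integrable_add:
  fixes f g :: "'a \<Rightarrow> real"
  assumes [measurable]: "f \<in> borel_measurable M" "g \<in> borel_measurable M"
    and "integrable M (\<lambda>x. (f x)\<^sup>2)" "integrable M (\<lambda>x. (g x)\<^sup>2)"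
  shows "integrable M (\<lambda>x. (f x + g x)\<^sup>2)"
proof (rule Bochner_Integration.integrable_bound[where f = "\<lambda>x. 2 * (f x)\<^sup>2 + 2 * (g x)\<^sup>2"])
  show "AE x in M. norm ((f x + g x)\<^sup>2) \<le> norm (2 * (f x)\<^sup>2 + 2 * (g x)\<^sup>2)"
  proof (rule AE_I2)
    fix x
    have "0 \<le> (f x - g x)\<^sup>2" by simp
    then have "(f x + g x)\<^sup>2 \<le> 2 * (f x)\<^sup>2 + 2 * (g x)\<^sup>2"
      by (simp add: power2_sum power2_diff)
    then show "norm ((f x + g x)\<^sup>2) \<le> norm (2 * (f x)\<^sup>2 + 2 * (g x)\<^sup>2)" by simp
  qed
qed (use assms in auto)

lemma square_integrable_diff:
  fixes f g :: "'a \<Rightarrow> real"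
  assumes [measurable]: "f \<in> borel_measurable M" "g \<in> borel_measurable M"
    and "integrable M (\<lambda>x. (f x)\<^sup>2)" "integrable M (\<lambda>x. (g x)\<^sup>2)"
  shows "integrable M (\<lambda>x. (f x - g x)\<^sup>2)"
  using square_integrable_add[of f M "\<lambda>x. - g x"] assms by simp

lemma Cauchy_Schwarz_integral:
  fixes f g :: "'a \<Rightarrow> real"
  assumes [measurable]: "f \<in> borel_measurable M" "g \<in> borel_measurable M"
    and f: "integrable M (\<lambda>x. (f x)\<^sup>2)" and g: "integrable M (\<lambda>x. (g x)\<^sup>2)"
  shows "integrable M (\<lambda>x. f x * g x)"
    and "\<bar>LINT x|M. f x * g x\<bar> \<le> sqrt (LINT x|M. (f x)\<^sup>2) * sqrt (LINT x|M. (g x)\<^sup>2)"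
proof -
  show fg: "integrable M (\<lambda>x. f x * g x)"
  proof (rule Bochner_Integration.integrable_bound[where f = "\<lambda>x. (f x)\<^sup>2 + (g x)\<^sup>2"])
    show "AE x in M. norm (f x * g x) \<le> norm ((f x)\<^sup>2 + (g x)\<^sup>2)"
    proof (rule AE_I2)
      fix x
      have "0 \<le> (\<bar>f x\<bar> - \<bar>g x\<bar>)\<^sup>2" "0 \<le> \<bar>f x\<bar> * \<bar>g x\<bar>" by simp_all
      then have "\<bar>f x\<bar> * \<bar>g x\<bar> \<le> (f x)\<^sup>2 + (g x)\<^sup>2"
        unfolding power2_diff power2_abs mult.assoc by linarith
      then show "norm (f x * g x) \<le> norm ((f x)\<^sup>2 + (g x)\<^sup>2)"
        by (simp add: abs_mult)
    qed
  qed (use f g in auto)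
  define A B C where "A = (LINT x|M. (f x)\<^sup>2)" and "B = (LINT x|M. f x * g x)"
    and "C = (LINT x|M. (g x)\<^sup>2)"
  have quad: "0 \<le> A - 2 * s * B + s\<^sup>2 * C" for s
  proof -
    have "0 \<le> (LINT x|M. (f x - s * g x)\<^sup>2)" by (rule Bochner_Integration.integral_nonneg) simp
    also have "\<dots> = (LINT x|M. (f x)\<^sup>2 - 2 * s * (f x * g x) + s\<^sup>2 * (g x)\<^sup>2)"
      by (rule Bochner_Integration.integral_cong) (auto simp: power2_eq_square algebra_simps)
    also have "\<dots> = A - 2 * s * B + s\<^sup>2 * C"
      unfolding A_def B_def C_def using f g fg by (simp add: mult.assoc)
    finally show ?thesis .
  qed
  have "0 \<le> A" "0 \<le> C" unfolding A_def C_def by auto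
  have "B\<^sup>2 \<le> A * C"
  proof (cases "C = 0")
    case True
    have "B = 0"
    proof (rule ccontr)
      assume "B \<noteq> 0"
      then show False using quad[of "(A + 1) / (2 * B)"] True by (simp add: field_simps)
    qed
    with True show ?thesis by simp
  next
    case False
    with \<open>0 \<le> C\<close> quad[of "B / C"] show ?thesis
      by (simp add: power2_eq_square field_simps)
  qed
  then have "sqrt (B\<^sup>2) \<le> sqrt (A * C)" by (rule real_sqrt_le_mono)
  then show "\<bar>LINT x|M. f x * g x\<bar> \<le> sqrt (LINT x|M. (f x)\<^sup>2) * sqrt (LINT x|M. (g x)\<^sup>2)"
    unfolding A_def B_def C_def by (simp add: real_sqrt_mult)
qed

text \<open>Coefficients of convex combinations of a tail. They are kept as functions on all indices, so that
combinations with different supports can be averaged.\<close>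

definition tail_weights :: "nat \<Rightarrow> (nat \<Rightarrow> real) set" where
  "tail_weights k = {c. finite {j. c j \<noteq> 0} \<and> (\<forall>j. 0 \<le> c j) \<and> (\<forall>j. c j \<noteq> 0 \<longrightarrow> k \<le> j) \<and>
     (\<Sum>j | c j \<noteq> 0. c j) = 1}"

definition mix :: "(nat \<Rightarrow> real) \<Rightarrow> (nat \<Rightarrow> real) \<Rightarrow> real" where
  "mix c f = (\<Sum>j | c j \<noteq> 0. c j * f j)"

lemma tail_weights_antimono: "k \<le> m \<Longrightarrow> tail_weights m \<subseteq> tail_weights k"
  by (auto simp: tail_weights_def)

lemma tail_weights_delta: "(\<lambda>j. if j = k then 1 else 0) \<in> tail_weights k"
  by (auto simp: tail_weights_def)

lemma mix_delta: "mix (\<lambda>j. if j = k then 1 else 0) f = f k"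
  by (simp add: mix_def)

lemma mix_superset:
  assumes "finite S" "{j. c j \<noteq> 0} \<subseteq> S"
  shows "mix c f = (\<Sum>j\<in>S. c j * f j)"
  unfolding mix_def by (rule sum.mono_neutral_left) (use assms in auto)

lemma mix_diff: "mix c (\<lambda>j. f j - g j) = mix c f - mix c g"
  by (simp add: mix_def sum_subtractf right_diff_distrib)

lemma mix_cmult: "mix c (\<lambda>j. a * f j) = a * mix c f" "mix c (\<lambda>j. f j * a) = mix c f * a"
  by (simp_all add: mix_def sum_distrib_left sum_distrib_right algebra_simps)

lemma mix_add: "mix c (\<lambda>j. f j + g j) = mix c f + mix c g"
  by (simp add: mix_def sum.distrib distrib_left)

lemma mix_const: "c \<in> tail_weights k \<Longrightarrow> mix c (\<lambda>j. a) = a"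
  by (simp add: mix_def tail_weights_def flip: sum_distrib_right)

lemma mix_mono:
  assumes "c \<in> tail_weights k" "\<And>j. k \<le> j \<Longrightarrow> f j \<le> g j"
  shows "mix c f \<le> mix c g"
  unfolding mix_def using assms by (intro sum_mono mult_left_mono) (auto simp: tail_weights_def)

lemma mix_abs_le:
  assumes "c \<in> tail_weights k" "\<And>j. k \<le> j \<Longrightarrow> \<bar>f j\<bar> \<le> B"
  shows "\<bar>mix c f\<bar> \<le> B"
proof -
  have "mix c f \<le> mix c (\<lambda>_. B)" "mix c (\<lambda>_. - B) \<le> mix c f"
    using assms(2) by (intro mix_mono[OF assms(1)]; force simp: abs_le_iff minus_le_iff)+
  then show ?thesis by (simp add: mix_const[OF assms(1)])
qed

text \<open>Mixing the tails does not disturb a limit that already exists. This is what allows the same weights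
    to be
used for every quantity attached to the approximations.\<close>

lemma mix_tendsto:
  assumes c: "\<And>k. c k \<in> tail_weights k" and f: "f \<longlonglongrightarrow> a"
  shows "(\<lambda>k. mix (c k) f) \<longlonglongrightarrow> a"
proof (rule LIMSEQ_I)
  fix e :: real assume "0 < e"
  then obtain N where N: "\<And>j. N \<le> j \<Longrightarrow> norm (f j - a) < e / 2"
    using LIMSEQ_D[OF f, of "e / 2"] by auto
  have "norm (mix (c k) f - a) < e" if "N \<le> k" for k
  proof -
    have "\<bar>mix (c k) (\<lambda>j. f j - a)\<bar> \<le> e / 2"
      by (rule mix_abs_le[OF c]) (use N that in \<open>force intro: less_imp_le\<close>)
    then show ?thesis using \<open>0 < e\<close> by (simp add: mix_diff mix_const[OF c])
  qed
  then show "\<exists>N. \<forall>k\<ge>N. norm (mix (c k) f - a) < e" by blast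
qed

lemma mix_measurable[measurable (raw)]:
  assumes "\<And>j. (\<lambda>x. f j x) \<in> borel_measurable M"
  shows "(\<lambda>x. mix c (\<lambda>j. f j x)) \<in> borel_measurable M"
  unfolding mix_def using assms by measurable

lemma mix_integral:
  assumes "\<And>j. integrable M (f j)"
  shows "integrable M (\<lambda>x. mix c (\<lambda>j. f j x))"
    and "(LINT x|M. mix c (\<lambda>j. f j x)) = mix c (\<lambda>j. LINT x|M. f j x)"
  using assms unfolding mix_def by auto

lemma mix_square_integrable:
  fixes f :: "nat \<Rightarrow> 'a \<Rightarrow> real"
  assumes [measurable]: "\<And>j. f j \<in> borel_measurable M" and "\<And>j. integrable M (\<lambda>x. (f j x)\<^sup>2)"
  shows "integrable M (\<lambda>x. (mix c (\<lambda>j. f j x))\<^sup>2)"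
proof -
  have "integrable M (\<lambda>x. (\<Sum>j\<in>S. c j * f j x)\<^sup>2)" if "finite S" for S
    using that
  proof induction
    case (insert j S)
    have "integrable M (\<lambda>x. (c j * f j x + (\<Sum>j\<in>S. c j * f j x))\<^sup>2)"
      by (rule square_integrable_add) (use insert assms in \<open>auto simp: power_mult_distrib\<close>)
    then show ?case using insert by simp
  qed simp
  then show ?thesis
    unfolding mix_def by (cases "finite {j. c j \<noteq> 0}") auto
qed

lemma tail_weights_midpoint:
  assumes c: "c \<in> tail_weights k" and d: "d \<in> tail_weights k"
  shows "(\<lambda>j. (c j + d j) / 2) \<in> tail_weights k"
    and "mix (\<lambda>j. (c j + d j) / 2) f = (mix c f + mix d f) / 2"
proof -
  let ?S = "{j. c j \<noteq> 0} \<union> {j. d j \<noteq> 0}"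
  have fin: "finite ?S" using c d by (auto simp: tail_weights_def)
  have mid: "mix (\<lambda>j. (c j + d j) / 2) f = (mix c f + mix d f) / 2" for f
  proof -
    have "mix (\<lambda>j. (c j + d j) / 2) f = (\<Sum>j\<in>?S. (c j + d j) / 2 * f j)"
      by (rule mix_superset[OF fin]) auto
    also have "\<dots> = ((\<Sum>j\<in>?S. c j * f j) + (\<Sum>j\<in>?S. d j * f j)) / 2"
      by (simp add: sum.distrib[symmetric] sum_divide_distrib field_simps)
    also have "\<dots> = (mix c f + mix d f) / 2"
      using mix_superset[OF fin, of c f] mix_superset[OF fin, of d f] by auto
    finally show ?thesis .
  qed
  show "mix (\<lambda>j. (c j + d j) / 2) f = (mix c f + mix d f) / 2" by (rule mid)
  have "mix (\<lambda>j. (c j + d j) / 2) (\<lambda>_. 1) = 1"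
    using mid[of "\<lambda>_. 1"] mix_const[OF c, of 1] mix_const[OF d, of 1] by simp
  then have sum1: "(\<Sum>j | (c j + d j) / 2 \<noteq> 0. (c j + d j) / 2) = 1" by (simp add: mix_def)
  have "finite {j. (c j + d j) / 2 \<noteq> 0}" by (rule finite_subset[OF _ fin]) auto
  moreover have "0 \<le> (c j + d j) / 2" "(c j + d j) / 2 \<noteq> 0 \<Longrightarrow> k \<le> j" for j
    using c d by (auto simp: tail_weights_def) (metis add.right_neutral)+
  ultimately show "(\<lambda>j. (c j + d j) / 2) \<in> tail_weights k"
    using sum1 unfolding tail_weights_def by blast
qed

text \<open>Completeness of \<open>L\<^sup>2\<close> over an arbitrary measure space: the convergence is so fast that the
    increments are
almost everywhere summable, and Fatou's lemma gives the rate for the pointwise limit.\<close>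

lemma L2_Cauchy_limit:
  fixes H :: "nat \<Rightarrow> 'a \<Rightarrow> real"
  assumes [measurable]: "\<And>k. H k \<in> borel_measurable M"
    and H: "\<And>k. integrable M (\<lambda>x. (H k x)\<^sup>2)"
    and fast: "\<And>k m. k \<le> m \<Longrightarrow> (\<integral>\<^sup>+x. ennreal ((H k x - H m x)\<^sup>2) \<partial>M) \<le> ennreal ((1/4)^k)"
  obtains g where "g \<in> borel_measurable M" "integrable M (\<lambda>x. (g x)\<^sup>2)"
    "\<And>k. (\<integral>\<^sup>+x. ennreal ((H k x - g x)\<^sup>2) \<partial>M) \<le> ennreal ((1/4)^k)"
proof -
  \<comment> \<open>The factor \<open>2 ^ k\<close> keeps the series of integrals convergent and forces geometric decay of \<open>a k x\<close>.\<close>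
  define a where "a k x = (H k x - H (Suc k) x)\<^sup>2" for k x
  have [measurable]: "a k \<in> borel_measurable M" for k unfolding a_def by measurable
  have a0: "0 \<le> a k x" for k x by (simp add: a_def)
  define g where "g x = lim (\<lambda>k. H k x)" for x
  have [measurable]: "g \<in> borel_measurable M" unfolding g_def by measurable
  have "(\<integral>\<^sup>+x. (\<Sum>k. ennreal (2^k * a k x)) \<partial>M) = (\<Sum>k. \<integral>\<^sup>+x. ennreal (2^k * a k x) \<partial>M)"
    by (rule nn_integral_suminf) measurable
  also have "\<dots> \<le> (\<Sum>k. ennreal ((1/2)^k))"
  proof (intro suminf_le allI summableI)
    fix k
    have "(\<integral>\<^sup>+x. ennreal (2^k * a k x) \<partial>M) = ennreal (2^k) * (\<integral>\<^sup>+x. ennreal (a k x) \<partial>M)"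
      by (simp add: ennreal_mult'' a0 nn_integral_cmult)
    also have "\<dots> \<le> ennreal (2^k) * ennreal ((1/4)^k)"
      unfolding a_def by (intro mult_left_mono fast) auto
    also have "\<dots> = ennreal (2^k * (1/4)^k)" by (simp add: ennreal_mult'')
    also have "2^k * (1/4)^k = (1/2::real)^k" by (simp flip: power_mult_distrib)
    finally show "(\<integral>\<^sup>+x. ennreal (2^k * a k x) \<partial>M) \<le> ennreal ((1/2)^k)" .
  qed
  also have "\<dots> < \<infinity>"
    by (subst suminf_ennreal2[OF _ summable_geometric]) auto
  finally have "AE x in M. (\<Sum>k. ennreal (2^k * a k x)) \<noteq> \<infinity>"
    by (intro nn_integral_PInf_AE) auto
  then have lim: "AE x in M. (\<lambda>k. H k x) \<longlonglongrightarrow> g x"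
  proof eventually_elim
    fix x assume fin: "(\<Sum>k. ennreal (2^k * a k x)) \<noteq> \<infinity>"
    then have "summable (\<lambda>k. 2^k * a k x)"
      by (intro summable_suminf_not_top) (auto simp: a0)
    then have "Bseq (\<lambda>k. 2^k * a k x)"
      using summable_LIMSEQ_zero convergent_imp_Bseq convergentI by blast
    then obtain C where C: "\<And>k. \<bar>2^k * a k x\<bar> \<le> C" "0 < C"
      by (auto simp: Bseq_def)
    have bnd: "norm (H (Suc k) x - H k x) \<le> sqrt C * (sqrt (1/2))^k" for k
    proof -
      have "a k x \<le> C * (1/2)^k"
        using C(1)[of k] by (simp add: a0 abs_mult power_one_over field_simps)
      then have "sqrt (a k x) \<le> sqrt (C * (1/2)^k)" by (rule real_sqrt_le_mono)
      also have "\<dots> = sqrt C * (sqrt (1/2))^k" by (simp only: real_sqrt_mult real_sqrt_power)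
      finally show ?thesis by (simp add: a_def abs_minus_commute)
    qed
    have "summable (\<lambda>k. H (Suc k) x - H k x)"
    proof (rule summable_comparison_test')
      show "summable (\<lambda>k. sqrt C * (sqrt (1/2))^k)"
        by (intro summable_mult summable_geometric) (auto simp: real_sqrt_lt_1_iff)
    qed (use bnd in auto)
    then have "(\<lambda>N. \<Sum>k<N. H (Suc k) x - H k x) \<longlonglongrightarrow> (\<Sum>k. H (Suc k) x - H k x)"
      by (rule summable_LIMSEQ)
    then have "(\<lambda>N. H N x - H 0 x) \<longlonglongrightarrow> (\<Sum>k. H (Suc k) x - H k x)"
      by (simp only: sum_lessThan_telescope[of "\<lambda>k. H k x"])
    then have "(\<lambda>N. (H N x - H 0 x) + H 0 x) \<longlonglongrightarrow> (\<Sum>k. H (Suc k) x - H k x) + H 0 x"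
      by (intro tendsto_intros)
    then have "convergent (\<lambda>N. H N x)" by (auto intro: convergentI)
    then show "(\<lambda>k. H k x) \<longlonglongrightarrow> g x" unfolding g_def by (rule convergent_LIMSEQ_iff[THEN iffD1])
  qed
  have est: "(\<integral>\<^sup>+x. ennreal ((H k x - g x)\<^sup>2) \<partial>M) \<le> ennreal ((1/4)^k)" for k
  proof -
    have "(\<integral>\<^sup>+x. ennreal ((H k x - g x)\<^sup>2) \<partial>M)
        = (\<integral>\<^sup>+x. liminf (\<lambda>m. ennreal ((H k x - H m x)\<^sup>2)) \<partial>M)"
    proof (rule nn_integral_cong_AE)
      show "AE x in M. ennreal ((H k x - g x)\<^sup>2) = liminf (\<lambda>m. ennreal ((H k x - H m x)\<^sup>2))"
        using lim
      proof eventually_elim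
        fix x assume "(\<lambda>m. H m x) \<longlonglongrightarrow> g x"
        then have "(\<lambda>m. ennreal ((H k x - H m x)\<^sup>2)) \<longlonglongrightarrow> ennreal ((H k x - g x)\<^sup>2)"
          by (intro tendsto_intros)
        then show "ennreal ((H k x - g x)\<^sup>2) = liminf (\<lambda>m. ennreal ((H k x - H m x)\<^sup>2))"
          by (intro lim_imp_Liminf[symmetric]) auto
      qed
    qed
    also have "\<dots> \<le> liminf (\<lambda>m. \<integral>\<^sup>+x. ennreal ((H k x - H m x)\<^sup>2) \<partial>M)"
      by (rule nn_integral_liminf) measurable
    also have "\<dots> \<le> limsup (\<lambda>m. \<integral>\<^sup>+x. ennreal ((H k x - H m x)\<^sup>2) \<partial>M)"
      by (rule Liminf_le_Limsup) simp
    also have "\<dots> \<le> ennreal ((1/4)^k)"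
      by (rule Limsup_bounded, rule eventually_mono[OF eventually_ge_at_top[of k]], erule fast)
    finally show ?thesis .
  qed
  have "integrable M (\<lambda>x. (H 0 x - g x)\<^sup>2)"
    using est[of 0] by (intro integrableI_nonneg) (auto simp: top_unique intro: le_less_trans)
  from square_integrable_diff[OF _ _ H[of 0] this] have "integrable M (\<lambda>x. (g x)\<^sup>2)" by simp
  with est that show thesis by (metis \<open>g \<in> borel_measurable M\<close>)
qed

text \<open>For each \<open>k\<close> take a combination of the tail from \<open>k\<close> on whose norm is nearly minimal. The minima
    increase
to a finite limit, and the midpoint of two such combinations is again a competitor, so the parallelogram
law makes them a Cauchy sequence.\<close>

lemma L2_bounded_tail_mixtures:
  fixes f :: "nat \<Rightarrow> 'a \<Rightarrow> real"
  assumes [measurable]: "\<And>j. f j \<in> borel_measurable M"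
    and f2: "\<And>j. integrable M (\<lambda>x. (f j x)\<^sup>2)" and K: "\<And>j. (LINT x|M. (f j x)\<^sup>2) \<le> K"
  obtains c g where "\<And>k. c k \<in> tail_weights k" "g \<in> borel_measurable M" "integrable M (\<lambda>x. (g x)\<^sup>2)"
    "\<And>k. (\<integral>\<^sup>+x. ennreal ((mix (c k) (\<lambda>j. f j x) - g x)\<^sup>2) \<partial>M) \<le> ennreal ((1/4)^k)"
proof -
  define h where "h c x = mix c (\<lambda>j. f j x)" for c x
  define q where "q c = (LINT x|M. (h c x)\<^sup>2)" for c
  have [measurable]: "h c \<in> borel_measurable M" for c unfolding h_def by measurable
  have h2: "integrable M (\<lambda>x. (h c x)\<^sup>2)" for c
    unfolding h_def by (rule mix_square_integrable) (use f2 in auto)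
  have q0: "0 \<le> q c" for c unfolding q_def by simp
  define d where "d k = Inf (q ` tail_weights k)" for k
  have bdd: "bdd_below (q ` tail_weights k)" for k using q0 by (auto intro!: bdd_belowI[of _ 0])
  have ne: "q ` tail_weights k \<noteq> {}" for k using tail_weights_delta by blast
  have d_le: "d k \<le> q c" if "c \<in> tail_weights k" for k c
    unfolding d_def by (rule cInf_lower) (use that bdd in auto)
  have "incseq d"
    unfolding d_def incseq_def using tail_weights_antimono
    by (intro allI impI cInf_superset_mono ne bdd image_mono) auto
  moreover have dK: "d k \<le> K" for k
    using d_le[OF tail_weights_delta, of k] K[of k] by (simp add: q_def h_def mix_delta)
  ultimately obtain D where D: "d \<longlonglongrightarrow> D" and dD: "\<And>k. d k \<le> D"
    using incseq_convergent[of d K] by blast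
  define r where "r k = 1 / real (Suc k)" for k
  have "\<exists>c\<in>tail_weights k. q c < d k + r k" for k
    using cInf_lessD[OF ne, of k "d k + r k"] unfolding d_def r_def by auto
  then obtain c0 where c0: "\<And>k. c0 k \<in> tail_weights k" "\<And>k. q (c0 k) < d k + r k"
    by metis
  \<comment> \<open>By the parallelogram law, \<open>e k\<close> bounds the squared distance between combination \<open>k\<close> and any later one.\<close>
  define e where "e k = 2 * (D - d k) + 4 / real (Suc k)" for k
  have e_lim: "e \<longlonglongrightarrow> 0"
  proof -
    have "(\<lambda>k. 2 * (D - d k) + 4 * inverse (real (Suc k))) \<longlonglongrightarrow> 2 * (D - D) + 4 * 0"
      by (intro tendsto_intros D LIMSEQ_inverse_real_of_nat)
    then show ?thesis by (simp add: e_def[abs_def] divide_inverse)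
  qed
  have dist: "(LINT x|M. (h (c0 k) x - h (c0 m) x)\<^sup>2) \<le> e k" if km: "k \<le> m" for k m
  proof -
    have cm: "c0 m \<in> tail_weights k" using c0(1)[of m] tail_weights_antimono[OF km] by auto
    let ?a = "\<lambda>j. (c0 k j + c0 m j) / 2"
    define Q where "Q = q ?a"
    have mid: "h ?a x = (h (c0 k) x + h (c0 m) x) / 2" for x
      unfolding h_def by (rule tail_weights_midpoint(2)[OF c0(1)[of k] cm])
    have "(LINT x|M. (h (c0 k) x - h (c0 m) x)\<^sup>2) =
       (LINT x|M. 2 * (h (c0 k) x)\<^sup>2 + 2 * (h (c0 m) x)\<^sup>2 - 4 * (h ?a x)\<^sup>2)"
      by (rule Bochner_Integration.integral_cong) (auto simp: mid power2_eq_square field_simps)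
    also have "\<dots> = 2 * q (c0 k) + 2 * q (c0 m) - 4 * Q"
      unfolding q_def Q_def using h2 by simp
    also have "\<dots> \<le> 2 * (d k + r k) + 2 * (D + r k) - 4 * d k"
    proof -
      have "d m + r m \<le> D + r k"
        using km unfolding r_def by (intro add_mono dD) (simp add: field_simps)
      moreover have "d k \<le> Q"
        unfolding Q_def by (rule d_le[OF tail_weights_midpoint(1)[OF c0(1)[of k] cm]])
      ultimately show ?thesis using c0(2)[of k] c0(2)[of m] by argo
    qed
    also have "\<dots> = e k"
    proof -
      have "4 / real (Suc k) = 4 * r k" by (simp add: r_def)
      then show ?thesis unfolding e_def by argo
    qed
    finally show ?thesis .
  qed
  have "\<exists>s\<ge>k. e s \<le> (1/4)^k" for k
  proof -
    have "eventually (\<lambda>s. e s < (1/4)^k) sequentially" by (rule order_tendstoD[OF e_lim]) simp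
    then have "eventually (\<lambda>s. e s < (1/4)^k \<and> k \<le> s) sequentially"
      using eventually_ge_at_top[of k] by eventually_elim auto
    then show ?thesis by (auto simp: eventually_sequentially intro: less_imp_le)
  qed
  then obtain s where s: "\<And>k. k \<le> s k" "\<And>k. e (s k) \<le> (1/4)^k" by metis
  define c where "c k = c0 (s k)" for k
  have c: "c k \<in> tail_weights k" for k
    using c0(1)[of "s k"] tail_weights_antimono[OF s(1)[of k]] by (auto simp: c_def)
  \<comment> \<open>The selection \<open>s\<close> may fail to be monotone, so the bound is taken from the smaller of the two indices.\<close>
  have close: "(\<integral>\<^sup>+x. ennreal ((h (c k) x - h (c m) x)\<^sup>2) \<partial>M) \<le> ennreal ((1/4)^k)" if "k \<le> m" for k m
  proof -
    have "(LINT x|M. (h (c k) x - h (c m) x)\<^sup>2) \<le> (1/4)^k"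
    proof (cases "s k \<le> s m")
      case True
      from dist[OF this] s(2)[of k] show ?thesis unfolding c_def by linarith
    next
      case False
      have "(LINT x|M. (h (c k) x - h (c m) x)\<^sup>2) = (LINT x|M. (h (c m) x - h (c k) x)\<^sup>2)"
        by (simp add: power2_commute)
      also have "\<dots> \<le> (1/4)^m"
        using dist[of "s m" "s k"] False s(2)[of m] unfolding c_def by linarith
      also have "\<dots> \<le> (1/4)^k" using that by (intro power_decreasing) auto
      finally show ?thesis .
    qed
    then show ?thesis
      by (subst nn_integral_eq_integral) (auto intro!: square_integrable_diff h2 ennreal_leI)
  qed
  obtain g where "g \<in> borel_measurable M" "integrable M (\<lambda>x. (g x)\<^sup>2)"
    "\<And>k. (\<integral>\<^sup>+x. ennreal ((h (c k) x - g x)\<^sup>2) \<partial>M) \<le> ennreal ((1/4)^k)"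
    by (rule L2_Cauchy_limit[of "\<lambda>k. h (c k)" M]) (use h2 close in auto)
  then show thesis using that c unfolding h_def by blast
qed

section \<open>Primitives and step functions on the unit interval\<close>

abbreviation I01 :: "real measure" where "I01 \<equiv> lebesgue_on {0<..<1}"

lemma id_measurable_I01[measurable]: "(\<lambda>x. x) \<in> borel_measurable I01"
  by (intro measurable_restrict_space1 measurable_completion) simp

lemma borel_measurable_I01: "f \<in> borel_measurable borel \<Longrightarrow> f \<in> borel_measurable I01"
  by (intro measurable_restrict_space1 measurable_completion) simp

lemma indicator_measurable_I01[measurable]: "(indicator {..x} :: real \<Rightarrow> real) \<in> borel_measurable I01"
  "(indicator {x..} :: real \<Rightarrow> real) \<in> borel_measurable I01"
  "(indicator {x<..y} :: real \<Rightarrow> real) \<in> borel_measurable I01"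
  by (rule borel_measurable_I01; measurable)+

lemma AE_I01_iff: "(AE x in I01. P x) \<longleftrightarrow> (AE x in lborel. 0 < x \<and> x < 1 \<longrightarrow> P x)"
  by (subst AE_restrict_space_iff) (auto simp: AE_completion_iff)

lemma AE_I01_neq: "AE x in I01. x \<noteq> z"
  unfolding AE_I01_iff using AE_lborel_singleton[of z] by eventually_elim auto

lemma nn_integral_I01:
  assumes "f \<in> borel_measurable borel"
  shows "(\<integral>\<^sup>+x. f x \<partial>I01) = (\<integral>\<^sup>+x. f x * indicator {0<..<1} x \<partial>lborel)"
  by (subst nn_integral_restrict_space) (auto simp: nn_integral_completion)

lemma integral_I01:
  fixes f :: "real \<Rightarrow> real"
  assumes [measurable]: "f \<in> borel_measurable borel"
  shows "(LINT x|I01. f x) = (LINT x|lborel. indicator {0<..<1} x * f x)"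
  by (subst integral_restrict_space) (auto intro!: integral_completion)

text \<open>The unit interval is taken open, so the case \<open>b = 1\<close> costs a null set.\<close>

lemma I01_Ioc:
  assumes "0 \<le> a" "a \<le> b" "b \<le> 1"
  shows "(LINT x|I01. indicator {a<..b} x) = b - (a::real)"
proof -
  have "(LINT x|I01. indicator {a<..b} x) = (LINT x|lborel. indicator {0<..<1} x * indicator {a<..b} x ::
      real)"
    by (subst integral_I01) auto
  also have "\<dots> = (LINT x|lborel. indicator {a<..b} x)"
    by (rule integral_cong_AE)
       (use AE_lborel_singleton[of "1::real"] assms in \<open>auto simp: indicator_def elim!: eventually_mono\<close>)
  also have "\<dots> = b - a" using assms by simp
  finally show ?thesis .
qed

interpretation I01: prob_space I01
proof
  have "emeasure I01 (space I01) = emeasure lborel {0<..<1::real}"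
    by (simp add: emeasure_restrict_space)
  then show "emeasure I01 (space I01) = 1" by simp
qed

lemma I01_bounded_integrable:
  fixes f :: "real \<Rightarrow> real"
  assumes "f \<in> borel_measurable I01" "\<And>x. \<lbrakk>0 < x; x < 1\<rbrakk> \<Longrightarrow> \<bar>f x\<bar> \<le> B"
  shows "integrable I01 f"
  by (rule I01.integrable_const_bound[of _ B]) (use assms in auto)

lemma I01_L2_imp_L1:
  fixes f :: "real \<Rightarrow> real"
  assumes "f \<in> borel_measurable I01" "integrable I01 (\<lambda>x. (f x)\<^sup>2)"
  shows "integrable I01 f"
  using Cauchy_Schwarz_integral(1)[of f I01 "\<lambda>_. 1"] assms by simp

lemma integrable_mult_bounded:
  fixes f g :: "'a \<Rightarrow> real"
  assumes "integrable M g" "f \<in> borel_measurable M" "\<And>x. x \<in> space M \<Longrightarrow> \<bar>f x\<bar> \<le> B"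
  shows "integrable M (\<lambda>x. f x * g x)"
proof (rule Bochner_Integration.integrable_bound[where f = "\<lambda>x. B * g x"])
  have "norm (f x * g x) \<le> norm (B * g x)" if "x \<in> space M" for x
    using mult_right_mono[of "\<bar>f x\<bar>" "\<bar>B\<bar>" "\<bar>g x\<bar>"] assms(3)[OF that] by (simp add: abs_mult)
  then show "AE x in M. norm (f x * g x) \<le> norm (B * g x)" by auto
qed (use assms in auto)

text \<open>The primitive that vanishes at \<open>0\<close>, continued by constants outside the unit interval.\<close>

definition prim :: "(real \<Rightarrow> real) \<Rightarrow> real \<Rightarrow> real" where
  "prim f x = (LINT y|I01. indicator {..x} y * f y)"

lemma integrable_indicator_mult:
  fixes f :: "real \<Rightarrow> real"
  assumes "integrable I01 f"
  shows "integrable I01 (\<lambda>y. indicator {..x} y * f y)"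
    "integrable I01 (\<lambda>y. indicator {x..} y * f y)"
    "integrable I01 (\<lambda>y. indicator {x<..z} y * f y)"
  by (rule integrable_mult_bounded[OF assms, of _ 1]; simp)+

lemma prim_0: "x \<le> 0 \<Longrightarrow> prim f x = 0"
  unfolding prim_def
  by (rule trans[OF Bochner_Integration.integral_cong[where g = "\<lambda>_. 0"]]) auto

lemma prim_1: "1 \<le> x \<Longrightarrow> prim f x = (LINT y|I01. f y)"
  unfolding prim_def by (rule Bochner_Integration.integral_cong) auto

lemma prim_bound:
  assumes "integrable I01 f"
  shows "\<bar>prim f x\<bar> \<le> (LINT y|I01. \<bar>f y\<bar>)"
proof -
  have "\<bar>prim f x\<bar> \<le> (LINT y|I01. \<bar>indicator {..x} y * f y\<bar>)"
    unfolding prim_def by (rule integral_abs_bound)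
  also have "\<dots> \<le> (LINT y|I01. \<bar>f y\<bar>)"
    by (rule integral_mono) (use assms integrable_indicator_mult(1)[OF assms] in \<open>auto simp: indicator_def\<close>)
  finally show ?thesis .
qed

lemma prim_L2_bound:
  assumes [measurable]: "f \<in> borel_measurable I01" and f2: "integrable I01 (\<lambda>x. (f x)\<^sup>2)"
  shows "\<bar>prim f x\<bar> \<le> sqrt (LINT y|I01. (f y)\<^sup>2)"
proof -
  have "\<bar>prim f x\<bar> \<le> (LINT y|I01. \<bar>f y\<bar>)" by (rule prim_bound) (rule I01_L2_imp_L1; fact)
  also have "\<dots> = (LINT y|I01. \<bar>f y\<bar> * 1)" by simp
  also have "\<dots> \<le> \<bar>LINT y|I01. \<bar>f y\<bar> * 1\<bar>" by simp
  also have "\<dots> \<le> sqrt (LINT y|I01. \<bar>f y\<bar>\<^sup>2) * sqrt (LINT y|I01. 1\<^sup>2)"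
    by (rule Cauchy_Schwarz_integral(2)) (use f2 in auto)
  also have "\<dots> = sqrt (LINT y|I01. (f y)\<^sup>2)" using I01.prob_space by simp
  finally show ?thesis .
qed

lemma prim_diff_Ioc:
  assumes "integrable I01 f" "a \<le> b"
  shows "prim f b - prim f a = (LINT y|I01. indicator {a<..b} y * f y)"
proof -
  have "prim f b - prim f a = (LINT y|I01. indicator {..b} y * f y - indicator {..a} y * f y)"
    unfolding prim_def by (rule Bochner_Integration.integral_diff[symmetric])
        (intro integrable_indicator_mult assms)+
  also have "\<dots> = (LINT y|I01. indicator {a<..b} y * f y)"
    by (rule Bochner_Integration.integral_cong) (use assms(2) in \<open>auto simp: indicator_def\<close>)
  finally show ?thesis .
qed

lemma prim_linear:
  assumes "integrable I01 f" "integrable I01 g"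
  shows "prim (\<lambda>x. f x - g x) x = prim f x - prim g x"
    "prim (\<lambda>x. f x + g x) x = prim f x + prim g x"
    "prim (\<lambda>x. a * f x) x = a * prim f x"
  unfolding prim_def using integrable_indicator_mult(1)[OF assms(1), of x] integrable_indicator_mult(1)[OF
      assms(2), of x]
  by (simp_all add: right_diff_distrib distrib_left mult.left_commute)

lemma prim_mix:
  assumes "\<And>j. integrable I01 (f j)"
  shows "prim (\<lambda>x. mix c (\<lambda>j. f j x)) x = mix c (\<lambda>j. prim (f j) x)"
  unfolding prim_def mix_cmult(1)[symmetric]
  by (rule mix_integral) (intro integrable_indicator_mult assms)

lemma continuous_prim:
  assumes f: "integrable I01 f"
  shows "continuous_on A (prim f)"
proof -
  have [measurable]: "f \<in> borel_measurable I01" using f by auto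
  have "isCont (prim f) x" for x
    unfolding continuous_at_sequentially comp_def
  proof safe
    fix X :: "nat \<Rightarrow> real" assume X: "X \<longlonglongrightarrow> x"
    show "(\<lambda>n. prim f (X n)) \<longlonglongrightarrow> prim f x"
      unfolding prim_def
    proof (rule integral_dominated_convergence[where w = "\<lambda>y. \<bar>f y\<bar>"])
      show "AE y in I01. (\<lambda>n. indicator {..X n} y * f y) \<longlonglongrightarrow> indicator {..x} y * f y"
        using AE_I01_neq[of x]
      proof eventually_elim
        fix y assume "y \<noteq> x"
        then consider "y < x" | "x < y" by linarith
        then have "eventually (\<lambda>n. indicator {..X n} y * f y = indicator {..x} y * f y) sequentially"
        proof cases
          case 1
          then show ?thesis by (rule eventually_mono[OF order_tendstoD(1)[OF X]])
              (use 1 in \<open>auto simp: indicator_def\<close>)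
        next
          case 2
          then show ?thesis by (rule eventually_mono[OF order_tendstoD(2)[OF X]])
              (use 2 in \<open>auto simp: indicator_def\<close>)
        qed
        then show "(\<lambda>n. indicator {..X n} y * f y) \<longlonglongrightarrow> indicator {..x} y * f y"
          by (rule tendsto_eventually)
      qed
    qed (use f in \<open>auto simp: indicator_def\<close>)
  qed
  then show ?thesis by (simp add: continuous_at_imp_continuous_on)
qed

lemma prim_measurable:
  assumes "integrable I01 f"
  shows "prim f \<in> borel_measurable borel"
  by (rule borel_measurable_continuous_onI[OF continuous_prim[OF assms]])

text \<open>Fubini's theorem on the triangle \<open>z \<le> y\<close>. It is stated for two measures because it is the source of both
integrations by parts that follow: of two primitives against each other, and of a primitive against a
function of bounded variation.\<close>

lemma triangle_Fubini:
  fixes M N :: "real measure"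
  assumes M: "sigma_finite_measure M" "(\<lambda>x. x) \<in> borel_measurable M" "integrable M a"
    and N: "sigma_finite_measure N" "(\<lambda>x. x) \<in> borel_measurable N" "integrable N b"
  shows "(LINT y|N. b y * (LINT z|M. indicator {..y} z * a z)) =
         (LINT z|M. a z * (LINT y|N. indicator {z..} y * b y :: real))"
proof -
  interpret pair_sigma_finite M N using M N by (simp add: pair_sigma_finite_def)
  have [measurable]: "a \<in> borel_measurable M" "b \<in> borel_measurable N"
    "(\<lambda>x. x) \<in> borel_measurable M" "(\<lambda>x. x) \<in> borel_measurable N"
    using M N by auto
  define f where "f z y = (if z \<le> y then a z * b y else 0)" for z y
  have [measurable]: "case_prod f \<in> borel_measurable (M \<Otimes>\<^sub>M N)"
    unfolding f_def by measurable
  have fb: "\<bar>f z y\<bar> \<le> \<bar>a z\<bar> * \<bar>b y\<bar>" for z y by (auto simp: f_def abs_mult)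
  have f2: "integrable N (\<lambda>y. f z y)" if "z \<in> space M" for z
  proof (rule Bochner_Integration.integrable_bound[where f = "\<lambda>y. \<bar>a z\<bar> * \<bar>b y\<bar>"])
    show "(\<lambda>y. f z y) \<in> borel_measurable N" unfolding f_def by measurable
    show "AE y in N. norm (f z y) \<le> norm (\<bar>a z\<bar> * \<bar>b y\<bar>)" using fb by auto
  qed (use N in auto)
  have "integrable (M \<Otimes>\<^sub>M N) (case_prod f)"
  proof (rule Fubini_integrable)
    show "integrable M (\<lambda>z. LINT y|N. norm (case_prod f (z, y)))"
    proof (rule Bochner_Integration.integrable_bound[where f = "\<lambda>z. \<bar>a z\<bar> * (LINT y|N. \<bar>b y\<bar>)"])
      have "(LINT y|N. \<bar>f z y\<bar>) \<le> (LINT y|N. \<bar>a z\<bar> * \<bar>b y\<bar>)" if "z \<in> space M" for z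
        by (rule integral_mono) (use fb f2[OF that] N in auto)
      then show "AE z in M. norm (LINT y|N. norm (case_prod f (z, y))) \<le> norm (\<bar>a z\<bar> * (LINT y|N. \<bar>b y\<bar>))"
        by (auto simp: abs_mult)
    qed (use M in auto)
  qed (use f2 in auto)
  from Fubini_integral[OF this]
  have "(LINT y|N. LINT z|M. f z y) = (LINT z|M. LINT y|N. f z y)" .
  moreover have "(LINT z|M. f z y) = b y * (LINT z|M. indicator {..y} z * a z)" for y
    unfolding integral_mult_right_zero[symmetric]
    by (rule Bochner_Integration.integral_cong) (auto simp: f_def indicator_def)
  moreover have "(LINT y|N. f z y) = a z * (LINT y|N. indicator {z..} y * b y)" for z
    unfolding integral_mult_right_zero[symmetric]
    by (rule Bochner_Integration.integral_cong) (auto simp: f_def indicator_def)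
  ultimately show ?thesis by simp
qed

lemma upper_integral_eq:
  assumes "integrable I01 f"
  shows "(LINT y|I01. indicator {z..} y * f y) = prim f 1 - prim f z"
proof -
  have [measurable]: "f \<in> borel_measurable I01" using assms by auto
  have "(LINT y|I01. indicator {z..} y * f y) = (LINT y|I01. f y - indicator {..z} y * f y)"
    by (rule integral_cong_AE) (use AE_I01_neq[of z] in \<open>auto simp: indicator_def elim!: eventually_mono\<close>)
  also have "\<dots> = prim f 1 - prim f z"
    unfolding prim_1[OF order_refl] unfolding prim_def
    by (rule Bochner_Integration.integral_diff) (intro integrable_indicator_mult assms)+
  finally show ?thesis .
qed

lemma integrable_prim_mult:
  assumes "integrable I01 f" "integrable I01 g"
  shows "integrable I01 (\<lambda>y. prim f y * g y)"
  by (rule integrable_mult_bounded[OF assms(2) borel_measurable_I01[OF prim_measurable[OF assms(1)]]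
      prim_bound[OF assms(1)]])

text \<open>The product rule, and with it integration by parts, for functions that are only primitives of integrable
functions.\<close>

lemma prim_product:
  assumes f: "integrable I01 f" and g: "integrable I01 g"
  shows "integrable I01 (\<lambda>y. prim f y * g y + f y * prim g y)"
    and "prim (\<lambda>y. prim f y * g y + f y * prim g y) x = prim f x * prim g x"
proof -
  have fg: "integrable I01 (\<lambda>y. prim f y * g y)" "integrable I01 (\<lambda>y. f y * prim g y)"
    using integrable_prim_mult[OF f g] integrable_prim_mult[OF g f] by (simp_all add: mult.commute)
  then show "integrable I01 (\<lambda>y. prim f y * g y + f y * prim g y)" by
      (rule Bochner_Integration.integrable_add)
  let ?f = "\<lambda>y. indicator {..x} y * f y" and ?g = "\<lambda>y. indicator {..x} y * g y"
  note int = integrable_indicator_mult(1)[OF f, of x] integrable_indicator_mult(1)[OF g, of x]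
  have trunc: "prim (\<lambda>y. indicator {..x} y * h y) z = prim h (min x z)" for h z
    unfolding prim_def by (rule Bochner_Integration.integral_cong) (auto simp: indicator_def)
  have "prim (\<lambda>y. prim f y * g y) x = (LINT y|I01. ?g y * (LINT z|I01. indicator {..y} z * ?f z))"
    unfolding prim_def[symmetric] trunc
    unfolding prim_def[of "\<lambda>y. prim f y * g y"]
    by (rule Bochner_Integration.integral_cong) (auto simp: indicator_def min_def)
  also have "\<dots> = (LINT z|I01. ?f z * (LINT y|I01. indicator {z..} y * ?g y))"
    by (rule triangle_Fubini) (use int in \<open>auto intro: I01.sigma_finite_measure_axioms\<close>)
  also have "\<dots> = (LINT z|I01. ?f z * (prim ?g 1 - prim ?g z))"
    by (simp only: upper_integral_eq[OF int(2)])
  also have "\<dots> = (LINT z|I01. prim ?g 1 * ?f z - indicator {..x} z * (f z * prim g z))"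
    unfolding trunc by (rule Bochner_Integration.integral_cong)
        (auto simp: indicator_def algebra_simps min_def)
  also have "\<dots> = prim ?g 1 * prim f x - prim (\<lambda>z. f z * prim g z) x"
    unfolding prim_def[of f] prim_def[of "\<lambda>z. f z * prim g z"]
    using int(1) integrable_indicator_mult(1)[OF fg(2), of x] by simp
  also have "prim ?g 1 = prim g x"
    unfolding trunc by (cases "x \<le> 1") (auto simp: min_def prim_1)
  finally show "prim (\<lambda>y. prim f y * g y + f y * prim g y) x = prim f x * prim g x"
    by (simp add: prim_linear(2)[OF fg])
qed

text \<open>Cell \<open>i\<close> of the mesh is the interval \<open>(i - 1, i] / n\<close>, as in the definition of a generalized solution.\<close>

definition step :: "nat \<Rightarrow> (int \<Rightarrow> real) \<Rightarrow> real \<Rightarrow> real" where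
  "step n a x = a \<lceil>real n * x\<rceil>"

lemma ceiling_in_range:
  assumes "0 < x" "x < 1" "0 < n"
  shows "\<lceil>real n * x\<rceil> \<in> {1..int n}"
proof -
  have "0 < real n * x" "real n * x \<le> real n" using assms by auto
  then show ?thesis by (auto simp: ceiling_le_iff)
qed

lemma step_measurable[measurable]: "step n a \<in> borel_measurable borel"
proof -
  have "(\<lambda>x. a \<lceil>real n * x\<rceil>) \<in> borel_measurable borel"
    by (rule measurable_compose[where g = a and N = "count_space UNIV"]) auto
  then show ?thesis by (simp add: step_def[abs_def])
qed

lemma step_measurable_I01[measurable]: "step n a \<in> borel_measurable I01"
  by (rule borel_measurable_I01) simp

lemma step_integrable:
  assumes "0 < n"
  shows "integrable I01 (step n a)"
proof (rule I01_bounded_integrable)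
  fix x :: real assume "0 < x" "x < 1"
  from ceiling_in_range[OF this assms]
  show "\<bar>step n a x\<bar> \<le> Max ((\<lambda>i. \<bar>a i\<bar>) ` {1..int n})"
    unfolding step_def by (intro Max_ge) auto
qed simp

lemma step_square: "(step n a x)\<^sup>2 = step n (\<lambda>i. (a i)\<^sup>2) x"
  by (simp add: step_def)

lemma prim_step:
  assumes n: "0 < n" and "m \<le> n"
  shows "prim (step n a) (real m / real n) = (\<Sum>i=1..int m. a i) / real n"
  using \<open>m \<le> n\<close>
proof (induction m)
  case 0
  then show ?case by (simp add: prim_0)
next
  case (Suc m)
  have le: "real m / real n \<le> real (Suc m) / real n" "real (Suc m) / real n \<le> 1"
    using Suc.prems n by (auto simp: divide_simps)
  have "prim (step n a) (real (Suc m) / real n) - prim (step n a) (real m / real n)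
      = (LINT y|I01. indicator {real m / real n<..real (Suc m) / real n} y * step n a y)"
    by (rule prim_diff_Ioc[OF step_integrable[OF n] le(1)])
  also have "\<dots> = (LINT y|I01. a (int (Suc m)) * indicator {real m / real n<..real (Suc m) / real n} y)"
  proof (rule Bochner_Integration.integral_cong[OF refl])
    fix y
    have "\<lceil>real n * y\<rceil> = int (Suc m)" if "y \<in> {real m / real n<..real (Suc m) / real n}"
      using that n by (intro ceiling_unique) (auto simp: field_simps)
    then show "indicator {real m / real n<..real (Suc m) / real n} y * step n a y
       = a (int (Suc m)) * indicator {real m / real n<..real (Suc m) / real n} y"
      by (auto simp: step_def indicator_def)
  qed
  also have "\<dots> = a (int (Suc m)) * (real (Suc m) / real n - real m / real n)"
    unfolding integral_mult_right_zero using I01_Ioc[of "real m / real n" "real (Suc m) / real n"] le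
    by simp
  also have "\<dots> = a (int (Suc m)) / real n" by (simp add: diff_divide_distrib[symmetric])
  finally have "prim (step n a) (real (Suc m) / real n) = (\<Sum>i=1..int m. a i) / real n
      + a (int (Suc m)) / real n"
    using Suc by simp
  also have "\<dots> = (\<Sum>i=1..int (Suc m). a i) / real n"
  proof -
    have "{1..int (Suc m)} = insert (int (Suc m)) {1..int m}" by auto
    then show ?thesis by (simp add: add_divide_distrib)
  qed
  finally show ?case .
qed

lemma integral_step:
  assumes "0 < n"
  shows "(LINT x|I01. step n a x) = (\<Sum>i=1..int n. a i) / real n"
  using prim_step[OF assms order_refl, of a] assms by (simp add: prim_1)

lemma step_jumps:
  assumes "0 < x" "x < 1" "0 < n"
  shows "step n a x = a 1 + (\<Sum>i=1..int n - 1. (a (i + 1) - a i) * indicator {real_of_int i / real n<..} x)"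
proof -
  let ?m = "\<lceil>real n * x\<rceil>"
  have m: "?m \<in> {1..int n}" by (rule ceiling_in_range[OF assms])
  have "(\<Sum>i=1..int n - 1. (a (i + 1) - a i) * indicator {real_of_int i / real n<..} x)
    = (\<Sum>i=1..?m - 1. a (i + 1) - a i)"
  proof (rule sum.mono_neutral_cong_right)
    have *: "real_of_int i / real n < x \<longleftrightarrow> i < ?m" for i
      using assms(3) by (simp add: less_ceiling_iff field_simps)
    show "\<forall>i\<in>{1..int n - 1} - {1..?m - 1}. (a (i + 1) - a i) * indicator {real_of_int i / real n<..} x = 0"
      using * by (auto simp: indicator_def)
    show "(a (i + 1) - a i) * indicator {real_of_int i / real n<..} x = a (i + 1) - a i"
      if "i \<in> {1..?m - 1}" for i
      using * that by (auto simp: indicator_def)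
  qed (use m in auto)
  also have "\<dots> = a ?m - a 1"
    using sum_int_shift[of "\<lambda>i. a i - a (i - 1)" 1 "?m - 1"] sum_int_telescope[of 2 ?m a] m by simp
  finally show ?thesis by (simp add: step_def)
qed

text \<open>The node values of the primitive of the discrete derivative are the original values.\<close>

lemma prim_step_Dminus:
  assumes "0 < n" "v 0 = 0" "m \<le> n"
  shows "prim (step n (Dminus n v)) (real m / real n) = v (int m)"
proof -
  have "prim (step n (Dminus n v)) (real m / real n) = (\<Sum>i=1..int m. real n * (v i - v (i - 1))) / real n"
    unfolding prim_step[OF assms(1,3)] Dminus_def ..
  also have "\<dots> = v (int m)"
    unfolding sum_distrib_left[symmetric] using assms by (simp add: sum_int_telescope[of 1 "int m" v])
  finally show ?thesis .
qed


section \<open>Bounded variation and the sign condition on a time slice\<close>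

text \<open>The finite measures that may appear in \<open>distr_deriv\<close> on the unit interval.\<close>

locale borel01_measure = finite_measure P for P :: "real measure" +
  assumes sets_P: "sets P = sets (restrict_space borel {0<..<1})"
begin

lemma space_P: "space P = {0<..<1}"
  using sets_eq_imp_space_eq[OF sets_P] by (simp add: space_restrict_space)

lemma borel_measurable_P: "f \<in> borel_measurable borel \<Longrightarrow> f \<in> borel_measurable P"
  using measurable_restrict_space1[of f borel borel "{0<..<1}"] measurable_cong_sets[OF sets_P refl] by blast

lemma integrable_P:
  fixes f :: "real \<Rightarrow> real"
  assumes "f \<in> borel_measurable borel" "\<And>x. \<lbrakk>0 < x; x < 1\<rbrakk> \<Longrightarrow> \<bar>f x\<bar> \<le> B"
  shows "integrable P f"
  by (rule integrable_const_bound[of _ B]) (use assms borel_measurable_P in \<open>auto simp: space_P\<close>)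

definition cumul :: "real \<Rightarrow> real" where
  "cumul x = (LINT z|P. indicator {..x} z)"

lemma integrable_indicator: "E \<in> sets borel \<Longrightarrow> integrable P (indicator E :: real \<Rightarrow> real)"
  by (rule integrable_P[of _ 1]) auto

lemma cumul_mono: "x \<le> y \<Longrightarrow> cumul x \<le> cumul y"
  unfolding cumul_def by (intro integral_mono integrable_indicator) (auto simp: indicator_def)

lemma cumul_bound: "\<bar>cumul x\<bar> \<le> measure P (space P)"
proof -
  have "cumul x \<le> (LINT z|P. 1)"
    unfolding cumul_def by (intro integral_mono integrable_indicator) (auto simp: indicator_def)
  moreover have "0 \<le> cumul x" unfolding cumul_def by simp
  ultimately show ?thesis by simp
qed

lemma cumul_measurable: "cumul \<in> borel_measurable borel"
  by (rule borel_measurable_mono) (simp add: mono_def cumul_mono)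

text \<open>\<open>triangle_Fubini\<close> for the pair consisting of \<open>P\<close> and Lebesgue measure.\<close>

lemma cumul_pairing:
  assumes \<rho>: "integrable I01 \<rho>"
  shows "integrable I01 (\<lambda>x. cumul x * \<rho> x)"
    and "(LINT x|I01. cumul x * \<rho> x) = (LINT z|P. prim \<rho> 1 - prim \<rho> z)"
proof -
  show "integrable I01 (\<lambda>x. cumul x * \<rho> x)"
    by (rule integrable_mult_bounded[OF \<rho> borel_measurable_I01[OF cumul_measurable] cumul_bound])
  have "(LINT x|I01. \<rho> x * (LINT z|P. indicator {..x} z * 1))
      = (LINT z|P. 1 * (LINT x|I01. indicator {z..} x * \<rho> x))"
    by (rule triangle_Fubini)
       (use \<rho> borel_measurable_P[of "\<lambda>x. x"] in \<open>auto intro: I01.sigma_finite_measure_axioms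
           sigma_finite_measure_axioms\<close>)
  then show "(LINT x|I01. cumul x * \<rho> x) = (LINT z|P. prim \<rho> 1 - prim \<rho> z)"
    unfolding upper_integral_eq[OF \<rho>] by (simp add: cumul_def mult.commute)
qed

end

text \<open>For a test function \<open>\<eta>\<close> and \<open>\<rho> = \<eta>'\<close> this says that \<open>P - N\<close> is the distributional derivative of \<open>u\<close>.
The class of admissible \<open>\<eta>\<close> is larger here: the sign condition needs \<open>\<eta>\<close> times a flux, which is only
absolutely continuous.\<close>

lemma BV_pairing:
  assumes P: "borel01_measure P" and N: "borel01_measure N"
    and u: "u \<in> borel_measurable I01"
      "AE x in I01. u x = c + borel01_measure.cumul P x - borel01_measure.cumul N x"
    and \<rho>: "integrable I01 \<rho>" "prim \<rho> 1 = 0"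
  shows "(LINT x|I01. u x * \<rho> x) = - ((LINT x|P. prim \<rho> x) - (LINT x|N. prim \<rho> x))"
proof -
  interpret P: borel01_measure P by fact
  interpret N: borel01_measure N by fact
  have [measurable]: "u \<in> borel_measurable I01" "\<rho> \<in> borel_measurable I01"
    "P.cumul \<in> borel_measurable I01" "N.cumul \<in> borel_measurable I01"
    using u \<rho> P.cumul_measurable N.cumul_measurable borel_measurable_I01 by auto
  have "(LINT x|I01. u x * \<rho> x) = (LINT x|I01. c * \<rho> x + P.cumul x * \<rho> x - N.cumul x * \<rho> x)"
  proof (rule integral_cong_AE)
    show "AE x in I01. u x * \<rho> x = c * \<rho> x + P.cumul x * \<rho> x - N.cumul x * \<rho> x"
      using u(2) by eventually_elim (simp add: distrib_right left_diff_distrib)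
  qed measurable
  also have "\<dots> = c * prim \<rho> 1 + (LINT z|P. prim \<rho> 1 - prim \<rho> z) - (LINT z|N. prim \<rho> 1 - prim \<rho> z)"
    using \<rho>(1) P.cumul_pairing[OF \<rho>(1)] N.cumul_pairing[OF \<rho>(1)] by (simp add: prim_1)
  finally show ?thesis using \<rho>(2) by simp
qed

text \<open>The sum of the upward jumps up to \<open>x\<close>. The jumps are placed so that the function is continuous from the
right, as Helly's selection theorem and Stieltjes measures require, whereas \<open>step\<close> is continuous from the
left.\<close>

definition up_jumps :: "nat \<Rightarrow> (int \<Rightarrow> real) \<Rightarrow> real \<Rightarrow> real" where
  "up_jumps n a x = (\<Sum>i=1..int n - 1. max 0 (a (i + 1) - a i) * indicator {real_of_int i / real n..} x)"

lemma mono_up_jumps: "mono (up_jumps n a)"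
  unfolding up_jumps_def mono_def
  by (intro allI impI sum_mono mult_left_mono) (auto simp: indicator_def)

lemma right_continuous_up_jumps: "continuous (at_right x) (up_jumps n a)"
proof -
  have "continuous (at_right x) (indicator {c..} :: real \<Rightarrow> real)" for c
  proof (cases "c \<le> x")
    case True
    have "eventually (\<lambda>y. (indicator {c..} y :: real) = indicator {c..} x) (at_right x)"
      by (rule eventually_mono[OF eventually_at_right_less]) (use True in \<open>auto simp: indicator_def\<close>)
    then show ?thesis unfolding continuous_within by (rule tendsto_eventually)
  next
    case False
    then have "eventually (\<lambda>y. y \<in> {x<..<c}) (at_right x)" by (intro eventually_at_right_real) simp
    then have "eventually (\<lambda>y. (indicator {c..} y :: real) = indicator {c..} x) (at_right x)"
      by (rule eventually_mono) (use False in \<open>auto simp: indicator_def\<close>)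
    then show ?thesis unfolding continuous_within by (rule tendsto_eventually)
  qed
  then show ?thesis unfolding up_jumps_def by (intro continuous_intros)
qed

lemma up_jumps_bound: "\<bar>up_jumps n a x\<bar> \<le> TV n a"
proof -
  have "0 \<le> up_jumps n a x" unfolding up_jumps_def by (intro sum_nonneg) auto
  moreover have "up_jumps n a x \<le> TV n a"
    unfolding up_jumps_def TV_def by (intro sum_mono) (auto simp: indicator_def)
  ultimately show ?thesis by simp
qed

lemma TV_uminus: "TV n (\<lambda>i. - a i) = TV n a"
  unfolding TV_def by (intro sum.cong refl) (simp add: abs_minus_commute)

text \<open>Excluding rational points avoids the nodes of all meshes, the only places where the two one-sided
conventions differ.\<close>

lemma step_up_jumps:
  assumes "0 < x" "x < 1" "0 < n" "x \<notin> \<rat>"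
  shows "step n a x = a 1 + up_jumps n a x - up_jumps n (\<lambda>i. - a i) x"
proof -
  have "x \<noteq> real_of_int i / real n" for i
  proof
    assume "x = real_of_int i / real n"
    moreover have "real_of_int i / real n \<in> \<rat>" by (intro Rats_divide) auto
    ultimately show False using assms(4) by simp
  qed
  then have "indicator {real_of_int i / real n<..} x = (indicator {real_of_int i / real n..} x :: real)" for i
    by (auto simp: indicator_def less_le)
  then show ?thesis
    unfolding step_jumps[OF assms(1-3)] up_jumps_def add_diff_eq[symmetric] sum_subtractf[symmetric]
    by (auto intro!: sum.cong simp: max_def algebra_simps)
qed

lemma borel01_interval_measure:
  assumes mono: "mono F" and rcont: "\<And>x. continuous (at_right x) F"
  defines "P \<equiv> restrict_space (interval_measure F) {0<..<1}"
  shows "borel01_measure P" and "\<lbrakk>0 < x; x < 1\<rbrakk> \<Longrightarrow> borel01_measure.cumul P x = F x - F 0"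
proof -
  note Ioc = emeasure_interval_measure_Ioc[OF _ monoD[OF mono] rcont]
    measure_interval_measure_Ioc[OF _ monoD[OF mono] rcont]
  have "emeasure (interval_measure F) {0<..<1} \<le> emeasure (interval_measure F) {0<..1}"
    by (rule emeasure_mono) auto
  also have "\<dots> < \<infinity>" by (subst Ioc) auto
  finally have "finite_measure P"
    unfolding P_def by (intro finite_measure_restrict_space finite_measureI)
        (auto simp: emeasure_restrict_space)
  moreover have "sets P = sets (restrict_space borel {0<..<1})"
    unfolding P_def by (rule sets_restrict_space_cong) simp
  ultimately show P: "borel01_measure P"
    unfolding borel01_measure_def borel01_measure_axioms_def by blast
  assume x: "0 < x" "x < 1"
  have "borel01_measure.cumul P x = (LINT z|interval_measure F. indicator {0<..<1} z *\<^sub>R indicator {..x} z)"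
    unfolding borel01_measure.cumul_def[OF P] unfolding P_def
    by (rule integral_restrict_space) simp
  also have "\<dots> = (LINT z|interval_measure F. indicator {0<..x} z)"
    by (rule Bochner_Integration.integral_cong) (use x in \<open>auto simp: indicator_def\<close>)
  also have "\<dots> = F x - F 0" using x by (simp add: Ioc)
  finally show "borel01_measure.cumul P x = F x - F 0" .
qed

text \<open>The upward and downward jumps form bounded monotone functions, to which Helly's theorem applies. The
values \<open>a k 1\<close> converge along the subsequence because everything else in the decomposition does, at almost
every point.\<close>

lemma bounded_variation_limit:
  assumes n: "\<And>k. 0 < n k" and TV: "\<And>k. TV (n k) (a k) \<le> M"
    and lim: "AE x in I01. (\<lambda>k. step (n k) (a k) x) \<longlonglongrightarrow> u x"
  obtains P N c where "borel01_measure P" "borel01_measure N"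
    "AE x in I01. u x = c + borel01_measure.cumul P x - borel01_measure.cumul N x"
proof -
  have bnd: "\<bar>up_jumps (n k) (a k) x\<bar> \<le> M" "\<bar>up_jumps (n k) (\<lambda>i. - a k i) x\<bar> \<le> M" for k x
    using up_jumps_bound[of "n k" "a k" x] up_jumps_bound[of "n k" "\<lambda>i. - a k i" x] TV[of k]
    by (simp_all add: TV_uminus)
  obtain s F where s: "strict_mono s" and F: "\<And>x. continuous (at_right x) F" "mono F"
    "\<And>x. isCont F x \<Longrightarrow> (\<lambda>k. up_jumps (n (s k)) (a (s k)) x) \<longlonglongrightarrow> F x"
    using Helly_selection[of "\<lambda>k. up_jumps (n k) (a k)" M] right_continuous_up_jumps mono_up_jumps bnd(1)
    by blast
  obtain r G where r: "strict_mono r" and G: "\<And>x. continuous (at_right x) G" "mono G"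
    "\<And>x. isCont G x \<Longrightarrow> (\<lambda>k. up_jumps (n (s (r k))) (\<lambda>i. - a (s (r k)) i) x) \<longlonglongrightarrow> G x"
    using Helly_selection[of "\<lambda>k. up_jumps (n (s k)) (\<lambda>i. - a (s k) i)" M]
      right_continuous_up_jumps mono_up_jumps bnd(2) by blast
  have null: "AE x in I01. x \<notin> S" if "countable S" for S :: "real set"
    using AE_not_in[OF countable_imp_null_set_lborel[OF that]] unfolding AE_I01_iff
    by eventually_elim auto
  \<comment> \<open>Monotone functions have countably many discontinuities, so these points can be discarded too.\<close>
  have "AE x in I01. (\<lambda>k. a (s (r k)) 1) \<longlonglongrightarrow> u x - F x + G x"
    using lim null[OF mono_ctble_discont[OF F(2)]] null[OF mono_ctble_discont[OF G(2)]] null[OF countable_rat]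
      AE_space
  proof eventually_elim
    fix x assume x: "(\<lambda>k. step (n k) (a k) x) \<longlonglongrightarrow> u x" "x \<notin> {a. \<not> isCont F a}"
      "x \<notin> {a. \<not> isCont G a}" "x \<notin> \<rat>" "x \<in> space I01"
    have "strict_mono (s \<circ> r)" using s r by (simp add: strict_mono_o)
    from LIMSEQ_subseq_LIMSEQ[OF x(1) this]
    have "(\<lambda>k. step (n (s (r k))) (a (s (r k))) x) \<longlonglongrightarrow> u x" by (simp add: comp_def)
    moreover have "(\<lambda>k. up_jumps (n (s (r k))) (a (s (r k))) x) \<longlonglongrightarrow> F x"
      using LIMSEQ_subseq_LIMSEQ[OF F(3) r] x(2) by (simp add: comp_def)
    moreover have "(\<lambda>k. up_jumps (n (s (r k))) (\<lambda>i. - a (s (r k)) i) x) \<longlonglongrightarrow> G x"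
      using G(3) x(3) by simp
    ultimately have "(\<lambda>k. step (n (s (r k))) (a (s (r k))) x - up_jumps (n (s (r k))) (a (s (r k))) x
        + up_jumps (n (s (r k))) (\<lambda>i. - a (s (r k)) i) x) \<longlonglongrightarrow> u x - F x + G x"
      by (intro tendsto_intros)
    then show "(\<lambda>k. a (s (r k)) 1) \<longlonglongrightarrow> u x - F x + G x"
      using x(4,5) n by (simp add: step_up_jumps)
  qed
  moreover from this obtain c where "(\<lambda>k. a (s (r k)) 1) \<longlonglongrightarrow> c"
    using eventually_happens[OF calculation] I01.AE_const by (auto simp: trivial_limit_def)
  ultimately have u: "AE x in I01. u x = c + F x - G x"
    by (auto elim!: eventually_mono dest!: LIMSEQ_unique[OF \<open>_ \<longlonglongrightarrow> c\<close>])
  define P where "P = restrict_space (interval_measure F) {0<..<1}"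
  define N where "N = restrict_space (interval_measure G) {0<..<1}"
  note P = borel01_interval_measure[OF F(2,1), folded P_def]
  note N = borel01_interval_measure[OF G(2,1), folded N_def]
  have "AE x in I01. u x = (c + F 0 - G 0) + borel01_measure.cumul P x - borel01_measure.cumul N x"
    using u AE_space by eventually_elim (simp add: P(2) N(2))
  with P(1) N(1) show thesis by (rule that)
qed

text \<open>The second factor is the derivative of \<open>prim \<rho>\<close> times \<open>prim d\<close>; both of its terms are controlled
    by the norm
of \<open>d\<close>. The estimate is used once with \<open>u\<close> small and once with \<open>d\<close> small.\<close>

lemma pairing_estimate:
  assumes [measurable]: "u \<in> borel_measurable I01" "d \<in> borel_measurable I01" "\<rho> \<in> borel_measurable I01"
    and u: "integrable I01 (\<lambda>x. (u x)\<^sup>2)" and d: "integrable I01 (\<lambda>x. (d x)\<^sup>2)"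
    and \<rho>: "\<And>x. \<lbrakk>0 < x; x < 1\<rbrakk> \<Longrightarrow> \<bar>\<rho> x\<bar> \<le> R"
  shows "integrable I01 (\<lambda>x. u x * (prim \<rho> x * d x + \<rho> x * prim d x))" (is ?int)
    and "\<bar>LINT x|I01. u x * (prim \<rho> x * d x + \<rho> x * prim d x)\<bar>
      \<le> 2 * R * (sqrt (LINT x|I01. (u x)\<^sup>2) * sqrt (LINT x|I01. (d x)\<^sup>2))" (is ?bound)
proof -
  have R0: "0 \<le> R" using \<rho>[of "1/2"] by auto
  have d1: "integrable I01 d" by (rule I01_L2_imp_L1) (use d in auto)
  have \<rho>1: "integrable I01 \<rho>" by (rule I01_bounded_integrable[where B = R]) (use \<rho> in auto)
  have [measurable]: "prim d \<in> borel_measurable I01" "prim \<rho> \<in> borel_measurable I01"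
    using prim_measurable[OF d1] prim_measurable[OF \<rho>1] borel_measurable_I01 by auto
  have prim\<rho>: "\<bar>prim \<rho> x\<bar> \<le> R" for x
  proof -
    have "\<bar>prim \<rho> x\<bar> \<le> (LINT y|I01. \<bar>\<rho> y\<bar>)" by (rule prim_bound[OF \<rho>1])
    also have "\<dots> \<le> (LINT y|I01. R)" by (rule integral_mono) (use \<rho>1 \<rho> in auto)
    finally show ?thesis using I01.prob_space by simp
  qed
  define q where "q x = prim \<rho> x * d x + \<rho> x * prim d x" for x
  define D where "D = (LINT y|I01. (d y)\<^sup>2)"
  have D0: "0 \<le> D" by (simp add: D_def)
  have [measurable]: "q \<in> borel_measurable I01" unfolding q_def by measurable
  have q_le: "(q x)\<^sup>2 \<le> 2 * R\<^sup>2 * ((d x)\<^sup>2 + D)" if "0 < x" "x < 1" for x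
  proof -
    have "(prim \<rho> x * d x)\<^sup>2 \<le> R\<^sup>2 * (d x)\<^sup>2"
      unfolding power_mult_distrib using power_mono[OF prim\<rho>[of x], of 2] by (intro mult_right_mono) auto
    moreover have "(\<rho> x * prim d x)\<^sup>2 \<le> R\<^sup>2 * D"
    proof -
      have "\<bar>prim d x\<bar> \<le> sqrt D" unfolding D_def by (rule prim_L2_bound) (use d in auto)
      from power_mono[OF this, of 2] have "(prim d x)\<^sup>2 \<le> D" using D0 by simp
      then show ?thesis
        unfolding power_mult_distrib using power_mono[OF \<rho>[OF that], of 2] by (intro mult_mono) auto
    qed
    moreover have "(q x)\<^sup>2 \<le> 2 * (prim \<rho> x * d x)\<^sup>2 + 2 * (\<rho> x * prim d x)\<^sup>2"
      using zero_le_power2[of "prim \<rho> x * d x - \<rho> x * prim d x"]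
      unfolding q_def power2_sum power2_diff by simp
    ultimately show ?thesis by (simp add: distrib_left)
  qed
  have q2: "integrable I01 (\<lambda>x. (q x)\<^sup>2)"
  proof (rule Bochner_Integration.integrable_bound[where f = "\<lambda>x. 2 * R\<^sup>2 * ((d x)\<^sup>2 + D)"])
    show "AE x in I01. norm ((q x)\<^sup>2) \<le> norm (2 * R\<^sup>2 * ((d x)\<^sup>2 + D))"
      by (rule AE_I2) (use q_le D0 in auto)
  qed (use d in auto)
  have "(LINT x|I01. (q x)\<^sup>2) \<le> (LINT x|I01. 2 * R\<^sup>2 * ((d x)\<^sup>2 + D))"
    by (rule integral_mono) (use q2 d q_le in auto)
  also have "\<dots> = (2 * R)\<^sup>2 * D"
    using d I01.prob_space by (simp add: D_def power2_eq_square)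
  finally have "sqrt (LINT x|I01. (q x)\<^sup>2) \<le> sqrt ((2 * R)\<^sup>2 * D)" by (rule real_sqrt_le_mono)
  also have "\<dots> = 2 * R * sqrt D" using R0 by (simp add: real_sqrt_mult)
  finally have *: "sqrt (LINT x|I01. (q x)\<^sup>2) \<le> 2 * R * sqrt D" .
  show ?int using Cauchy_Schwarz_integral(1)[OF _ _ u q2] by (simp add: q_def)
  have "\<bar>LINT x|I01. u x * q x\<bar> \<le> sqrt (LINT x|I01. (u x)\<^sup>2) * sqrt (LINT x|I01. (q x)\<^sup>2)"
    by (rule Cauchy_Schwarz_integral(2)) (use u q2 in auto)
  also have "\<dots> \<le> sqrt (LINT x|I01. (u x)\<^sup>2) * (2 * R * sqrt D)"
    by (intro mult_left_mono *) auto
  finally show ?bound by (simp add: q_def D_def mult_ac)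
qed

text \<open>The integrand is the step function \<open>a\<close> times the derivative of \<open>\<eta> V\<close>, where \<open>\<eta> = prim \<rho>\<close> and \<open>V
    = prim f\<close>.
As \<open>V\<close> takes the values \<open>v(i)\<close> at the nodes and vanishes at the ends, integrating over the jumps of
\<open>a\<close> gives minus the sum of \<open>\<eta>(i/n) v(i) (a(i+1) - a(i))\<close>, whose terms are nonnegative. There is no
discretisation error.\<close>

lemma discrete_sign:
  assumes n: "0 < n" and v: "v 0 = 0" "v (int n) = 0"
    and sign: "\<And>i. i \<in> {1..int n - 1} \<Longrightarrow> 0 \<le> v i * (a (i + 1) - a i)"
    and \<rho>: "integrable I01 \<rho>" "\<And>x. \<lbrakk>0 < x; x < 1\<rbrakk> \<Longrightarrow> 0 \<le> prim \<rho> x"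
  defines "f \<equiv> step n (Dminus n v)"
  shows "(LINT x|I01. step n a x * (prim \<rho> x * f x + \<rho> x * prim f x)) \<le> 0"
proof -
  have f: "integrable I01 f" unfolding f_def by (rule step_integrable[OF n])
  define q where "q x = prim \<rho> x * f x + \<rho> x * prim f x" for x
  have q: "integrable I01 q" "\<And>x. prim q x = prim \<rho> x * prim f x"
    unfolding q_def using prim_product[OF \<rho>(1) f] by auto
  have nodes: "prim f (real m / real n) = v (int m)" if "m \<le> n" for m
    unfolding f_def by (rule prim_step_Dminus[of n v m]) (use n v that in auto)
  have q1: "prim q 1 = 0" using nodes[of n] n v q(2)[of 1] by simp
  have tail: "(LINT x|I01. indicator {z<..} x * q x) = - prim q z" for z
  proof -
    have "(LINT x|I01. indicator {z<..} x * q x) = (LINT x|I01. q x - indicator {..z} x * q x)"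
      by (rule Bochner_Integration.integral_cong) (auto simp: indicator_def)
    also have "\<dots> = prim q 1 - prim q z"
      unfolding prim_1[OF order_refl] unfolding prim_def
      by (rule Bochner_Integration.integral_diff) (intro integrable_indicator_mult q)+
    finally show ?thesis using q1 by simp
  qed
  have ind_int: "integrable I01 (\<lambda>x. indicator {z<..} x * q x)" for z
    by (rule integrable_mult_bounded[OF q(1), of _ 1]) (auto intro!: borel_measurable_I01)
  have "(LINT x|I01. step n a x * q x) = (LINT x|I01. a 1 * q x +
     (\<Sum>i=1..int n - 1. (a (i + 1) - a i) * (indicator {real_of_int i / real n<..} x * q x)))"
    by (rule Bochner_Integration.integral_cong[OF refl])
       (simp only: space_lebesgue_on greaterThanLessThan_iff step_jumps[OF _ _ n] distrib_right
          sum_distrib_right mult.assoc)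
  also have "\<dots> = a 1 * prim q 1 +
     (\<Sum>i=1..int n - 1. (a (i + 1) - a i) * (- prim q (real_of_int i / real n)))"
    using q(1) ind_int by (simp add: prim_1 tail[unfolded prim_1])
  also have "\<dots> = (\<Sum>i=1..int n - 1. - (prim \<rho> (real_of_int i / real n) * (v i * (a (i + 1) - a i))))"
  proof -
    have "prim q (real_of_int i / real n) = prim \<rho> (real_of_int i / real n) * v i" if "i \<in> {1..int n - 1}"
        for i
    proof -
      have "nat i \<le> n" using that by auto
      then show ?thesis using nodes[of "nat i"] that q(2) by simp
    qed
    then show ?thesis using q1 by (auto intro!: sum.cong simp: algebra_simps)
  qed
  also have "\<dots> \<le> 0"
  proof (rule sum_nonpos)
    fix i assume i: "i \<in> {1..int n - 1}"
    then have "0 < real_of_int i / real n" "real_of_int i / real n < 1" using n by auto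
    from \<rho>(2)[OF this] sign[OF i]
    show "- (prim \<rho> (real_of_int i / real n) * (v i * (a (i + 1) - a i))) \<le> 0" by simp
  qed
  finally show ?thesis unfolding q_def .
qed

text \<open>The expression of \<open>discrete_sign\<close> is bilinear. Replacing the step function by \<open>u\<close> costs an error that
tends to zero by the hypothesis \<open>close\<close>, in which the convergence of the step functions competes with the
possible growth of the rates. What remains is linear in the rate, so it may be mixed and then passes to the
strong limit of the mixtures.\<close>

lemma limit_sign:
  assumes n: "\<And>k. 0 < n k" and v: "\<And>k. v k 0 = 0" "\<And>k. v k (int (n k)) = 0"
    and sign: "\<And>k i. i \<in> {1..int (n k) - 1} \<Longrightarrow> 0 \<le> v k i * (a k (i + 1) - a k i)"
    and [measurable]: "u \<in> borel_measurable I01" and u2: "integrable I01 (\<lambda>x. (u x)\<^sup>2)"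
  defines "f \<equiv> \<lambda>k. step (n k) (Dminus (n k) (v k))"
  assumes close: "(\<lambda>k. sqrt (LINT x|I01. (step (n k) (a k) x - u x)\<^sup>2) * sqrt (LINT x|I01. (f k x)\<^sup>2)) \<longlonglongrightarrow> 0"
    and c: "\<And>k. c k \<in> tail_weights k"
    and [measurable]: "g \<in> borel_measurable I01" and g2: "integrable I01 (\<lambda>x. (g x)\<^sup>2)"
    and g: "(\<lambda>k. LINT x|I01. (mix (c k) (\<lambda>j. f j x) - g x)\<^sup>2) \<longlonglongrightarrow> 0"
    and [measurable]: "\<rho> \<in> borel_measurable I01" and R: "\<And>x. \<lbrakk>0 < x; x < 1\<rbrakk> \<Longrightarrow> \<bar>\<rho> x\<bar> \<le> R"
    and \<rho>0: "\<And>x. \<lbrakk>0 < x; x < 1\<rbrakk> \<Longrightarrow> 0 \<le> prim \<rho> x"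
  shows "(LINT x|I01. u x * (prim \<rho> x * g x + \<rho> x * prim g x)) \<le> 0"
proof -
  have [measurable]: "f k \<in> borel_measurable I01" for k unfolding f_def by measurable
  have f1: "integrable I01 (f k)" and f2: "integrable I01 (\<lambda>x. (f k x)\<^sup>2)" for k
    unfolding f_def step_square by (rule step_integrable[OF n])+
  have a2: "integrable I01 (\<lambda>x. (step (n k) (a k) x)\<^sup>2)" for k
    unfolding step_square by (rule step_integrable[OF n])
  have \<rho>1: "integrable I01 \<rho>" by (rule I01_bounded_integrable[where B = R]) (use R in auto)
  define B where "B u d = (LINT x|I01. u x * (prim \<rho> x * d x + \<rho> x * prim d x))" for u d
  define \<delta> where "\<delta> k = 2 * R * (sqrt (LINT x|I01. (step (n k) (a k) x - u x)\<^sup>2) * sqrt (LINT x|I01. (f k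
      x)\<^sup>2))" for k
  have uf: "integrable I01 (\<lambda>x. u x * (prim \<rho> x * f k x + \<rho> x * prim (f k) x))" for k
    by (rule pairing_estimate(1)) (use u2 f2 R in auto)
  \<comment> \<open>The pairing with the step function is nonpositive, so only the error of replacing it
      by \<open>u\<close> can be positive.\<close>
  have B\<delta>: "B u (f k) \<le> \<delta> k" for k
  proof -
    have d2: "integrable I01 (\<lambda>x. (step (n k) (a k) x - u x)\<^sup>2)"
      by (rule square_integrable_diff) (use a2 u2 in auto)
    have "B (\<lambda>x. step (n k) (a k) x - u x) (f k) = B (step (n k) (a k)) (f k) - B u (f k)"
      unfolding B_def left_diff_distrib
      by (rule Bochner_Integration.integral_diff) (rule pairing_estimate(1); use a2 u2 f2 R in auto)+
    moreover have "\<bar>B (\<lambda>x. step (n k) (a k) x - u x) (f k)\<bar> \<le> \<delta> k"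
      unfolding B_def \<delta>_def by (rule pairing_estimate(2)) (use d2 f2 R in auto)
    moreover have "B (step (n k) (a k)) (f k) \<le> 0"
      unfolding B_def f_def by (rule discrete_sign) (use n v sign \<rho>1 \<rho>0 in auto)
    ultimately show ?thesis by linarith
  qed
  have \<delta>: "\<delta> \<longlonglongrightarrow> 0"
    unfolding \<delta>_def using tendsto_mult_left[OF close, of "2 * R"] by simp
  define h where "h k x = mix (c k) (\<lambda>j. f j x)" for k x
  have [measurable]: "h k \<in> borel_measurable I01" for k unfolding h_def by measurable
  have h2: "integrable I01 (\<lambda>x. (h k x)\<^sup>2)" for k
    unfolding h_def by (rule mix_square_integrable) (use f2 in auto)
  have "B u (h k) = mix (c k) (\<lambda>j. B u (f j))" for k
  proof -
    have "u x * (prim \<rho> x * h k x + \<rho> x * prim (h k) x)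
        = mix (c k) (\<lambda>j. u x * (prim \<rho> x * f j x + \<rho> x * prim (f j) x))" for x
      unfolding h_def prim_mix[OF f1] by (simp add: mix_add mix_cmult)
    then show ?thesis unfolding B_def by (simp add: mix_integral(2)[OF uf])
  qed
  then have Bh: "B u (h k) \<le> mix (c k) \<delta>" for k
    using mix_mono[OF c B\<delta>] by simp
  have "(\<lambda>k. B u (h k)) \<longlonglongrightarrow> B u g"
  proof (rule Lim_transform[OF tendsto_const])
    have eq: "B u (\<lambda>x. h k x - g x) = B u (h k) - B u g" for k
    proof -
      have "integrable I01 (h k)" "integrable I01 g"
        by (rule I01_L2_imp_L1; use h2 g2 in auto)+
      then have "B u (\<lambda>x. h k x - g x) = (LINT x|I01. u x * (prim \<rho> x * h k x + \<rho> x * prim (h k) x)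
          - u x * (prim \<rho> x * g x + \<rho> x * prim g x))"
        unfolding B_def by (simp add: prim_linear(1) algebra_simps)
      also have "\<dots> = B u (h k) - B u g"
        unfolding B_def
        by (rule Bochner_Integration.integral_diff) (rule pairing_estimate(1); use u2 h2 g2 R in auto)+
      finally show ?thesis .
    qed
    show "(\<lambda>k. B u (h k) - B u g) \<longlonglongrightarrow> 0"
    proof (rule Lim_null_comparison)
      show "eventually (\<lambda>k. norm (B u (h k) - B u g) \<le>
          2 * R * (sqrt (LINT x|I01. (u x)\<^sup>2) * sqrt (LINT x|I01. (h k x - g x)\<^sup>2))) sequentially"
      proof (rule always_eventually, rule allI)
        fix k
        have "\<bar>B u (\<lambda>x. h k x - g x)\<bar> \<le>
          2 * R * (sqrt (LINT x|I01. (u x)\<^sup>2) * sqrt (LINT x|I01. (h k x - g x)\<^sup>2))"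
          unfolding B_def
          by (rule pairing_estimate(2)) (use u2 square_integrable_diff[OF _ _ h2 g2] R in auto)
        then show "norm (B u (h k) - B u g) \<le>
          2 * R * (sqrt (LINT x|I01. (u x)\<^sup>2) * sqrt (LINT x|I01. (h k x - g x)\<^sup>2))"
          unfolding eq by simp
      qed
      have "(\<lambda>k. 2 * R * (sqrt (LINT x|I01. (u x)\<^sup>2) * sqrt (LINT x|I01. (h k x - g x)\<^sup>2)))
          \<longlonglongrightarrow> 2 * R * (sqrt (LINT x|I01. (u x)\<^sup>2) * sqrt 0)"
        by (intro tendsto_intros g[folded h_def])
      then show "(\<lambda>k. 2 * R * (sqrt (LINT x|I01. (u x)\<^sup>2) * sqrt (LINT x|I01. (h k x - g x)\<^sup>2))) \<longlonglongrightarrow> 0"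
        by simp
    qed
  qed
  then have "B u g \<le> 0"
    by (rule LIMSEQ_le[OF _ mix_tendsto[OF c \<delta>]]) (use Bh in auto)
  then show ?thesis unfolding B_def .
qed

section \<open>Nonnegativity of a signed measure\<close>

text \<open>A continuous approximation of the indicator of \<open>x > c\<close> that is a primitive of a bounded function.\<close>

lemma prim_ramp:
  assumes "0 \<le> c" "0 < x" "x < 1" "0 < m"
  shows "prim (\<lambda>y. real m * indicator {c<..c + 1 / real m} y) x = real m * max 0 (min (x - c) (1 / real m))"
proof -
  have "prim (\<lambda>y. real m * indicator {c<..c + 1 / real m} y) x
      = (LINT y|I01. real m * indicator {c<..max c (min x (c + 1 / real m))} y)"
    unfolding prim_def by (rule Bochner_Integration.integral_cong) (auto simp: indicator_def)
  also have "\<dots> = real m * (LINT y|I01. indicator {c<..max c (min x (c + 1 / real m))} y)"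
    by simp
  also have "(LINT y|I01. indicator {c<..max c (min x (c + 1 / real m))} y)
      = max 0 (min (x - c) (1 / real m))"
  proof (cases "c \<le> 1")
    case True
    then show ?thesis
      using I01_Ioc[of c "max c (min x (c + 1 / real m))"] assms by (auto simp: max_def min_def)
  next
    case False
    then have *: "max c (min x (c + 1 / real m)) = c" using assms by auto
    have "min (x - c) (1 / real m) \<le> 0" using False assms by (intro min.coboundedI1) simp
    then show ?thesis unfolding * by simp
  qed
  finally show ?thesis .
qed

text \<open>Differences of two ramps tend pointwise to the indicator of a half-open interval, so the signed measure
with density \<open>w\<close> with respect to \<open>P - N\<close> is nonnegative on such intervals. Its distribution function \<open>W\<close>
is therefore nondecreasing, and Dynkin's theorem identifies the signed measure with the Stieltjes measure
of \<open>W\<close>.\<close>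

lemma signed_measure_nonneg:
  fixes w :: "real \<Rightarrow> real"
  assumes P: "borel01_measure P" and N: "borel01_measure N"
    and w: "w \<in> borel_measurable borel" "\<And>x. \<lbrakk>0 < x; x < 1\<rbrakk> \<Longrightarrow> \<bar>w x\<bar> \<le> B"
    and test: "\<And>\<rho> R. \<lbrakk>\<rho> \<in> borel_measurable I01; \<And>x. \<lbrakk>0 < x; x < 1\<rbrakk> \<Longrightarrow> \<bar>\<rho> x\<bar> \<le> R;
        \<And>x. \<lbrakk>0 < x; x < 1\<rbrakk> \<Longrightarrow> 0 \<le> prim \<rho> x\<rbrakk>
      \<Longrightarrow> 0 \<le> (LINT x|P. prim \<rho> x * w x) - (LINT x|N. prim \<rho> x * w x)"
    and E: "E \<in> sets borel"
  shows "0 \<le> (LINT x|P. indicator E x * w x) - (LINT x|N. indicator E x * w x)"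
proof -
  interpret P: borel01_measure P by fact
  interpret N: borel01_measure N by fact
  note [measurable] = w(1)
  have B0: "0 \<le> B" using w(2)[of "1/2"] by auto
  \<comment> \<open>Integration against the signed measure that has density \<open>w\<close> with respect to \<open>P - N\<close>.\<close>
  define s where "s f = (LINT x|P. f x * w x) - (LINT x|N. f x * w x)" for f
  have bnd: "\<bar>f x * w x\<bar> \<le> B" if "0 < x" "x < 1" "\<bar>f x\<bar> \<le> 1" for f x
    using mult_mono[OF that(3) w(2)[OF that(1,2)]] by (simp add: abs_mult)
  have s_lim: "(\<lambda>k. s (f k)) \<longlonglongrightarrow> s g"
    if [measurable]: "\<And>k. f k \<in> borel_measurable borel" "g \<in> borel_measurable borel"
      and b: "\<And>k x. \<lbrakk>0 < x; x < 1\<rbrakk> \<Longrightarrow> \<bar>f k x\<bar> \<le> 1"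
      and lim: "\<And>x. \<lbrakk>0 < x; x < 1\<rbrakk> \<Longrightarrow> (\<lambda>k. f k x) \<longlonglongrightarrow> g x" for f g
  proof -
    have *: "(\<lambda>k. LINT x|Q. f k x * w x) \<longlonglongrightarrow> (LINT x|Q. g x * w x)" if Q: "borel01_measure Q" for Q
    proof -
      interpret Q: borel01_measure Q by fact
      show ?thesis
        by (rule integral_dominated_convergence[where w = "\<lambda>_. B"])
           (use b bnd lim in \<open>auto intro!: Q.borel_measurable_P tendsto_intros simp: Q.space_P\<close>)
    qed
    show ?thesis unfolding s_def by (rule tendsto_diff[OF *[OF P] *[OF N]])
  qed
  have s_add: "s (\<lambda>x. f x + g x) = s f + s g"
    if [measurable]: "f \<in> borel_measurable borel" "g \<in> borel_measurable borel"
      and b: "\<And>x. \<bar>f x\<bar> \<le> 1" "\<And>x. \<bar>g x\<bar> \<le> 1" for f g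
  proof -
    have "(LINT x|Q. (f x + g x) * w x) = (LINT x|Q. f x * w x) + (LINT x|Q. g x * w x)"
      if Q: "borel01_measure Q" for Q
    proof -
      interpret Q: borel01_measure Q by fact
      have "integrable Q (\<lambda>x. f x * w x)" "integrable Q (\<lambda>x. g x * w x)"
        by (rule Q.integrable_P[of _ B]; use b bnd in auto)+
      then show ?thesis by (simp add: distrib_right)
    qed
    then show ?thesis unfolding s_def using P N by simp
  qed
  have s_cong: "s f = s g" if "\<And>x. \<lbrakk>0 < x; x < 1\<rbrakk> \<Longrightarrow> f x = g x" for f g
  proof -
    have "(LINT x|P. f x * w x) = (LINT x|P. g x * w x)"
      by (rule Bochner_Integration.integral_cong[OF refl]) (use that in \<open>simp add: P.space_P\<close>)
    moreover have "(LINT x|N. f x * w x) = (LINT x|N. g x * w x)"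
      by (rule Bochner_Integration.integral_cong[OF refl]) (use that in \<open>simp add: N.space_P\<close>)
    ultimately show ?thesis by (simp add: s_def)
  qed
  have s_0: "s (\<lambda>_. 0) = 0" "s (indicator {}) = 0" by (simp_all add: s_def)
  have Ioc_pos: "0 \<le> s (indicator {c<..d})" if "0 \<le> c" "c \<le> d" for c d
  proof -
    define \<rho> where "\<rho> m y = real (Suc m) * indicator {c<..c + 1 / real (Suc m)} y
        - real (Suc m) * indicator {d<..d + 1 / real (Suc m)} y" for m y
    define ramp where "ramp a m x = real (Suc m) * max 0 (min (x - a) (1 / real (Suc m)))"
        for a x :: real and m
    have [measurable]: "(\<lambda>x. ramp a m x) \<in> borel_measurable borel" for a m
      unfolding ramp_def by measurable
    have prim_\<rho>: "prim (\<rho> m) x = ramp c m x - ramp d m x" if "0 < x" "x < 1" for m x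
    proof -
      have int: "integrable I01 (\<lambda>y. real (Suc m) * indicator {a<..a + 1 / real (Suc m)} y)" for a
        by (rule I01_bounded_integrable[where B = "real (Suc m)"]) (auto simp: indicator_def)
      show ?thesis
        unfolding \<rho>_def[abs_def] prim_linear(1)[OF int int] ramp_def
        using prim_ramp[of c x "Suc m"] prim_ramp[of d x "Suc m"] that \<open>0 \<le> c\<close> \<open>c \<le> d\<close> by simp
    qed
    have ramp_le: "0 \<le> ramp a m x" "ramp a m x \<le> 1" for a m x
    proof -
      show "0 \<le> ramp a m x" unfolding ramp_def by simp
      have "ramp a m x \<le> real (Suc m) * (1 / real (Suc m))"
        unfolding ramp_def by (rule mult_left_mono) auto
      then show "ramp a m x \<le> 1" by simp
    qed
    have ramp_anti: "ramp d m x \<le> ramp c m x" for m x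
      unfolding ramp_def using \<open>c \<le> d\<close> by (intro mult_left_mono) auto
    have ramp_lim: "(\<lambda>m. ramp a m x) \<longlonglongrightarrow> indicator {a<..} x" for a x
    proof (cases "a < x")
      case True
      have "eventually (\<lambda>m. inverse (real (Suc m)) < x - a) sequentially"
        by (rule order_tendstoD(2)[OF LIMSEQ_inverse_real_of_nat]) (use True in simp)
      then have "eventually (\<lambda>m. ramp a m x = 1) sequentially"
        by (rule eventually_mono) (auto simp: ramp_def min_def divide_inverse max_def)
      then show ?thesis using True by (simp add: tendsto_eventually)
    next
      case False
      then have "min (x - a) (1 / real (Suc m)) \<le> 0" for m by (intro min.coboundedI1) simp
      then have "ramp a m x = 0" for m unfolding ramp_def by simp
      then show ?thesis using False by simp
    qed
    have "0 \<le> s (\<lambda>x. ramp c m x - ramp d m x)" for m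
    proof -
      have "0 \<le> s (prim (\<rho> m))"
        unfolding s_def
      proof (rule test)
        show "\<rho> m \<in> borel_measurable I01" unfolding \<rho>_def by measurable
        show "\<bar>\<rho> m x\<bar> \<le> 2 * real (Suc m)" for x
          unfolding \<rho>_def by (auto simp: indicator_def)
        show "0 \<le> prim (\<rho> m) x" if "0 < x" "x < 1" for x
          using prim_\<rho>[OF that] ramp_anti by simp
      qed
      then show ?thesis using s_cong[OF prim_\<rho>] by simp
    qed
    moreover have "(\<lambda>m. s (\<lambda>x. ramp c m x - ramp d m x)) \<longlonglongrightarrow> s (\<lambda>x. indicator {c<..} x - indicator {d<..} x)"
    proof (rule s_lim)
      show "\<bar>ramp c m x - ramp d m x\<bar> \<le> 1" for m x
        using ramp_le[of c m x] ramp_le[of d m x] by linarith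
    qed (auto intro!: tendsto_intros ramp_lim)
    ultimately have "0 \<le> s (\<lambda>x. indicator {c<..} x - indicator {d<..} x)"
      by (meson LIMSEQ_le_const)
    also have "\<dots> = s (indicator {c<..d})"
      by (rule s_cong) (use \<open>c \<le> d\<close> in \<open>auto simp: indicator_def\<close>)
    finally show ?thesis .
  qed
  define W where "W x = s (indicator {..x})" for x
  have W_diff: "W d = W c + s (indicator {c<..d})" if "c \<le> d" for c d
  proof -
    have "(indicator {..d} :: real \<Rightarrow> real) = (\<lambda>x. indicator {..c} x + indicator {c<..d} x)"
      using that by (auto simp: indicator_def)
    then show ?thesis unfolding W_def by (simp add: s_add)
  qed
  \<comment> \<open>Both measures are concentrated on the unit interval, so negative end points can be moved to \<open>0\<close>.\<close>
  have W_clip: "s (indicator {c<..d}) = s (indicator {max 0 c<..max 0 d})" for c d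
    by (rule s_cong) (auto simp: indicator_def)
  have mono: "W c \<le> W d" if "c \<le> d" for c d
    using W_diff[OF that] Ioc_pos[of "max 0 c" "max 0 d"] that unfolding W_clip[of c d] by auto
  have rcont: "continuous (at_right x) W" for x
    unfolding continuous_within
  proof (rule tendsto_at_right_sequentially[of x "x + 1"])
    fix X :: "nat \<Rightarrow> real" assume X: "\<And>n. x < X n" "X \<longlonglongrightarrow> x"
    show "(\<lambda>n. W (X n)) \<longlonglongrightarrow> W x"
      unfolding W_def
    proof (rule s_lim)
      fix y :: real
      show "(\<lambda>k. indicator {..X k} y :: real) \<longlonglongrightarrow> indicator {..x} y"
      proof (cases "y \<le> x")
        case True
        then show ?thesis using X(1) by (simp add: indicator_def less_imp_le order_trans)
      next
        case False
        then have "eventually (\<lambda>k. X k < y) sequentially" using order_tendstoD(2)[OF X(2)] by simp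
        then have "eventually (\<lambda>k. (indicator {..X k} y :: real) = indicator {..x} y) sequentially"
          by (rule eventually_mono) (use False in \<open>auto simp: indicator_def\<close>)
        then show ?thesis by (rule tendsto_eventually)
      qed
    qed (auto simp: indicator_def)
  qed simp
  define C where "C = interval_measure W"
  note C_Ioc = emeasure_interval_measure_Ioc[OF _ mono rcont, folded C_def]
  have sets_C[measurable_cong]: "sets C = sets borel" and space_C: "space C = UNIV"
    by (simp_all add: C_def)
  \<comment> \<open>As \<open>W\<close> is constant outside the unit interval, the total mass is already seen on a bounded interval.\<close>
  have total: "emeasure C UNIV = ennreal (s (\<lambda>_. 1))"
  proof -
    have "(\<lambda>k. emeasure C {- real k<..real k}) \<longlonglongrightarrow> emeasure C (\<Union>k. {- real k<..real k})"
      by (rule Lim_emeasure_incseq) (auto simp: sets_C incseq_def)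
    moreover have "(\<Union>k. {- real k<..real k}) = UNIV"
    proof -
      have "\<exists>k. - real k < x \<and> x \<le> real k" for x
      proof -
        obtain k :: nat where "\<bar>x\<bar> < real k" using reals_Archimedean2 by blast
        then show ?thesis by (intro exI[of _ k]) auto
      qed
      then show ?thesis by auto
    qed
    moreover have "(\<lambda>k. emeasure C {- real k<..real k}) \<longlonglongrightarrow> ennreal (s (\<lambda>_. 1))"
    proof (rule tendsto_eventually, rule eventually_mono[OF eventually_ge_at_top[of 1]])
      fix k :: nat assume k: "1 \<le> k"
      have "W (real k) - W (- real k) = s (indicator {- real k<..real k})"
        using W_diff[of "- real k" "real k"] by simp
      also have "\<dots> = s (\<lambda>_. 1)" by (rule s_cong) (use k in \<open>auto simp: indicator_def\<close>)
      finally show "emeasure C {- real k<..real k} = ennreal (s (\<lambda>_. 1))" by (simp add: C_Ioc)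
    qed
    ultimately show ?thesis by (simp add: LIMSEQ_unique)
  qed
  interpret C: finite_measure C by standard (simp add: space_C total)
  have s1: "0 \<le> s (\<lambda>_. 1)"
  proof -
    have "s (\<lambda>_. 1) = s (indicator {0<..1})" by (rule s_cong) auto
    then show ?thesis using Ioc_pos[of 0 1] by simp
  qed
  have measure_UNIV: "measure C UNIV = s (\<lambda>_. 1)"
    by (simp add: measure_def total s1)
  let ?G = "range (\<lambda>(a, b). {a<..b::real})"
  have "s (indicator E) = measure C E"
  proof (rule sigma_sets_induct_disjoint[of ?G UNIV E])
    show "Int_stable ?G"
    proof (rule Int_stableI)
      fix A A' assume "A \<in> ?G" "A' \<in> ?G"
      then obtain a b c d where "A = {a<..b}" "A' = {c<..d}" by auto
      then have "A \<inter> A' = (\<lambda>(a, b). {a<..b}) (max a c, min b d)" by auto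
      then show "A \<inter> A' \<in> ?G" by blast
    qed
    show "E \<in> sigma_sets UNIV ?G"
      using E unfolding borel_sigma_sets_Ioc by simp
    show "s (indicator A) = measure C A" if "A \<in> ?G" for A
    proof -
      obtain a b where A: "A = {a<..b}" using \<open>A \<in> ?G\<close> by auto
      show ?thesis
      proof (cases "a \<le> b")
        case True
        then show ?thesis unfolding A using W_diff[OF True] mono[OF True]
          by (simp add: measure_def C_Ioc)
      next
        case False
        then have "A = {}" unfolding A by auto
        then show ?thesis using s_0 by simp
      qed
    qed
    show "s (indicator {}) = measure C {}" using s_0 by simp
  next
    fix A assume A: "A \<in> sigma_sets UNIV ?G" "s (indicator A) = measure C A"
    then have [measurable]: "A \<in> sets borel" unfolding borel_sigma_sets_Ioc by simp
    have "s (\<lambda>_. 1) = s (\<lambda>x. indicator A x + indicator (UNIV - A) x)"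
      by (rule s_cong) (auto simp: indicator_def)
    also have "\<dots> = s (indicator A) + s (indicator (UNIV - A))" by (simp add: s_add)
    finally show "s (indicator (UNIV - A)) = measure C (UNIV - A)"
      using A(2) C.finite_measure_compl[of A] by (simp add: space_C measure_UNIV sets_C)
  next
    fix A :: "nat \<Rightarrow> real set"
    assume A: "disjoint_family A" "range A \<subseteq> sigma_sets UNIV ?G" "\<And>i. s (indicator (A i)) = measure C (A i)"
    have [measurable]: "A i \<in> sets borel" for i using A(2) unfolding borel_sigma_sets_Ioc by auto
    have partial: "(\<Sum>i<k. indicator (A i) x) \<le> (indicator (\<Union>i. A i) x :: real)" for k x
      using indicator_sums[of A x] A(1) sums_unique sums_summable
      by (metis (no_types, lifting) disjoint_family_on_def iso_tuple_UNIV_I sum_le_suminf indicator_pos_le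
          finite_lessThan)
    have "(\<lambda>k. s (\<lambda>x. \<Sum>i<k. indicator (A i) x)) \<longlonglongrightarrow> s (indicator (\<Union>i. A i))"
    proof (rule s_lim)
      fix k and x :: real
      have "0 \<le> (\<Sum>i<k. indicator (A i) x :: real)" by (intro sum_nonneg) auto
      with order_trans[OF partial[of x k] indicator_le_1] show "\<bar>\<Sum>i<k. indicator (A i) x\<bar> \<le> (1::real)"
        by (simp only: abs_of_nonneg)
    next
      fix x :: real
      show "(\<lambda>k. \<Sum>i<k. indicator (A i) x :: real) \<longlonglongrightarrow> indicator (\<Union>i. A i) x"
        using indicator_sums[of A x] A(1) unfolding sums_def disjoint_family_on_def by auto
    qed measurable
    moreover have "s (\<lambda>x. \<Sum>i<k. indicator (A i) x) = (\<Sum>i<k. measure C (A i))" for k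
    proof (induction k)
      case 0
      then show ?case using s_0 by simp
    next
      case (Suc k)
      have "\<bar>\<Sum>i<k. indicator (A i) x :: real\<bar> \<le> 1" for x
      proof -
        have "0 \<le> (\<Sum>i<k. indicator (A i) x :: real)" by (intro sum_nonneg) auto
        with order_trans[OF partial[of x k] indicator_le_1] show ?thesis by (simp only: abs_of_nonneg)
      qed
      then show ?case using Suc A(3) by (simp add: s_add)
    qed
    moreover have "(\<lambda>i. measure C (A i)) sums measure C (\<Union>i. A i)"
      by (rule C.finite_measure_UNION) (use A(1) in \<open>auto simp: sets_C\<close>)
    ultimately show "s (indicator (\<Union>i. A i)) = measure C (\<Union>i. A i)"
      unfolding sums_def by (auto dest: LIMSEQ_unique)
  qed auto
  then show ?thesis unfolding s_def by (metis measure_nonneg)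
qed

section \<open>Slices of the space-time strip\<close>

abbreviation (input) strip :: "(real \<times> real) set" where "strip \<equiv> {0<..} \<times> {0<..<1}"

abbreviation J0 :: "real measure" where "J0 \<equiv> lebesgue_on {0<..}"

lemma strip_sets[measurable, simp]: "strip \<in> sets borel"
  by (intro borel_open open_Times) auto

lemma AE_J0_iff: "(AE t in J0. P t) \<longleftrightarrow> (AE t in lborel. 0 < t \<longrightarrow> P t)"
  by (subst AE_restrict_space_iff) (auto simp: AE_completion_iff)

lemma AE_strip_iff: "(AE p in lebesgue_on strip. P p) \<longleftrightarrow> (AE p in lborel. p \<in> strip \<longrightarrow> P p)"
  by (subst AE_restrict_space_iff) (auto simp: AE_completion_iff)

lemma AE_strip_slices:
  assumes "AE p in lebesgue_on strip. P p"
  shows "AE t in J0. AE x in I01. P (t, x)"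
proof -
  have "AE p in lborel \<Otimes>\<^sub>M lborel. p \<in> strip \<longrightarrow> P p"
    using assms unfolding AE_strip_iff lborel_prod .
  from lborel_pair.AE_pair[OF this]
  have "AE t in lborel. AE x in lborel. (t, x) \<in> strip \<longrightarrow> P (t, x)" .
  then show ?thesis
    unfolding AE_J0_iff AE_I01_iff by eventually_elim auto
qed

text \<open>For a set that is only Lebesgue measurable in the plane, slices need not be measurable. Its Borel
    main part
differs from it by a null set, and Tonelli's theorem applies to the main part.\<close>

lemma AE_slices_strip:
  assumes meas: "{p. \<not> P p} \<inter> strip \<in> sets lebesgue"
    and ae: "AE t in J0. AE x in I01. P (t, x)"
  shows "AE p in lebesgue_on strip. P p"
proof -
  define B where "B = main_part lborel ({p. \<not> P p} \<inter> strip)"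
  have [measurable]: "B \<in> sets borel" unfolding B_def using main_part_sets[OF meas] by simp
  have B_sub: "B \<subseteq> {p. \<not> P p} \<inter> strip"
    using main_part_null_part_Un[OF meas] unfolding B_def by blast
  have "AE p in lborel \<Otimes>\<^sub>M lborel. p \<notin> B"
  proof (rule lborel_pair.AE_pair_measure)
    have "{p. p \<notin> B} \<in> sets (lborel :: (real \<times> real) measure)" by measurable
    then show "{p \<in> space (lborel \<Otimes>\<^sub>M lborel). p \<notin> B} \<in> sets (lborel \<Otimes>\<^sub>M lborel)"
      unfolding lborel_prod by simp
    show "AE t in lborel. AE x in lborel. (t, x) \<notin> B"
      using ae unfolding AE_J0_iff AE_I01_iff
    proof eventually_elim
      case (elim t)
      show ?case
      proof (cases "0 < t")
        case True
        with elim have "AE x in lborel. 0 < x \<and> x < 1 \<longrightarrow> P (t, x)" by simp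
        then show ?thesis by eventually_elim (use B_sub in auto)
      next
        case False
        then show ?thesis using B_sub by auto
      qed
    qed
  qed
  then have "AE p in lborel. p \<notin> B" unfolding lborel_prod .
  with AE_in_main_part[OF meas] show ?thesis
    unfolding AE_strip_iff B_def by eventually_elim auto
qed

lemma AE_slices_convergent:
  fixes f :: "nat \<Rightarrow> real \<times> real \<Rightarrow> real"
  assumes [measurable]: "\<And>k. f k \<in> borel_measurable borel"
    and ae: "AE t in J0. AE x in I01. convergent (\<lambda>k. f k (t, x))"
  shows "AE p in lebesgue_on strip. convergent (\<lambda>k. f k p)"
proof (rule AE_slices_strip[OF _ ae])
  have "{p \<in> space borel. \<not> Cauchy (\<lambda>k. f k p)} \<in> sets borel" by measurable
  then have "{p. \<not> Cauchy (\<lambda>k. f k p)} \<inter> strip \<in> sets borel" by auto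
  then have "{p. \<not> Cauchy (\<lambda>k. f k p)} \<inter> strip \<in> sets lebesgue"
    by (intro sets_completionI_sets) simp
  then show "{p. \<not> convergent (\<lambda>k. f k p)} \<inter> strip \<in> sets lebesgue"
    by (simp only: Cauchy_convergent_iff)
qed

lemma integral_strip:
  fixes f :: "real \<times> real \<Rightarrow> real"
  assumes [measurable]: "f \<in> borel_measurable borel"
  shows "(LINT p|lebesgue_on strip. f p) = (LINT p|lborel. indicator strip p * f p)"
  by (subst integral_restrict_space) (auto intro!: integral_completion)

lemma integrable_strip:
  fixes f :: "real \<times> real \<Rightarrow> real"
  assumes [measurable]: "f \<in> borel_measurable borel"
  shows "integrable (lebesgue_on strip) f \<longleftrightarrow> integrable lborel (\<lambda>p. indicator strip p * f p)"
  by (subst integrable_restrict_space) (auto intro!: integrable_completion)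

lemma borel_measurable_strip:
  "f \<in> borel_measurable borel \<Longrightarrow> f \<in> borel_measurable (lebesgue_on strip)"
  by (intro measurable_restrict_space1 measurable_completion) simp

text \<open>Extending by zero outside the strip makes this a Borel function on the plane, so that integrals over
space-time are integrals over \<open>lborel\<close>, for which Fubini's theorem is available.\<close>

definition spacetime :: "nat \<Rightarrow> (real \<Rightarrow> int \<Rightarrow> real) \<Rightarrow> real \<times> real \<Rightarrow> real" where
  "spacetime n a p = (if p \<in> strip then step n (a (fst p)) (snd p) else 0)"

lemma spacetime_measurable:
  assumes n: "0 < n" and cont: "\<And>i. i \<in> {1..int n} \<Longrightarrow> continuous_on {0..} (\<lambda>t. a t i)"
  shows "spacetime n a \<in> borel_measurable borel"
proof -
  define b where "b t i = (indicator {0..} t *\<^sub>R a t i :: real)" for t i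
  have [measurable]: "(\<lambda>t. b t i) \<in> borel_measurable borel" if "i \<in> {1..int n}" for i
    unfolding b_def by (rule borel_measurable_continuous_on_indicator) (use cont[OF that] in auto)
  have "(\<lambda>p. indicator strip p * (\<Sum>i=1..int n. b (fst p) i * (if \<lceil>real n * snd p\<rceil>
      = i then 1 else 0))) \<in> borel_measurable (borel :: (real \<times> real) measure)"
    unfolding borel_prod[symmetric] by measurable
  moreover have "spacetime n a = (\<lambda>p. indicator strip p * (\<Sum>i=1..int n. b (fst p) i * (if \<lceil>real n * snd p\<rceil>
      = i then 1 else 0)))"
  proof
    fix p
    show "spacetime n a p = indicator strip p * (\<Sum>i=1..int n. b (fst p) i * (if \<lceil>real n * snd p\<rceil>
        = i then 1 else 0))"
    proof (cases "p \<in> strip")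
      case True
      then have "\<lceil>real n * snd p\<rceil> \<in> {1..int n}" using ceiling_in_range[OF _ _ n, of "snd p"] by auto
      then have "(\<Sum>i=1..int n. b (fst p) i * (if \<lceil>real n * snd p\<rceil> = i then 1 else 0))
          = b (fst p) \<lceil>real n * snd p\<rceil>"
        by (simp add: if_distrib[of "\<lambda>z. _ * z"] cong: if_cong)
      then show ?thesis using True by (auto simp: spacetime_def step_def b_def)
    qed (simp add: spacetime_def)
  qed
  ultimately show ?thesis by simp
qed

lemma nn_integral_spacetime:
  assumes n: "0 < n" and cont: "\<And>i. i \<in> {1..int n} \<Longrightarrow> continuous_on {0..} (\<lambda>t. a t i)"
  shows "(\<integral>\<^sup>+p. ennreal ((spacetime n a p)\<^sup>2) \<partial>lborel)
    = (\<integral>\<^sup>+t. indicator {0<..} t * ennreal ((\<Sum>i=1..int n. (a t i)\<^sup>2) / n) \<partial>lborel)"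
proof -
  have [measurable]: "spacetime n a \<in> borel_measurable (borel \<Otimes>\<^sub>M borel)"
    using spacetime_measurable[OF assms] by (simp add: borel_prod)
  have "(\<integral>\<^sup>+p. ennreal ((spacetime n a p)\<^sup>2) \<partial>lborel)
      = (\<integral>\<^sup>+p. ennreal ((spacetime n a p)\<^sup>2) \<partial>(lborel \<Otimes>\<^sub>M lborel))"
    unfolding lborel_prod ..
  also have "\<dots> = (\<integral>\<^sup>+t. \<integral>\<^sup>+x. ennreal ((spacetime n a (t, x))\<^sup>2) \<partial>lborel \<partial>lborel)"
    by (rule lborel.nn_integral_fst[symmetric]) measurable
  also have "\<dots> = (\<integral>\<^sup>+t. indicator {0<..} t * ennreal ((\<Sum>i=1..int n. (a t i)\<^sup>2) / n) \<partial>lborel)"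
  proof (rule nn_integral_cong)
    fix t :: real
    show "(\<integral>\<^sup>+x. ennreal ((spacetime n a (t, x))\<^sup>2) \<partial>lborel)
        = indicator {0<..} t * ennreal ((\<Sum>i=1..int n. (a t i)\<^sup>2) / n)"
    proof (cases "0 < t")
      case True
      have "(\<integral>\<^sup>+x. ennreal ((spacetime n a (t, x))\<^sup>2) \<partial>lborel)
          = (\<integral>\<^sup>+x. ennreal ((step n (a t) x)\<^sup>2) * indicator {0<..<1} x \<partial>lborel)"
        by (rule nn_integral_cong) (use True in \<open>auto simp: spacetime_def indicator_def\<close>)
      also have "\<dots> = (\<integral>\<^sup>+x. ennreal ((step n (a t) x)\<^sup>2) \<partial>I01)"
        by (rule nn_integral_I01[symmetric]) measurable
      also have "\<dots> = ennreal (LINT x|I01. (step n (a t) x)\<^sup>2)"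
      proof (rule nn_integral_eq_integral)
        show "integrable I01 (\<lambda>x. (step n (a t) x)\<^sup>2)"
          unfolding step_square by (rule step_integrable[OF n])
      qed simp
      also have "\<dots> = ennreal ((\<Sum>i=1..int n. (a t i)\<^sup>2) / n)"
        unfolding step_square integral_step[OF n] ..
      finally show ?thesis using True by simp
    qed (simp add: spacetime_def)
  qed
  finally show ?thesis .
qed

lemma suminf_nn_integral_AE:
  fixes f :: "nat \<Rightarrow> 'a \<Rightarrow> ennreal"
  assumes [measurable]: "\<And>k. f k \<in> borel_measurable M"
    and le: "\<And>k. (\<integral>\<^sup>+x. f k x \<partial>M) \<le> ennreal (b k)" and b: "\<And>k. 0 \<le> b k" "summable b"
  shows "AE x in M. (\<Sum>k. f k x) \<noteq> \<infinity>"
proof -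
  have "(\<integral>\<^sup>+x. (\<Sum>k. f k x) \<partial>M) = (\<Sum>k. \<integral>\<^sup>+x. f k x \<partial>M)"
    by (rule nn_integral_suminf) measurable
  also have "\<dots> \<le> (\<Sum>k. ennreal (b k))" by (intro suminf_le summableI allI le)
  also have "\<dots> < \<infinity>" by (subst suminf_ennreal2[OF b]) auto
  finally show ?thesis by (intro nn_integral_PInf_AE) auto
qed

text \<open>The series of the squares has a finite integral, so it converges almost everywhere.\<close>

lemma AE_tendsto_zero_of_L2:
  fixes d :: "nat \<Rightarrow> 'a \<Rightarrow> real"
  assumes [measurable]: "\<And>k. d k \<in> borel_measurable M"
    and "\<And>k. (\<integral>\<^sup>+x. ennreal ((d k x)\<^sup>2) \<partial>M) \<le> ennreal (b k)" "\<And>k. 0 \<le> b k" "summable b"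
  shows "AE x in M. (\<lambda>k. d k x) \<longlonglongrightarrow> 0"
proof -
  have "AE x in M. (\<Sum>k. ennreal ((d k x)\<^sup>2)) \<noteq> \<infinity>"
    by (rule suminf_nn_integral_AE[where b = b]) (use assms in auto)
  then show ?thesis
  proof eventually_elim
    case (elim x)
    then have "summable (\<lambda>k. (d k x)\<^sup>2)" by (intro summable_suminf_not_top) auto
    then have "(\<lambda>k. (d k x)\<^sup>2) \<longlonglongrightarrow> 0" by (rule summable_LIMSEQ_zero)
    then have "(\<lambda>k. sqrt ((d k x)\<^sup>2)) \<longlonglongrightarrow> sqrt 0" by (rule tendsto_real_sqrt)
    then show ?case by (simp add: tendsto_rabs_zero_iff)
  qed
qed

text \<open>The flux and the primitive of the rate agree at the right end of the cell that contains \<open>x\<close>; over a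
    cell,
the Cauchy--Schwarz inequality bounds the change of the primitive.\<close>

lemma prim_step_interpolates:
  assumes n: "0 < n" and v: "v 0 = 0" and x: "0 < x" "x < 1"
  defines "f \<equiv> step n (Dminus n v)"
  shows "\<bar>step n v x - prim f x\<bar> \<le> sqrt (LINT y|I01. (f y)\<^sup>2) / sqrt (real n)"
proof -
  have f2: "integrable I01 (\<lambda>y. (f y)\<^sup>2)" unfolding f_def step_square by (rule step_integrable[OF n])
  have f1: "integrable I01 f" unfolding f_def by (rule step_integrable[OF n])
  have [measurable]: "f \<in> borel_measurable I01" unfolding f_def by simp
  define i where "i = \<lceil>real n * x\<rceil>"
  define b where "b = real_of_int i / real n"
  have i: "i \<in> {1..int n}" unfolding i_def by (rule ceiling_in_range[OF x n])
  have "real n * x \<le> i" "real_of_int i < real n * x + 1" unfolding i_def by linarith+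
  then have b: "x \<le> b" "b \<le> x + 1 / real n" "b \<le> 1"
    unfolding b_def using n i by (auto simp: field_simps)
  have "prim f b = step n v x"
    using prim_step_Dminus[of n v "nat i"] n v i unfolding f_def b_def step_def i_def[symmetric] by
        (simp add: nat_le_iff)
  moreover have "prim f b - prim f x = (LINT y|I01. indicator {x<..b} y * f y)"
    by (rule prim_diff_Ioc[OF f1 b(1)])
  ultimately have "\<bar>step n v x - prim f x\<bar> = \<bar>LINT y|I01. indicator {x<..b} y * f y\<bar>" by simp
  also have "\<dots> \<le> sqrt (LINT y|I01. (indicator {x<..b} y)\<^sup>2) * sqrt (LINT y|I01. (f y)\<^sup>2)"
    by (rule Cauchy_Schwarz_integral(2)) (use f2 in \<open>auto intro!: I01_bounded_integrable[where B
        = 1] simp: indicator_def power2_eq_square\<close>)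
  also have "(LINT y|I01. (indicator {x<..b} y)\<^sup>2) = b - x"
  proof -
    have "(LINT y|I01. (indicator {x<..b} y)\<^sup>2) = (LINT y|I01. indicator {x<..b} y :: real)"
      by (rule Bochner_Integration.integral_cong) (auto simp: indicator_def)
    then show ?thesis using I01_Ioc[of x b] x b by simp
  qed
  also have "sqrt (b - x) * sqrt (LINT y|I01. (f y)\<^sup>2) \<le> sqrt (1 / real n) * sqrt (LINT y|I01. (f y)\<^sup>2)"
    using b by (intro mult_right_mono real_sqrt_le_mono) auto
  finally show ?thesis by (simp add: real_sqrt_divide)
qed

text \<open>The hypothesis \<open>small\<close> makes the interpolation error negligible, so the mixed fluxes and the
    primitives of
the mixed rates have the same limit. The latter converge uniformly, because the mixed rates converge in
\<open>L\<^sup>2\<close>.\<close>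

lemma flux_limit:
  assumes n: "\<And>k. 0 < n k" and v: "\<And>k. v k 0 = 0" "\<And>k. v k (int (n k)) = 0"
  defines "f \<equiv> \<lambda>k. step (n k) (Dminus (n k) (v k))"
  assumes small: "(\<lambda>k. sqrt (LINT x|I01. (f k x)\<^sup>2) / sqrt (real (n k))) \<longlonglongrightarrow> 0"
    and c: "\<And>k. c k \<in> tail_weights k"
    and [measurable]: "g \<in> borel_measurable I01" and g2: "integrable I01 (\<lambda>x. (g x)\<^sup>2)"
    and g: "(\<lambda>k. LINT x|I01. (mix (c k) (\<lambda>j. f j x) - g x)\<^sup>2) \<longlonglongrightarrow> 0"
  shows "prim g 1 = 0"
    and "\<lbrakk>0 < x; x < 1\<rbrakk> \<Longrightarrow> (\<lambda>k. mix (c k) (\<lambda>j. step (n j) (v j) x)) \<longlonglongrightarrow> prim g x"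
proof -
  have [measurable]: "f k \<in> borel_measurable I01" for k unfolding f_def by measurable
  have f1: "integrable I01 (f k)" and f2: "integrable I01 (\<lambda>x. (f k x)\<^sup>2)" for k
    unfolding f_def step_square by (rule step_integrable[OF n])+
  define h where "h k x = mix (c k) (\<lambda>j. f j x)" for k x
  have [measurable]: "h k \<in> borel_measurable I01" for k unfolding h_def by measurable
  have h2: "integrable I01 (\<lambda>x. (h k x)\<^sup>2)" for k
    unfolding h_def by (rule mix_square_integrable) (use f2 in auto)
  have lim: "(\<lambda>k. prim (h k) x) \<longlonglongrightarrow> prim g x" for x
  proof (rule LIM_zero_cancel, rule Lim_null_comparison)
    show "eventually (\<lambda>k. norm (prim (h k) x - prim g x) \<le> sqrt (LINT y|I01. (h k y - g y)\<^sup>2)) sequentially"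
    proof (intro always_eventually allI)
      fix k
      have "prim (h k) x - prim g x = prim (\<lambda>y. h k y - g y) x"
        by (rule prim_linear(1)[symmetric]) (rule I01_L2_imp_L1; use h2 g2 in auto)+
      then show "norm (prim (h k) x - prim g x) \<le> sqrt (LINT y|I01. (h k y - g y)\<^sup>2)"
        using prim_L2_bound[of "\<lambda>y. h k y - g y" x] square_integrable_diff[OF _ _ h2[of k] g2] by simp
    qed
    show "(\<lambda>k. sqrt (LINT y|I01. (h k y - g y)\<^sup>2)) \<longlonglongrightarrow> 0"
      using tendsto_real_sqrt[OF g[folded h_def]] by simp
  qed
  have prim_h: "prim (h k) x = mix (c k) (\<lambda>j. prim (f j) x)" for k x
    unfolding h_def by (rule prim_mix) (rule f1)
  have "prim (f k) 1 = 0" for k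
    using prim_step_Dminus[of "n k" "v k" "n k"] n[of k] v(1,2)[of k] unfolding f_def by simp
  then have "prim (h k) 1 = 0" for k
    unfolding prim_h by (simp add: mix_const[OF c])
  then show "prim g 1 = 0"
    using LIMSEQ_unique[OF lim[of 1]] by simp
  assume x: "0 < x" "x < 1"
  have "(\<lambda>j. step (n j) (v j) x - prim (f j) x) \<longlonglongrightarrow> 0"
    by (rule Lim_null_comparison[OF _ small])
       (use prim_step_interpolates[of "n k" "v k" x for k] n v(1) x in \<open>auto simp: f_def\<close>)
  from tendsto_add[OF mix_tendsto[OF c this] lim[of x]]
  show "(\<lambda>k. mix (c k) (\<lambda>j. step (n j) (v j) x)) \<longlonglongrightarrow> prim g x"
    unfolding prim_h by (simp add: mix_diff)
qed

section \<open>Mixing the fluxes and the time derivatives\<close>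

text \<open>A subsequence chosen so that \<open>w k\<close> approaches \<open>u\<close>, and the mesh is refined, at geometric rates.
    These rates
have to beat the growth of the norm of the time derivatives on a slice, which can be of order \<open>sqrt 2 ^ k\<close>
(see \<open>AE_rates_slow\<close>).\<close>

locale approximating_sequence =
  fixes \<phi> :: "real \<Rightarrow> real" and n :: "nat \<Rightarrow> nat" and w :: "nat \<Rightarrow> real \<Rightarrow> int \<Rightarrow> real"
    and u :: "real \<Rightarrow> real \<Rightarrow> real" and M C :: real
  assumes flow: "\<And>k. semidiscrete_flow \<phi> (n k) (w k)"
    and data: "\<And>k. sup_norm (n k) (w k 0) + TV (n k) (w k 0) \<le> M"
    and C: "\<And>s. \<bar>deriv \<phi> s\<bar> \<le> C"
    and mesh: "\<And>k. 4 ^ k \<le> n k"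
    and u_L2: "\<And>t. 0 \<le> t \<Longrightarrow> in_L2_01 (u t)"
    and close: "\<And>k t. \<lbrakk>0 \<le> t; t \<le> real k\<rbrakk> \<Longrightarrow> L2_norm01 (\<lambda>x. step (n k) (w k t) x - u t x) \<le> (1/2) ^ k"
begin

abbreviation v where "v k t \<equiv> flux \<phi> (n k) (w k t)"
abbreviation rate where "rate k t \<equiv> Dminus (n k) (v k t)"
abbreviation rate_norm where "rate_norm k t \<equiv> sqrt (LINT x|I01. (step (n k) (rate k t) x)\<^sup>2)"

lemma n_pos: "0 < n k"
  using semidiscrete_flow.n_pos[OF flow] .

lemma C_nonneg: "0 \<le> C"
  using C[of 0] by auto

lemma u_measurable: "0 \<le> t \<Longrightarrow> u t \<in> borel_measurable I01"
  and u_square: "0 \<le> t \<Longrightarrow> integrable I01 (\<lambda>x. (u t x)\<^sup>2)"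
  using u_L2 by (auto simp: in_L2_01_def)

lemma step_sq: "integrable I01 (\<lambda>x. (step (n k) a x)\<^sup>2)"
  unfolding step_square by (rule step_integrable[OF n_pos])

lemma diff_sq: "0 \<le> t \<Longrightarrow> integrable I01 (\<lambda>x. (step (n k) (w k t) x - u t x)\<^sup>2)"
  by (rule square_integrable_diff) (use u_measurable u_square step_sq in auto)

lemma close_sq:
  assumes "0 \<le> t" "t \<le> real k"
  shows "(LINT x|I01. (step (n k) (w k t) x - u t x)\<^sup>2) \<le> (1/4) ^ k"
proof -
  have "(sqrt (LINT x|I01. (step (n k) (w k t) x - u t x)\<^sup>2))\<^sup>2 \<le> ((1/2) ^ k)\<^sup>2"
    using close[OF assms] unfolding L2_norm01_def by (intro power_mono) auto
  then show ?thesis by (simp add: power_mult[symmetric] power_mult_distrib[symmetric] power2_eq_square)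
qed

lemma slices_converge:
  assumes t: "0 \<le> t"
  shows "AE x in I01. (\<lambda>k. step (n k) (w k t) x) \<longlonglongrightarrow> u t x"
proof -
  define m where "m = nat \<lceil>t\<rceil>"
  have m: "t \<le> real m" unfolding m_def by linarith
  note [measurable] = u_measurable[OF t]
  have "AE x in I01. (\<lambda>k. step (n (k + m)) (w (k + m) t) x - u t x) \<longlonglongrightarrow> 0"
  proof (rule AE_tendsto_zero_of_L2[where b = "\<lambda>k. (1/4) ^ k"])
    fix k
    have "(\<integral>\<^sup>+x. ennreal ((step (n (k + m)) (w (k + m) t) x - u t x)\<^sup>2) \<partial>I01)
        = ennreal (LINT x|I01. (step (n (k + m)) (w (k + m) t) x - u t x)\<^sup>2)"
      by (rule nn_integral_eq_integral[OF diff_sq[OF t]]) simp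
    also have "\<dots> \<le> ennreal ((1/4) ^ (k + m))"
      using close_sq[OF t, of "k + m"] m by (intro ennreal_leI) simp
    also have "\<dots> \<le> ennreal ((1/4) ^ k)"
      by (intro ennreal_leI power_decreasing) auto
    finally show "(\<integral>\<^sup>+x. ennreal ((step (n (k + m)) (w (k + m) t) x - u t x)\<^sup>2) \<partial>I01) \<le> ennreal ((1/4) ^ k)" .
  qed (auto intro!: summable_geometric)
  then show ?thesis
  proof eventually_elim
    case (elim x)
    then have "(\<lambda>k. step (n (k + m)) (w (k + m) t) x) \<longlonglongrightarrow> u t x" by (rule LIM_zero_cancel)
    then show ?case by (rule LIMSEQ_offset)
  qed
qed

lemma TV_bound: "0 \<le> t \<Longrightarrow> TV (n k) (w k t) \<le> M"
  using semidiscrete_flow.TV_nonincreasing[OF flow, of t k] data[of k] sup_norm_nonneg[OF n_pos, of k "w k 0"]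
  by linarith

lemma w_bound: "\<lbrakk>0 \<le> t; i \<in> {1..int (n k)}\<rbrakk> \<Longrightarrow> \<bar>w k t i\<bar> \<le> M"
  using semidiscrete_flow.uniform_bound[OF flow, of t i k] data[of k] by linarith

lemma M_nonneg: "0 \<le> M"
  using w_bound[of 0 1 0] n_pos[of 0] by force

lemma v_bound: "\<bar>v k t i\<bar> \<le> C"
  unfolding flux_def by (rule C)

text \<open>This bound depends on the mesh; it only serves to make integrals on a fixed mesh finite.\<close>

lemma rate_bound: "\<bar>rate k t i\<bar> \<le> 2 * real (n k) * C"
proof -
  have "\<bar>v k t i - v k t (i - 1)\<bar> \<le> 2 * C"
    using v_bound[of k t i] v_bound[of k t "i - 1"] by linarith
  then show ?thesis unfolding Dminus_def
    using mult_left_mono[of "\<bar>v k t i - v k t (i - 1)\<bar>" "2 * C" "real (n k)"] by (simp add: abs_mult)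
qed

lemma spacetime_w_measurable[measurable]: "spacetime (n k) (w k) \<in> borel_measurable borel"
  by (rule spacetime_measurable[OF n_pos semidiscrete_flow.continuous_w[OF flow]])

lemma spacetime_v_measurable[measurable]: "spacetime (n k) (v k) \<in> borel_measurable borel"
  by (rule spacetime_measurable[OF n_pos semidiscrete_flow.continuous_flux[OF flow]]) auto

lemma spacetime_rate_measurable[measurable]: "spacetime (n k) (rate k) \<in> borel_measurable borel"
  by (rule spacetime_measurable[OF n_pos semidiscrete_flow.continuous_rate[OF flow]])

lemma dissipation:
  "(\<integral>\<^sup>+t. indicator {0<..} t * ennreal ((\<Sum>i=1..int (n k). (rate k t i)\<^sup>2) / n k) \<partial>lborel) \<le> ennreal (C * M)"
proof -
  have "C * TV (n k) (w k 0) \<le> C * M" by (intro mult_left_mono TV_bound C_nonneg) simp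
  with semidiscrete_flow.energy_dissipation[OF flow C, of k] show ?thesis
    by (auto intro: order_trans ennreal_leI)
qed

lemma rate_L2:
  "(\<integral>\<^sup>+p. ennreal ((spacetime (n k) (rate k) p)\<^sup>2) \<partial>lborel) \<le> ennreal (C * M)"
  using dissipation[of k]
  by (subst nn_integral_spacetime[OF n_pos semidiscrete_flow.continuous_rate[OF flow]])

end

text \<open>The weights \<open>c\<close> make the time derivatives converge to \<open>g\<close>; the same weights are applied to the
    fluxes and to
the solutions.\<close>

locale mixed_sequence = approximating_sequence +
  fixes c :: "nat \<Rightarrow> nat \<Rightarrow> real" and g :: "real \<times> real \<Rightarrow> real"
  assumes c: "\<And>k. c k \<in> tail_weights k"
    and g_measurable[measurable]: "g \<in> borel_measurable borel"
    and g_L2: "integrable lborel (\<lambda>p. (g p)\<^sup>2)"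
    and g_close: "\<And>k. (\<integral>\<^sup>+p. ennreal ((mix (c k) (\<lambda>j. spacetime (n j) (rate j) p) - g p)\<^sup>2) \<partial>lborel)
        \<le> ennreal ((1/4) ^ k)"

lemma (in approximating_sequence) mixed_sequence_exists:
  obtains c g where "mixed_sequence \<phi> n w u M C c g"
proof -
  have sq: "integrable lborel (\<lambda>p. (spacetime (n k) (rate k) p)\<^sup>2)" for k
    using rate_L2[of k] by (intro integrableI_nonneg) (auto intro: le_less_trans)
  have CM: "0 \<le> C * M" using C_nonneg M_nonneg by simp
  obtain c g where "\<And>k. c k \<in> tail_weights k" "g \<in> borel_measurable lborel" "integrable lborel (\<lambda>x. (g x)\<^sup>2)"
    "\<And>k. (\<integral>\<^sup>+p. ennreal ((mix (c k) (\<lambda>j. spacetime (n j) (rate j) p) - g p)\<^sup>2) \<partial>lborel) \<le> ennreal ((1/4)^k)"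
  proof (rule L2_bounded_tail_mixtures[of "\<lambda>j. spacetime (n j) (rate j)" lborel "C * M"])
    show "(LINT p|lborel. (spacetime (n k) (rate k) p)\<^sup>2) \<le> C * M" for k
      using rate_L2[of k] CM unfolding nn_integral_eq_integral[OF sq AE_I2[OF zero_le_power2]]
      by (simp add: ennreal_le_iff)
  qed (use sq in auto)
  then have "mixed_sequence \<phi> n w u M C c g"
    by unfold_locales auto
  then show thesis by (rule that)
qed

context mixed_sequence
begin

text \<open>The times at which the argument can be carried out on the slice. Almost every time is of this kind.\<close>

definition regular_time :: "real \<Rightarrow> bool" where
  "regular_time t \<longleftrightarrow> 0 < t \<and> integrable I01 (\<lambda>x. (g (t, x))\<^sup>2) \<and>
     (\<lambda>k. LINT x|I01. (mix (c k) (\<lambda>j. step (n j) (rate j t) x) - g (t, x))\<^sup>2) \<longlonglongrightarrow> 0 \<and>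
     (\<lambda>k. rate_norm k t * (1/2) ^ k) \<longlonglongrightarrow> 0"

lemma g_slice_measurable: "(\<lambda>x. g (t, x)) \<in> borel_measurable borel"
  using g_measurable unfolding borel_prod[symmetric] by measurable

lemma g_slice_measurable_I01[measurable]: "(\<lambda>x. g (t, x)) \<in> borel_measurable I01"
  by (rule borel_measurable_I01[OF g_slice_measurable])

text \<open>The squared norms \<open>Q k\<close> have uniformly bounded integrals in time. Hence the sum of \<open>Q k t / 2 ^ k\<close>
    is finite
for almost every \<open>t\<close>, so that its terms tend to zero.\<close>

lemma AE_rates_slow:
  "AE t in J0. (\<lambda>k. rate_norm k t * (1/2) ^ k) \<longlonglongrightarrow> 0"
proof -
  define Q where "Q k t = (\<Sum>i=1..int (n k). (rate k t i)\<^sup>2) / n k" for k t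
  have Q: "(LINT x|I01. (step (n k) (rate k t) x)\<^sup>2) = Q k t" for k t
    unfolding step_square integral_step[OF n_pos] Q_def ..
  have Q0: "0 \<le> Q k t" for k t unfolding Q[symmetric] by simp
  define q where "q k t = indicator {0<..} t * ennreal (Q k t)" for k t
  have q_meas: "q k \<in> borel_measurable borel" for k
  proof -
    have "(\<lambda>t. indicator {0..} t *\<^sub>R Q k t) \<in> borel_measurable borel"
      unfolding Q_def using n_pos
      by (intro borel_measurable_continuous_on_indicator continuous_intros
          semidiscrete_flow.continuous_rate[OF flow]) auto
    then have "(\<lambda>t. indicator {0<..} t * ennreal (indicator {0..} t *\<^sub>R Q k t)) \<in> borel_measurable borel"
      by measurable
    then show ?thesis unfolding q_def by (rule measurable_cong[THEN iffD1, rotated])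
        (auto simp: indicator_def)
  qed
  have q_scaled: "(\<lambda>t. ennreal ((1/2) ^ k) * q k t) \<in> borel_measurable lborel" for k
    by (rule borel_measurable_times_ennreal) (simp_all add: q_meas)
  have "AE t in lborel. (\<Sum>k. ennreal ((1/2) ^ k) * q k t) \<noteq> \<infinity>"
  proof (rule suminf_nn_integral_AE[where b = "\<lambda>k. (1/2) ^ k * (C * M)"])
    fix k
    have "(\<integral>\<^sup>+t. ennreal ((1/2) ^ k) * q k t \<partial>lborel)
      = ennreal ((1/2) ^ k) * (\<integral>\<^sup>+t. q k t \<partial>lborel)"
      by (rule nn_integral_cmult) (simp add: q_meas)
    also have "\<dots> \<le> ennreal ((1/2) ^ k) * ennreal (C * M)"
      unfolding q_def Q_def by (rule mult_left_mono[OF dissipation]) simp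
    also have "\<dots> = ennreal ((1/2) ^ k * (C * M))"
      by (rule ennreal_mult[symmetric]) (use C_nonneg M_nonneg in auto)
    finally show "(\<integral>\<^sup>+t. ennreal ((1/2) ^ k) * q k t \<partial>lborel) \<le> ennreal ((1/2) ^ k * (C * M))" .
    show "0 \<le> (1/2) ^ k * (C * M)" using C_nonneg M_nonneg by simp
  qed (rule q_scaled, intro summable_mult2 summable_geometric, simp)
  then show ?thesis unfolding AE_J0_iff
  proof eventually_elim
    case (elim t)
    show ?case
    proof
      assume t: "0 < t"
      then have "(\<Sum>k. ennreal ((1/2) ^ k * Q k t)) \<noteq> top"
        using elim by (simp add: ennreal_mult Q0 q_def)
      then have "summable (\<lambda>k. (1/2) ^ k * Q k t)"
        by (intro summable_suminf_not_top) (simp_all add: Q0)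
      then have "(\<lambda>k. (1/2) ^ k * Q k t) \<longlonglongrightarrow> 0" by (rule summable_LIMSEQ_zero)
      moreover have "(\<lambda>k. (1/2::real) ^ k) \<longlonglongrightarrow> 0" by (rule LIMSEQ_power_zero) simp
      ultimately have "(\<lambda>k. sqrt ((1/2) ^ k * Q k t * (1/2) ^ k)) \<longlonglongrightarrow> sqrt (0 * 0)"
        by (intro tendsto_real_sqrt tendsto_mult)
      moreover have "sqrt ((1/2) ^ k * Q k t * (1/2) ^ k) = sqrt (Q k t) * (1/2) ^ k" for k
      proof -
        have "(1/2) ^ k * Q k t * (1/2) ^ k = Q k t * ((1/2) ^ k)\<^sup>2"
          by (simp add: power2_eq_square)
        then show ?thesis by (simp only: real_sqrt_mult) simp
      qed
      ultimately show "(\<lambda>k. rate_norm k t * (1/2) ^ k) \<longlonglongrightarrow> 0"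
        unfolding Q by simp
    qed
  qed
qed

text \<open>By Tonelli's theorem the squared distances on the slices have integrals that are summable in \<open>k\<close>.\<close>

lemma AE_mixtures_converge:
  "AE t in J0. integrable I01 (\<lambda>x. (g (t, x))\<^sup>2) \<and>
     (\<lambda>k. LINT x|I01. (mix (c k) (\<lambda>j. step (n j) (rate j t) x) - g (t, x))\<^sup>2) \<longlonglongrightarrow> 0"
proof -
  define d where "d k p = mix (c k) (\<lambda>j. spacetime (n j) (rate j) p) - g p" for k p
  have d_meas: "d k \<in> borel_measurable borel" for k unfolding d_def by measurable
  have [measurable]: "d k \<in> borel_measurable (borel \<Otimes>\<^sub>M borel)" for k
    using d_meas by (simp add: borel_prod)
  have "AE t in lborel. (\<Sum>k. \<integral>\<^sup>+x. ennreal ((d k (t, x))\<^sup>2) \<partial>lborel) \<noteq> \<infinity>"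
  proof (rule suminf_nn_integral_AE[where b = "\<lambda>k. (1/4) ^ k"])
    fix k
    show "(\<lambda>t. \<integral>\<^sup>+x. ennreal ((d k (t, x))\<^sup>2) \<partial>lborel) \<in> borel_measurable lborel" by measurable
    have "(\<integral>\<^sup>+t. \<integral>\<^sup>+x. ennreal ((d k (t, x))\<^sup>2) \<partial>lborel \<partial>lborel)
        = (\<integral>\<^sup>+p. ennreal ((d k p)\<^sup>2) \<partial>(lborel \<Otimes>\<^sub>M lborel))"
      by (rule lborel.nn_integral_fst) measurable
    also have "\<dots> \<le> ennreal ((1/4) ^ k)"
      unfolding lborel_prod d_def by (rule g_close)
    finally show "(\<integral>\<^sup>+t. \<integral>\<^sup>+x. ennreal ((d k (t, x))\<^sup>2) \<partial>lborel \<partial>lborel) \<le> ennreal ((1/4) ^ k)" .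
  qed (auto intro!: summable_geometric)
  then show ?thesis unfolding AE_J0_iff
  proof eventually_elim
    case (elim t)
    show ?case
    proof
      assume t: "0 < t"
      define e where "e k x = mix (c k) (\<lambda>j. step (n j) (rate j t) x) - g (t, x)" for k x
      have [measurable]: "e k \<in> borel_measurable I01" for k unfolding e_def by measurable
      have le: "(\<integral>\<^sup>+x. ennreal ((e k x)\<^sup>2) \<partial>I01) \<le> (\<integral>\<^sup>+x. ennreal ((d k (t, x))\<^sup>2) \<partial>lborel)" for k
      proof -
        have "(\<integral>\<^sup>+x. ennreal ((e k x)\<^sup>2) \<partial>I01) = (\<integral>\<^sup>+x. ennreal ((d k (t, x))\<^sup>2) \<partial>I01)"
          by (rule nn_integral_cong) (use t in \<open>auto simp: e_def d_def spacetime_def\<close>)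
        also have "\<dots> = (\<integral>\<^sup>+x. ennreal ((d k (t, x))\<^sup>2) * indicator {0<..<1} x \<partial>lborel)"
          by (rule nn_integral_I01) measurable
        also have "\<dots> \<le> (\<integral>\<^sup>+x. ennreal ((d k (t, x))\<^sup>2) \<partial>lborel)"
          by (rule nn_integral_mono) (auto simp: indicator_def)
        finally show ?thesis .
      qed
      have fin: "(\<Sum>k. \<integral>\<^sup>+x. ennreal ((e k x)\<^sup>2) \<partial>I01) \<noteq> \<infinity>"
      proof -
        have "(\<Sum>k. \<integral>\<^sup>+x. ennreal ((e k x)\<^sup>2) \<partial>I01) \<le> (\<Sum>k. \<integral>\<^sup>+x. ennreal ((d k (t, x))\<^sup>2) \<partial>lborel)"
          by (intro suminf_le le summableI)
        then show ?thesis using elim by (auto simp: top_unique)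
      qed
      have e2: "integrable I01 (\<lambda>x. (e k x)\<^sup>2)" for k
      proof (rule integrableI_nonneg)
        have "(\<integral>\<^sup>+x. ennreal ((e k x)\<^sup>2) \<partial>I01) \<le> (\<Sum>k. \<integral>\<^sup>+x. ennreal ((e k x)\<^sup>2) \<partial>I01)"
          using sum_le_suminf[OF summableI, of "{k}" "\<lambda>k. \<integral>\<^sup>+x. ennreal ((e k x)\<^sup>2) \<partial>I01"] by simp
        then show "(\<integral>\<^sup>+x. ennreal ((e k x)\<^sup>2) \<partial>I01) < \<infinity>"
          using fin by (auto simp: less_top[symmetric] top_unique)
      qed auto
      have "summable (\<lambda>k. LINT x|I01. (e k x)\<^sup>2)"
        by (rule summable_suminf_not_top)
           (use fin in \<open>simp_all add: nn_integral_eq_integral[OF e2]\<close>)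
      then have "(\<lambda>k. LINT x|I01. (e k x)\<^sup>2) \<longlonglongrightarrow> 0" by (rule summable_LIMSEQ_zero)
      moreover have "integrable I01 (\<lambda>x. (g (t, x))\<^sup>2)"
      proof -
        have m2: "integrable I01 (\<lambda>x. (mix (c 0) (\<lambda>j. step (n j) (rate j t) x))\<^sup>2)"
          by (rule mix_square_integrable) (use step_sq in auto)
        have "integrable I01 (\<lambda>x. (mix (c 0) (\<lambda>j. step (n j) (rate j t) x) - e 0 x)\<^sup>2)"
          by (rule square_integrable_diff) (use m2 e2 in auto)
        then show ?thesis by (simp add: e_def)
      qed
      ultimately show "integrable I01 (\<lambda>x. (g (t, x))\<^sup>2) \<and>
        (\<lambda>k. LINT x|I01. (mix (c k) (\<lambda>j. step (n j) (rate j t) x) - g (t, x))\<^sup>2) \<longlonglongrightarrow> 0"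
        by (simp add: e_def)
    qed
  qed
qed

lemma AE_regular_time: "AE t in J0. regular_time t"
  using AE_rates_slow AE_mixtures_converge AE_space
  by eventually_elim (simp add: regular_time_def)

lemma regular_time_flux:
  assumes "regular_time t"
  shows "prim (\<lambda>x. g (t, x)) 1 = 0"
    and "\<lbrakk>0 < x; x < 1\<rbrakk> \<Longrightarrow> (\<lambda>k. mix (c k) (\<lambda>j. step (n j) (v j t) x)) \<longlonglongrightarrow> prim (\<lambda>x. g (t, x)) x"
proof -
  have "(\<lambda>k. rate_norm k t / sqrt (real (n k))) \<longlonglongrightarrow> 0"
  proof (rule Lim_null_comparison)
    show "(\<lambda>k. rate_norm k t * (1/2) ^ k) \<longlonglongrightarrow> 0"
      using assms unfolding regular_time_def by blast
    have "norm (rate_norm k t / sqrt (real (n k)))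
       \<le> rate_norm k t * (1/2) ^ k" for k
    proof -
      have "(2::real) ^ k = sqrt (4 ^ k)" by (simp add: real_sqrt_power)
      also have "\<dots> \<le> sqrt (real (n k))"
        using mesh[of k] by (intro real_sqrt_le_mono) (metis of_nat_le_iff of_nat_numeral of_nat_power)
      finally have "1 / sqrt (real (n k)) \<le> (1/2) ^ k"
        using n_pos[of k] by (simp add: power_one_over frac_le)
      from mult_left_mono[OF this, of "rate_norm k t"]
      show ?thesis by simp
    qed
    then show "eventually (\<lambda>k. norm (rate_norm k t / sqrt (real (n k)))
       \<le> rate_norm k t * (1/2) ^ k) sequentially"
      by (intro always_eventually allI)
  qed
  note lim = flux_limit[of n "\<lambda>k. v k t" c "\<lambda>x. g (t, x)", OF n_pos _ _ this c]
  show "prim (\<lambda>x. g (t, x)) 1 = 0"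
    by (rule lim(1)) (use assms semidiscrete_flow.flux_boundary[OF flow] in \<open>auto simp: regular_time_def\<close>)
  show "(\<lambda>k. mix (c k) (\<lambda>j. step (n j) (v j t) x)) \<longlonglongrightarrow> prim (\<lambda>x. g (t, x)) x" if "0 < x" "x < 1"
    by (rule lim(2)) (use that assms semidiscrete_flow.flux_boundary[OF flow] in \<open>auto simp:
        regular_time_def\<close>)
qed

text \<open>The distance of \<open>w k t\<close> from \<open>u t\<close> is at most \<open>(1/2) ^ k\<close> as soon as \<open>t \<le> k\<close>.\<close>

lemma regular_time_sign:
  assumes t: "regular_time t" and \<rho>: "\<rho> \<in> borel_measurable I01" "\<And>x. \<lbrakk>0 < x; x < 1\<rbrakk> \<Longrightarrow> \<bar>\<rho> x\<bar> \<le> R"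
    "\<And>x. \<lbrakk>0 < x; x < 1\<rbrakk> \<Longrightarrow> 0 \<le> prim \<rho> x"
  shows "(LINT x|I01. u t x * (prim \<rho> x * g (t, x) + \<rho> x * prim (\<lambda>x. g (t, x)) x)) \<le> 0"
proof (rule limit_sign[of n "\<lambda>k. v k t" "\<lambda>k. w k t" "u t" c "\<lambda>x. g (t, x)" \<rho> R])
  have t0: "0 \<le> t" using t by (simp add: regular_time_def)
  show "u t \<in> borel_measurable I01" "integrable I01 (\<lambda>x. (u t x)\<^sup>2)"
    using u_measurable u_square t0 by auto
  show "(\<lambda>k. sqrt (LINT x|I01. (step (n k) (w k t) x - u t x)\<^sup>2) * rate_norm k t) \<longlonglongrightarrow> 0"
  proof (rule Lim_null_comparison)
    show "(\<lambda>k. rate_norm k t * (1/2) ^ k) \<longlonglongrightarrow> 0"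
      using t unfolding regular_time_def by blast
    have "norm (sqrt (LINT x|I01. (step (n k) (w k t) x - u t x)\<^sup>2) * rate_norm k t)
        \<le> rate_norm k t * (1/2) ^ k" if "t \<le> real k" for k
      using mult_right_mono[OF close[OF t0 that, unfolded L2_norm01_def], of "rate_norm k t"]
      by (simp add: abs_mult mult.commute)
    moreover have "eventually (\<lambda>k. t \<le> real k) sequentially"
      using eventually_ge_at_top[of "nat \<lceil>t\<rceil>"] by eventually_elim linarith
    ultimately show "eventually (\<lambda>k. norm (sqrt (LINT x|I01. (step (n k) (w k t) x - u t x)\<^sup>2) * rate_norm
        k t)
        \<le> rate_norm k t * (1/2) ^ k) sequentially"
      by (auto elim: eventually_mono)
  qed
qed (use t \<rho> n_pos c semidiscrete_flow.flux_boundary[OF flow] semidiscrete_flow.flux_sign[OF flow] in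
    \<open>auto simp: regular_time_def\<close>)

definition vmix :: "nat \<Rightarrow> real \<times> real \<Rightarrow> real" where
  "vmix k p = mix (c k) (\<lambda>j. spacetime (n j) (v j) p)"

definition vlim :: "real \<times> real \<Rightarrow> real" where
  "vlim p = lim (\<lambda>k. vmix k p)"

lemma vmix_measurable[measurable]: "vmix k \<in> borel_measurable borel"
  unfolding vmix_def by measurable

lemma vlim_measurable[measurable]: "vlim \<in> borel_measurable borel"
  unfolding vlim_def by measurable

lemma vmix_slice:
  assumes "regular_time t" "0 < x" "x < 1"
  shows "(\<lambda>k. vmix k (t, x)) \<longlonglongrightarrow> prim (\<lambda>x. g (t, x)) x"
  using regular_time_flux(2)[OF assms] assms by (simp add: vmix_def spacetime_def regular_time_def)

lemma vlim_slice:
  assumes "regular_time t" "0 < x" "x < 1"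
  shows "vlim (t, x) = prim (\<lambda>x. g (t, x)) x"
  unfolding vlim_def by (rule limI[OF vmix_slice[OF assms]])

lemma AE_vmix: "AE p in lebesgue_on strip. (\<lambda>k. vmix k p) \<longlonglongrightarrow> vlim p"
proof -
  have "AE p in lebesgue_on strip. convergent (\<lambda>k. vmix k p)"
  proof (rule AE_slices_convergent)
    show "AE t in J0. AE x in I01. convergent (\<lambda>k. vmix k (t, x))"
      using AE_regular_time
    proof eventually_elim
      case (elim t)
      show ?case by (rule AE_I2) (auto intro: convergentI vmix_slice[OF elim])
    qed
  qed measurable
  then show ?thesis by eventually_elim (simp add: vlim_def convergent_LIMSEQ_iff)
qed

lemma vmix_bound: "\<bar>vmix k p\<bar> \<le> C"
  unfolding vmix_def
  by (rule mix_abs_le[OF c]) (use v_bound C_nonneg in \<open>auto simp: spacetime_def step_def\<close>)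

text \<open>The mixed fluxes are bounded and converge almost everywhere, so their weak* limit is the pointwise
    limit;
and mixing does not change the weak* limit \<open>V\<close> of the fluxes themselves.\<close>

lemma weak_limit_eq:
  assumes weak: "weak_star_limit strip (\<lambda>k (t, x). v k t \<lceil>real (n k) * x\<rceil>) V"
  shows "AE p in lebesgue_on strip. V p = vlim p"
proof -
  let ?L = "lebesgue_on strip"
  have V[measurable]: "V \<in> borel_measurable ?L" and "\<exists>B. AE p in ?L. \<bar>V p\<bar> \<le> B"
    using weak unfolding weak_star_limit_def Linfty_def by auto
  then obtain B where B: "AE p in ?L. \<bar>V p\<bar> \<le> B" by blast
  have [measurable]: "vlim \<in> borel_measurable ?L" "\<And>k. vmix k \<in> borel_measurable ?L"
    "\<And>j. spacetime (n j) (v j) \<in> borel_measurable ?L"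
    by (auto intro!: borel_measurable_strip)
  have zero: "(LINT p|?L. V p * \<psi> p) = (LINT p|?L. vlim p * \<psi> p)" if \<psi>: "integrable ?L \<psi>" for \<psi>
  proof -
    have [measurable]: "\<psi> \<in> borel_measurable ?L" using \<psi> by auto
    have int: "integrable ?L (\<lambda>p. spacetime (n j) (v j) p * \<psi> p)" for j
    proof (rule integrable_mult_bounded[OF \<psi>])
      show "\<bar>spacetime (n j) (v j) p\<bar> \<le> C" for p
        using v_bound C_nonneg by (simp add: spacetime_def step_def)
    qed measurable
    have "(\<lambda>k. LINT p|?L. (case p of (t, x) \<Rightarrow> v k t \<lceil>real (n k) * x\<rceil>) * \<psi> p) \<longlonglongrightarrow> (LINT p|?L. V p * \<psi> p)"
      using weak \<psi> unfolding weak_star_limit_def by blast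
    moreover have "(LINT p|?L. (case p of (t, x) \<Rightarrow> v k t \<lceil>real (n k) * x\<rceil>) * \<psi> p)
        = (LINT p|?L. spacetime (n k) (v k) p * \<psi> p)" for k
      by (rule Bochner_Integration.integral_cong) (auto simp: spacetime_def step_def)
    ultimately have "(\<lambda>k. LINT p|?L. spacetime (n k) (v k) p * \<psi> p) \<longlonglongrightarrow> (LINT p|?L. V p * \<psi> p)" by simp
    from mix_tendsto[OF c this]
    have "(\<lambda>k. LINT p|?L. vmix k p * \<psi> p) \<longlonglongrightarrow> (LINT p|?L. V p * \<psi> p)"
      unfolding vmix_def mix_cmult(2)[symmetric] mix_integral(2)[OF int] .
    moreover have "(\<lambda>k. LINT p|?L. vmix k p * \<psi> p) \<longlonglongrightarrow> (LINT p|?L. vlim p * \<psi> p)"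
    proof (rule integral_dominated_convergence[where w = "\<lambda>p. C * \<bar>\<psi> p\<bar>"])
      show "AE p in ?L. (\<lambda>k. vmix k p * \<psi> p) \<longlonglongrightarrow> vlim p * \<psi> p"
        using AE_vmix by eventually_elim (intro tendsto_intros)
      show "AE p in ?L. norm (vmix k p * \<psi> p) \<le> C * \<bar>\<psi> p\<bar>" for k
        by (rule AE_I2) (auto simp: abs_mult intro!: mult_right_mono vmix_bound)
    qed (use \<psi> in auto)
    ultimately show ?thesis by (rule LIMSEQ_unique)
  qed
  have "AE p in ?L. fst p < real m \<longrightarrow> V p = vlim p" for m :: nat
  proof -
    define A where "A = {0<..<real m} \<times> {0<..<1::real}"
    have A_open: "open A" unfolding A_def by (intro open_Times) auto
    have [measurable]: "A \<in> sets ?L"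
      using A_open by (auto simp: sets_restrict_space_iff A_def)
    have A_fin: "emeasure ?L A < \<infinity>"
    proof -
      have "emeasure ?L A = emeasure lborel A"
        using A_open by (subst emeasure_restrict_space) (auto simp: A_def)
      also have "\<dots> \<le> emeasure lborel ({0..real m} \<times> {0..1::real})"
        using A_open by (intro emeasure_mono) (auto simp: A_def intro!: borel_closed closed_Times)
      also have "\<dots> < \<infinity>" by (intro emeasure_compact_finite compact_Times) auto
      finally show ?thesis .
    qed
    have ind: "integrable ?L (indicator A :: _ \<Rightarrow> real)"
      using A_fin by (intro integrable_real_indicator) auto
    \<comment> \<open>Testing the difference against its own sign yields its \<open>L\<^sup>1\<close> norm on a bounded part of the strip.\<close>
    define \<psi> where "\<psi> p = sgn (V p - vlim p) * indicator A p" for p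
    have \<psi>: "integrable ?L \<psi>"
      unfolding \<psi>_def by (rule integrable_mult_bounded[OF ind, of _ 1]) (auto simp: sgn_real_def)
    have lb: "AE p in ?L. \<bar>vlim p\<bar> \<le> C"
      using AE_vmix
    proof eventually_elim
      case (elim p)
      show ?case by (rule LIMSEQ_le_const2[OF tendsto_rabs[OF elim]]) (use vmix_bound in auto)
    qed
    have iV: "integrable ?L (\<lambda>p. V p * \<psi> p)"
    proof (rule Bochner_Integration.integrable_bound[where f = "\<lambda>p. B * \<psi> p"])
      show "AE p in ?L. norm (V p * \<psi> p) \<le> norm (B * \<psi> p)"
        using B by eventually_elim (auto simp: abs_mult intro!: mult_right_mono)
    qed (use \<psi> in auto)
    have il: "integrable ?L (\<lambda>p. vlim p * \<psi> p)"
    proof (rule Bochner_Integration.integrable_bound[where f = "\<lambda>p. C * \<psi> p"])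
      show "AE p in ?L. norm (vlim p * \<psi> p) \<le> norm (C * \<psi> p)"
        using lb by eventually_elim (auto simp: abs_mult intro!: mult_right_mono)
    qed (use \<psi> in auto)
    have eq: "V p * \<psi> p - vlim p * \<psi> p = \<bar>V p - vlim p\<bar> * indicator A p" for p
      unfolding \<psi>_def by (simp add: left_diff_distrib[symmetric] abs_sgn)
    have "(LINT p|?L. V p * \<psi> p - vlim p * \<psi> p) = 0"
      using zero[OF \<psi>] iV il by simp
    moreover have "integrable ?L (\<lambda>p. V p * \<psi> p - vlim p * \<psi> p)" using iV il by simp
    ultimately have "AE p in ?L. \<bar>V p - vlim p\<bar> * indicator A p = 0"
      unfolding eq by (subst (asm) integral_nonneg_eq_0_iff_AE) auto
    then show ?thesis
      using AE_space by eventually_elim (auto simp: A_def indicator_def)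
  qed
  then have "AE p in ?L. \<forall>m::nat. fst p < real m \<longrightarrow> V p = vlim p"
    by (intro AE_all_countable[THEN iffD2] allI)
  then show ?thesis
    by eventually_elim (use reals_Archimedean2 in blast)
qed

end

section \<open>Test functions and weak derivatives\<close>

lemma test_functionD:
  assumes "test_function \<Omega> \<eta>"
  shows "(\<eta> has_derivative frechet_derivative \<eta> (at p)) (at p)"
    and "continuous_on UNIV \<eta>"
    and "b \<in> Basis \<Longrightarrow> continuous_on UNIV (\<lambda>p. frechet_derivative \<eta> (at p) b)"
    and "p \<notin> closure {p. \<eta> p \<noteq> 0} \<Longrightarrow> \<eta> p = 0"
    and "p \<notin> closure {p. \<eta> p \<noteq> 0} \<Longrightarrow> frechet_derivative \<eta> (at p) b = 0"
proof -
  have C: "Ck k \<eta>" for k using assms by (simp add: test_function_def)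
  show der: "(\<eta> has_derivative frechet_derivative \<eta> (at p)) (at p)" for p
    using C[of "Suc 0"] by (simp add: frechet_derivative_works[symmetric])
  show "continuous_on UNIV \<eta>" using C[of 0] by simp
  show "continuous_on UNIV (\<lambda>p. frechet_derivative \<eta> (at p) b)" if "b \<in> Basis"
    using C[of "Suc 0"] that by simp
  show "p \<notin> closure {p. \<eta> p \<noteq> 0} \<Longrightarrow> \<eta> p = 0"
    using closure_subset[of "{p. \<eta> p \<noteq> 0}"] by auto
  assume p: "p \<notin> closure {p. \<eta> p \<noteq> 0}"
  have "((\<lambda>_. 0) has_derivative frechet_derivative \<eta> (at p)) (at p)"
  proof (rule has_derivative_transform_within_open[OF der])
    show "open (- closure {p. \<eta> p \<noteq> 0})" by auto
    show "\<eta> q = 0" if "q \<in> - closure {p. \<eta> p \<noteq> 0}" for q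
      using that closure_subset[of "{p. \<eta> p \<noteq> 0}"] by auto
  qed (use p in auto)
  then have "frechet_derivative \<eta> (at p) = (\<lambda>_. 0)"
    by (rule has_derivative_unique) simp
  then show "frechet_derivative \<eta> (at p) b = 0" by simp
qed

lemma bounded_of_compact_support:
  fixes f :: "'a::euclidean_space \<Rightarrow> real"
  assumes "continuous_on UNIV f" "compact K" "\<And>p. p \<notin> K \<Longrightarrow> f p = 0"
  obtains B where "0 \<le> B" "\<And>p. \<bar>f p\<bar> \<le> B"
proof -
  have "bounded (f ` K)"
    by (intro compact_imp_bounded compact_continuous_image assms(2) continuous_on_subset[OF assms(1)]) simp
  then obtain B where B: "\<And>p. p \<in> K \<Longrightarrow> \<bar>f p\<bar> \<le> B" by (auto simp: bounded_iff)
  have "\<bar>f p\<bar> \<le> max 0 B" for p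
    using B[of p] assms(3)[of p] by (cases "p \<in> K") auto
  then show thesis by (intro that[of "max 0 B"]) auto
qed

lemma test_function_bounds:
  assumes "test_function \<Omega> \<eta>" "b \<in> Basis"
  obtains B where "0 \<le> B" "\<And>p. \<bar>\<eta> p\<bar> \<le> B" "\<And>p. \<bar>frechet_derivative \<eta> (at p) b\<bar> \<le> B"
proof -
  have K: "compact (closure {p. \<eta> p \<noteq> 0})" using assms(1) by (simp add: test_function_def)
  obtain B1 where B1: "0 \<le> B1" "\<And>p. \<bar>\<eta> p\<bar> \<le> B1"
    by (rule bounded_of_compact_support[OF test_functionD(2)[OF assms(1)] K test_functionD(4)[OF
        assms(1)]]) blast+
  obtain B2 where B2: "\<And>p. \<bar>frechet_derivative \<eta> (at p) b\<bar> \<le> B2"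
    by (rule bounded_of_compact_support[OF test_functionD(3)[OF assms] K test_functionD(5)[OF assms(1)]])
        blast+
  show thesis
    by (rule that[of "max B1 B2"]) (use B1 B2 in \<open>auto intro: order_trans[OF _ max.cobounded1]
        order_trans[OF _ max.cobounded2]\<close>)
qed

text \<open>A test function is the primitive of its derivative, which brings it under the integration by parts
formulas for primitives.\<close>

lemma test_function_interval:
  assumes \<eta>: "test_function {0<..<1} \<eta>"
  obtains \<rho> R where "\<And>x. frechet_derivative \<eta> (at x) 1 = \<rho> x" "\<And>x. deriv \<eta> x = \<rho> x"
    "integrable I01 \<rho>" "\<rho> \<in> borel_measurable I01" "\<And>x. \<bar>\<rho> x\<bar> \<le> R"
    "\<And>x. \<lbrakk>0 \<le> x; x \<le> 1\<rbrakk> \<Longrightarrow> prim \<rho> x = \<eta> x" "prim \<rho> 1 = 0"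
proof -
  define \<rho> where "\<rho> x = frechet_derivative \<eta> (at x) 1" for x
  have der: "(\<eta> has_real_derivative \<rho> x) (at x)" for x
  proof -
    have "frechet_derivative \<eta> (at x) s = \<rho> x * s" for s
      using linear_scale[OF has_derivative_linear[OF test_functionD(1)[OF \<eta>, of x]], of s 1]
      by (simp add: \<rho>_def)
    then have "frechet_derivative \<eta> (at x) = (*) (\<rho> x)" by (rule ext)
    then show ?thesis
      using test_functionD(1)[OF \<eta>, of x] by (simp add: has_field_derivative_def)
  qed
  have cont: "continuous_on UNIV \<rho>"
    unfolding \<rho>_def[abs_def] by (rule test_functionD(3)[OF \<eta>]) simp
  obtain R where R: "\<And>x. \<bar>\<rho> x\<bar> \<le> R"
    unfolding \<rho>_def by (rule test_function_bounds[OF \<eta>, of 1]) (simp, blast)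
  have meas: "\<rho> \<in> borel_measurable borel" by (rule borel_measurable_continuous_onI[OF cont])
  have int: "integrable I01 \<rho>"
    by (rule I01_bounded_integrable[OF borel_measurable_I01[OF meas] R])
  have end0: "\<eta> 0 = 0" and end1: "\<eta> 1 = 0"
  proof -
    have "closure {x. \<eta> x \<noteq> 0} \<subseteq> {0<..<1}" using \<eta> by (simp add: test_function_def)
    then have out: "0 \<notin> closure {x. \<eta> x \<noteq> 0}" "1 \<notin> closure {x. \<eta> x \<noteq> 0}" by auto
    show "\<eta> 0 = 0" by (rule test_functionD(4)[OF \<eta> out(1)])
    show "\<eta> 1 = 0" by (rule test_functionD(4)[OF \<eta> out(2)])
  qed
  have prim: "prim \<rho> x = \<eta> x" if x: "0 \<le> x" "x \<le> 1" for x
  proof -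
    have "prim \<rho> x = (LINT y|lborel. indicator {0<..<1} y * (indicator {..x} y * \<rho> y))"
      unfolding prim_def by (rule integral_I01) (use meas in measurable)
    also have "\<dots> = (LINT y|lborel. \<rho> y * indicator {0..x} y)"
      by (rule integral_cong_AE)
         (use meas AE_lborel_singleton[of "0::real"] AE_lborel_singleton[of "1::real"] x in
           \<open>auto simp: indicator_def elim!: eventually_elim2\<close>)
    also have "\<dots> = \<eta> x - \<eta> 0"
      by (rule integral_FTC_Icc_real[OF x(1)]) (use der cont in \<open>auto simp: continuous_on_eq_continuous_at\<close>)
    finally show ?thesis using end0 by simp
  qed
  show thesis
    by (rule that[of \<rho> R])
       (use der R int prim end1 borel_measurable_I01[OF meas] in \<open>auto simp: \<rho>_def[symmetric]
           DERIV_imp_deriv\<close>)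
qed

text \<open>Lebesgue measure is complete. This is needed because the slices of a Lebesgue measurable function of
\<open>(t, x)\<close> are only known to coincide almost everywhere with measurable functions.\<close>

lemma AE_eq_measurable_I01:
  fixes f h :: "real \<Rightarrow> real"
  assumes h: "h \<in> borel_measurable I01" and eq: "AE x in I01. f x = h x"
  shows "f \<in> borel_measurable I01"
proof -
  have 1: "(\<lambda>x. indicator {0<..<1} x *\<^sub>R h x) \<in> borel_measurable lebesgue"
    using h by (subst (asm) borel_measurable_restrict_space_iff) (auto simp: mult.commute)
  have ae: "AE x in lebesgue. indicator {0<..<1} x *\<^sub>R f x = indicator {0<..<1} x *\<^sub>R h x"
    using eq by (subst (asm) AE_restrict_space_iff) (auto simp: indicator_def elim!: eventually_mono)
  have "(\<lambda>x. indicator {0<..<1} x *\<^sub>R f x) \<in> borel_measurable lebesgue"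
  proof (rule measurableI)
    fix A :: "real set" assume "A \<in> sets borel"
    then have "(\<lambda>x. indicator {0<..<1} x *\<^sub>R h x) -` A \<inter> space lebesgue \<in> sets lebesgue"
      using 1 by (rule measurable_sets[rotated])
    then show "(\<lambda>x. indicator {0<..<1} x *\<^sub>R f x) -` A \<inter> space lebesgue \<in> sets lebesgue"
      by (rule completion.in_sets_AE[rotated]) (use ae in \<open>auto elim!: eventually_mono\<close>)
  qed auto
  then show ?thesis
    by (subst borel_measurable_restrict_space_iff) (auto simp: mult.commute)
qed

lemma integrable_I01_compact:
  fixes f :: "real \<Rightarrow> real"
  assumes "integrable I01 f" "compact K" "K \<subseteq> {0<..<1}"
  shows "integrable (lebesgue_on K) f"
proof -
  have K: "K \<in> sets lebesgue" using assms(2) by (simp add: lmeasurable_compact fmeasurableD)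
  have "integrable lebesgue (\<lambda>x. indicator {0<..<1} x *\<^sub>R f x)"
    using assms(1) by (subst (asm) integrable_restrict_space) auto
  then have "integrable lebesgue (\<lambda>x. indicator K x *\<^sub>R (indicator {0<..<1} x *\<^sub>R f x))"
    by (rule integrable_mult_indicator[OF K])
  moreover have "(\<lambda>x. indicator K x *\<^sub>R (indicator {0<..<1} x *\<^sub>R f x)) = (\<lambda>x. indicator K x *\<^sub>R f x)"
    using assms(3) by (auto simp: indicator_def fun_eq_iff)
  ultimately have "integrable lebesgue (\<lambda>x. indicator K x *\<^sub>R f x)" by (simp only:)
  then show ?thesis using K by (subst integrable_restrict_space) auto
qed

text \<open>Integration by parts without boundary terms: \<open>\<eta>\<close> and \<open>prim g\<close> both vanish at the ends.\<close>

lemma weak_deriv_prim: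
  assumes g: "integrable I01 g" "prim g 1 = 0" and f: "AE x in I01. f x = prim g x"
  shows "weak_deriv {0<..<1} 1 f g" and "integrable I01 f"
proof -
  have pm: "prim g \<in> borel_measurable I01" by (rule borel_measurable_I01[OF prim_measurable[OF g(1)]])
  have fm: "f \<in> borel_measurable I01" by (rule AE_eq_measurable_I01[OF pm f])
  have "integrable I01 (prim g)" by (rule I01_bounded_integrable[OF pm prim_bound[OF g(1)]])
  then show fi: "integrable I01 f" using f fm pm by (subst integrable_cong_AE) auto
  have "(LINT x|I01. f x * frechet_derivative \<eta> (at x) 1) = - (LINT x|I01. g x * \<eta> x)"
    if \<eta>: "test_function {0<..<1} \<eta>" for \<eta>
  proof -
    obtain \<rho> R where \<rho>: "\<And>x. frechet_derivative \<eta> (at x) 1 = \<rho> x" "integrable I01 \<rho>"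
      "\<rho> \<in> borel_measurable I01" "\<And>x. \<lbrakk>0 \<le> x; x \<le> 1\<rbrakk> \<Longrightarrow> prim \<rho> x = \<eta> x" "prim \<rho> 1 = 0"
      using test_function_interval[OF \<eta>] by metis
    have int: "integrable I01 (\<lambda>x. prim \<rho> x * g x)" "integrable I01 (\<lambda>x. prim g x * \<rho> x)"
      by (rule integrable_prim_mult; use \<rho> g in auto)+
    have "(LINT x|I01. f x * frechet_derivative \<eta> (at x) 1) = (LINT x|I01. prim g x * \<rho> x)"
      by (rule integral_cong_AE) (use fm pm \<rho> f in \<open>auto elim!: eventually_mono\<close>)
    moreover have "(LINT x|I01. g x * \<eta> x) = (LINT x|I01. prim \<rho> x * g x)"
      by (rule Bochner_Integration.integral_cong) (auto simp: \<rho>(4))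
    moreover have "(LINT x|I01. prim \<rho> x * g x) + (LINT x|I01. prim g x * \<rho> x)
      = prim (\<lambda>x. prim \<rho> x * g x + \<rho> x * prim g x) 1"
      using int by (simp add: prim_1 mult.commute)
    moreover have "\<dots> = 0" using prim_product(2)[OF \<rho>(2) g(1), of 1] g(2) by simp
    ultimately show ?thesis by simp
  qed
  then show "weak_deriv {0<..<1} 1 f g"
    unfolding weak_deriv_def L1_loc_def using integrable_I01_compact fi g(1) by auto
qed

lemma integrable_strip_subset:
  fixes f :: "real \<times> real \<Rightarrow> real"
  assumes A: "A \<in> sets lebesgue" "emeasure lebesgue A < \<infinity>" and f: "f \<in> borel_measurable borel"
    and f2: "integrable lborel (\<lambda>p. (f p)\<^sup>2)"
  shows "integrable (lebesgue_on A) f"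
proof -
  have f': "f \<in> borel_measurable (lebesgue_on A)"
    by (intro measurable_restrict_space1 measurable_completion) (use f in simp)
  interpret finite_measure "lebesgue_on A"
    by (rule finite_measureI) (use A in \<open>simp add: emeasure_restrict_space\<close>)
  have "integrable lebesgue (\<lambda>p. (f p)\<^sup>2)"
    using f2 f by (subst integrable_completion) auto
  from integrable_mult_indicator[OF A(1) this]
  have "integrable (lebesgue_on A) (\<lambda>p. (f p)\<^sup>2)"
    using A by (subst integrable_restrict_space) auto
  from Cauchy_Schwarz_integral(1)[OF f' _ this, of "\<lambda>_. 1"]
  show ?thesis by simp
qed

context mixed_sequence
begin

lemma w_bound_spacetime: "\<bar>spacetime (n k) (w k) p\<bar> \<le> M"
  using w_bound ceiling_in_range[OF _ _ n_pos[of k], of "snd p"] M_nonneg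
  by (auto simp: spacetime_def step_def)

text \<open>For fixed \<open>x\<close> the integrand is the time derivative of \<open>w k t i * \<eta> (t, x)\<close>, a function that vanishes
    near
\<open>t = 0\<close> and for large \<open>t\<close>.\<close>

lemma semidiscrete_weak_time_derivative:
  assumes \<eta>: "test_function strip \<eta>"
  shows "integrable lborel (\<lambda>p. spacetime (n k) (w k) p * frechet_derivative \<eta> (at p) (1, 0))"
    and "integrable lborel (\<lambda>p. spacetime (n k) (rate k) p * \<eta> p)"
    and "(LINT p|lborel. spacetime (n k) (w k) p * frechet_derivative \<eta> (at p) (1, 0))
      = - (LINT p|lborel. spacetime (n k) (rate k) p * \<eta> p)"
proof -
  define \<theta> where "\<theta> p = frechet_derivative \<eta> (at p) (1, 0)" for p
  have Basis: "(1, 0) \<in> (Basis :: (real \<times> real) set)" by (simp add: Basis_prod_def)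
  obtain B where B: "0 \<le> B" "\<And>p. \<bar>\<eta> p\<bar> \<le> B" "\<And>p. \<bar>\<theta> p\<bar> \<le> B"
    unfolding \<theta>_def by (rule test_function_bounds[OF \<eta> Basis]) blast
  have cont: "continuous_on UNIV \<eta>" "continuous_on UNIV \<theta>"
    unfolding \<theta>_def using test_functionD(2,3)[OF \<eta>] Basis by auto
  have [measurable]: "\<eta> \<in> borel_measurable borel" "\<theta> \<in> borel_measurable borel"
    by (intro borel_measurable_continuous_onI cont)+
  let ?K = "closure {p. \<eta> p \<noteq> 0}"
  have K: "compact ?K" "?K \<subseteq> strip" using \<eta> by (auto simp: test_function_def)
  obtain T where T: "\<And>p. p \<in> ?K \<Longrightarrow> norm p \<le> T" using compact_imp_bounded[OF K(1)] by (auto simp: bounded_iff)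
  \<comment> \<open>The support of \<open>\<eta>\<close> lies in the open time interval from \<open>0\<close> to \<open>L\<close>.\<close>
  define L where "L = max T 0 + 1"
  have K_L: "fst p < L" if "p \<in> ?K" for p
    using T[OF that] norm_fst_le[of "fst p" "snd p"] unfolding L_def by auto
  have vanish: "\<eta> p = 0" "\<theta> p = 0" if "p \<notin> ?K" for p
    using test_functionD(4,5)[OF \<eta> that] by (auto simp: \<theta>_def)
  have L: "0 < L" unfolding L_def by simp
  define A where "A = {0..L} \<times> {0..1::real}"
  have K_A: "?K \<subseteq> A"
  proof
    fix p assume p: "p \<in> ?K"
    then have "p \<in> strip" using K(2) by blast
    then show "p \<in> A" using K_L[OF p] by (simp add: A_def mem_Times_iff)
  qed
  have "compact A" unfolding A_def by (intro compact_Times) auto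
  then have A: "A \<in> sets borel" "emeasure lborel A < \<infinity>"
    by (rule borel_compact, rule emeasure_compact_finite)
  have bounded_int: "integrable lborel (\<lambda>p. f p * h p)"
    if [measurable]: "f \<in> borel_measurable borel" "h \<in> borel_measurable borel"
      and b: "\<And>p. \<bar>f p\<bar> \<le> Bf" "\<And>p. \<bar>h p\<bar> \<le> B" and z: "\<And>p. p \<notin> ?K \<Longrightarrow> h p = 0"
    for f h :: "real \<times> real \<Rightarrow> real" and Bf
  proof (rule Bochner_Integration.integrable_bound[where f = "\<lambda>p. (Bf * B) * indicator A p"])
    show "AE p in lborel. norm (f p * h p) \<le> norm ((Bf * B) * indicator A p)"
    proof (rule AE_I2)
      fix p
      have "0 \<le> Bf" using b(1)[of p] by auto
      show "norm (f p * h p) \<le> norm ((Bf * B) * indicator A p)"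
      proof (cases "p \<in> ?K")
        case True
        then have "p \<in> A" using K_A by auto
        then show ?thesis
          using mult_mono[OF b(1)[of p] b(2)[of p]] \<open>0 \<le> Bf\<close> B(1) by (simp add: abs_mult)
      qed (simp add: z)
    qed
  qed (use A in auto)
  have int_w: "integrable lborel (\<lambda>p. spacetime (n k) (w k) p * \<theta> p)"
  proof (rule bounded_int[where Bf = M])
    show "\<bar>spacetime (n k) (w k) p\<bar> \<le> M" for p by (rule w_bound_spacetime)
  qed (measurable, rule B(3), rule vanish(2))
  then show "integrable lborel (\<lambda>p. spacetime (n k) (w k) p * frechet_derivative \<eta> (at p) (1, 0))"
    unfolding \<theta>_def .
  show int_r: "integrable lborel (\<lambda>p. spacetime (n k) (rate k) p * \<eta> p)"
  proof (rule bounded_int[where Bf = "2 * real (n k) * C"])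
    fix p show "\<bar>spacetime (n k) (rate k) p\<bar> \<le> 2 * real (n k) * C"
      using rate_bound C_nonneg by (auto simp: spacetime_def step_def)
  qed (measurable, rule B(2), rule vanish(1))
  define \<Phi> where "\<Phi> p = spacetime (n k) (w k) p * \<theta> p + spacetime (n k) (rate k) p * \<eta> p" for p
  have \<Phi>: "integrable lborel \<Phi>" unfolding \<Phi>_def using int_w int_r by auto
  have slice: "(LINT t|lborel. \<Phi> (t, x)) = 0" for x
  proof (cases "0 < x \<and> x < 1")
    case False
    then have "\<Phi> (t, x) = 0" for t by (auto simp: \<Phi>_def spacetime_def)
    then show ?thesis by simp
  next
    case True
    define i where "i = \<lceil>real (n k) * x\<rceil>"
    have i: "i \<in> {1..int (n k)}" unfolding i_def by (rule ceiling_in_range) (use True n_pos in auto)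
    have out: "\<eta> (t, x) = 0" "\<theta> (t, x) = 0" if "t \<le> 0 \<or> L \<le> t" for t
    proof -
      have "(t, x) \<notin> ?K"
      proof
        assume tx: "(t, x) \<in> ?K"
        then have "(t, x) \<in> strip" using K(2) by blast
        then show False using K_L[OF tx] that by simp
      qed
      then show "\<eta> (t, x) = 0" "\<theta> (t, x) = 0" by (rule vanish(1), rule vanish(2))
    qed
    define F where "F t = w k t i * \<theta> (t, x) + rate k t i * \<eta> (t, x)" for t
    have "(LINT t|lborel. \<Phi> (t, x)) = (LINT t|lborel. indicator {0..L} t *\<^sub>R F t)"
    proof (rule Bochner_Integration.integral_cong[OF refl])
      fix t
      show "\<Phi> (t, x) = indicator {0..L} t *\<^sub>R F t"
      proof (cases "0 < t \<and> t < L")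
        case True
        with \<open>0 < x \<and> x < 1\<close> show ?thesis
          by (simp add: \<Phi>_def F_def spacetime_def step_def i_def)
      next
        case False
        then have "t \<le> 0 \<or> L \<le> t" by auto
        from out[OF this] show ?thesis by (simp add: \<Phi>_def F_def)
      qed
    qed
    also have "\<dots> = integral {0..L} F"
    proof -
      have "continuous_on {0..L} F"
        unfolding F_def
        by (intro continuous_intros continuous_on_subset[OF semidiscrete_flow.continuous_w[OF flow i]]
            continuous_on_subset[OF semidiscrete_flow.continuous_rate[OF flow i]]
            continuous_on_compose2[OF cont(1)] continuous_on_compose2[OF cont(2)]) auto
      from set_borel_integral_eq_integral(2)[OF borel_integrable_atLeastAtMost'[OF this]]
      show ?thesis by (simp add: set_lebesgue_integral_def)
    qed
    also have "(F has_integral w k L i * \<eta> (L, x) - w k 0 i * \<eta> (0, x)) {0..L}"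
    proof (rule fundamental_theorem_of_calculus)
      fix t assume t: "t \<in> {0..L}"
      have "((\<lambda>t. \<eta> (t, x)) has_derivative (\<lambda>s. frechet_derivative \<eta> (at (t, x)) (s, 0))) (at t)"
        by (rule has_derivative_compose[of "\<lambda>t. (t, x)" "\<lambda>s. (s, 0)", OF _ test_functionD(1)[OF \<eta>]])
           (auto intro!: derivative_eq_intros)
      moreover have "frechet_derivative \<eta> (at (t, x)) (s, 0) = \<theta> (t, x) * s" for s
        using linear_scale[OF has_derivative_linear[OF test_functionD(1)[OF \<eta>, of "(t, x)"]], of s "(1, 0)"]
        by (simp add: \<theta>_def mult.commute)
      ultimately have "((\<lambda>t. \<eta> (t, x)) has_real_derivative \<theta> (t, x)) (at t)"
        by (simp add: has_field_derivative_def)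
      then have "((\<lambda>t. \<eta> (t, x)) has_real_derivative \<theta> (t, x)) (at t within {0..})"
        by (rule DERIV_subset) auto
      moreover have "((\<lambda>t. w k t i) has_real_derivative rate k t i) (at t within {0..})"
        using semidiscrete_flow.ode[OF flow _ i] t by auto
      ultimately have "((\<lambda>t. w k t i * \<eta> (t, x)) has_real_derivative F t) (at t within {0..})"
        unfolding F_def by (auto intro!: derivative_eq_intros)
      then show "((\<lambda>t. w k t i * \<eta> (t, x)) has_vector_derivative F t) (at t within {0..L})"
        unfolding has_real_derivative_iff_has_vector_derivative
        by (rule has_vector_derivative_within_subset) auto
    qed (use L in simp)
    then have "integral {0..L} F = 0" using out[of 0] out[of L] by (simp add: integral_unique)
    finally show ?thesis .
  qed
  have "(LINT p|lborel. \<Phi> p) = (LINT x|lborel. LINT t|lborel. \<Phi> (t, x))"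
    using lborel_pair.integral_snd[of "\<lambda>t x. \<Phi> (t, x)"] \<Phi> by (simp add: lborel_prod)
  also have "\<dots> = 0" by (simp add: slice)
  finally have "(LINT p|lborel. spacetime (n k) (w k) p * \<theta> p)
      + (LINT p|lborel. spacetime (n k) (rate k) p * \<eta> p) = 0"
    unfolding \<Phi>_def using int_w int_r by simp
  then show "(LINT p|lborel. spacetime (n k) (w k) p * frechet_derivative \<eta> (at p) (1, 0))
      = - (LINT p|lborel. spacetime (n k) (rate k) p * \<eta> p)"
    unfolding \<theta>_def by simp
qed

text \<open>On the left the uniform bound allows dominated convergence. On the right the rates need not
    converge, but
the left hand side shows that their integrals against \<open>\<eta>\<close> do; the mixed integrals have the same limit and
also converge to the integral of \<open>g\<close>.\<close>

lemma weak_time_derivative: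
  assumes \<eta>: "test_function strip \<eta>" and U: "U \<in> borel_measurable (lebesgue_on strip)"
    and lim: "AE p in lebesgue_on strip. (\<lambda>k. spacetime (n k) (w k) p) \<longlonglongrightarrow> U p"
  shows "(LINT p|lebesgue_on strip. U p * frechet_derivative \<eta> (at p) (1, 0))
    = - (LINT p|lebesgue_on strip. g p * \<eta> p)"
proof -
  let ?L = "lebesgue_on strip"
  let ?\<theta> = "\<lambda>p. frechet_derivative \<eta> (at p) (1, 0)"
  note sd = semidiscrete_weak_time_derivative[OF \<eta>]
  have Basis: "(1, 0) \<in> (Basis :: (real \<times> real) set)" by (simp add: Basis_prod_def)
  have meas[measurable]: "\<eta> \<in> borel_measurable borel" "?\<theta> \<in> borel_measurable borel"
    by (intro borel_measurable_continuous_onI test_functionD(2,3)[OF \<eta>] Basis)+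
  have K: "compact (closure {p. \<eta> p \<noteq> 0})" "closure {p. \<eta> p \<noteq> 0} \<subseteq> strip"
    using \<eta> by (auto simp: test_function_def)
  obtain B where B: "0 \<le> B" "\<And>p. \<bar>\<eta> p\<bar> \<le> B" "\<And>p. \<bar>?\<theta> p\<bar> \<le> B"
    by (rule test_function_bounds[OF \<eta> Basis]) blast
  have cpt_int: "integrable lborel h"
    if "h \<in> borel_measurable borel" "\<And>p. \<bar>h p\<bar> \<le> b" "\<And>p. p \<notin> closure {p. \<eta> p \<noteq> 0} \<Longrightarrow> h p = 0"
    for h :: "real \<times> real \<Rightarrow> real" and b
  proof (rule Bochner_Integration.integrable_bound[where f = "\<lambda>p. b * indicator (closure {p. \<eta> p \<noteq> 0}) p"])
    show "integrable lborel (\<lambda>p. b * indicator (closure {p. \<eta> p \<noteq> 0}) p)"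
      using emeasure_compact_finite[OF K(1)] K(1) by auto
    show "AE p in lborel. norm (h p) \<le> norm (b * indicator (closure {p. \<eta> p \<noteq> 0}) p)"
    proof (rule AE_I2)
      fix p
      show "norm (h p) \<le> norm (b * indicator (closure {p. \<eta> p \<noteq> 0}) p)"
        using that(2)[of p] that(3)[of p] by (cases "p \<in> closure {p. \<eta> p \<noteq> 0}") simp_all
    qed
  qed (use that in auto)
  have on_strip: "(LINT p|?L. f p) = (LINT p|lborel. f p)"
    if "f \<in> borel_measurable borel" "\<And>p. p \<notin> strip \<Longrightarrow> f p = 0" for f :: "real \<times> real \<Rightarrow> real"
    unfolding integral_strip[OF that(1)]
    by (rule Bochner_Integration.integral_cong) (use that(2) in \<open>auto simp: indicator_def\<close>)
  have off: "\<eta> p = 0" "?\<theta> p = 0" if "p \<notin> strip" for p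
    using test_functionD(4,5)[OF \<eta>, of p] K(2) that by auto
  have \<theta>1: "integrable ?L (\<lambda>p. M * \<bar>?\<theta> p\<bar>)"
  proof (subst integrable_strip)
    show "integrable lborel (\<lambda>p. indicator strip p * (M * \<bar>?\<theta> p\<bar>))"
    proof (rule cpt_int[where b = "M * B"])
      show "\<bar>indicator strip p * (M * \<bar>?\<theta> p\<bar>)\<bar> \<le> M * B" for p
        using B(1) M_nonneg mult_left_mono[OF B(3)[of p] M_nonneg] by (auto simp: abs_mult indicator_def)
      show "indicator strip p * (M * \<bar>?\<theta> p\<bar>) = 0" if "p \<notin> closure {p. \<eta> p \<noteq> 0}" for p
        using test_functionD(5)[OF \<eta> that] by simp
    qed measurable
  qed measurable
  have [measurable]: "?\<theta> \<in> borel_measurable ?L" "\<And>k. spacetime (n k) (w k) \<in> borel_measurable ?L"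
    using borel_measurable_strip[OF meas(2)] borel_measurable_strip[OF spacetime_w_measurable] by auto
  note [measurable] = U
  have "(\<lambda>k. LINT p|?L. spacetime (n k) (w k) p * ?\<theta> p) \<longlonglongrightarrow> (LINT p|?L. U p * ?\<theta> p)"
  proof (rule integral_dominated_convergence[where w = "\<lambda>p. M * \<bar>?\<theta> p\<bar>"])
    show "AE p in ?L. (\<lambda>k. spacetime (n k) (w k) p * ?\<theta> p) \<longlonglongrightarrow> U p * ?\<theta> p"
      using lim by eventually_elim (intro tendsto_intros)
    show "AE p in ?L. norm (spacetime (n k) (w k) p * ?\<theta> p) \<le> M * \<bar>?\<theta> p\<bar>" for k
      by (rule AE_I2) (auto simp: abs_mult intro!: mult_right_mono w_bound_spacetime)
  qed (use \<theta>1 in auto)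
  moreover have "(LINT p|?L. spacetime (n k) (w k) p * ?\<theta> p)
      = - (LINT p|lborel. spacetime (n k) (rate k) p * \<eta> p)" for k
    by (subst on_strip) (auto simp: off sd(3))
  ultimately have "(\<lambda>k. - (LINT p|lborel. spacetime (n k) (rate k) p * \<eta> p)) \<longlonglongrightarrow> (LINT p|?L. U p * ?\<theta> p)"
      by simp
  from mix_tendsto[OF c tendsto_minus[OF this]]
  have lhs: "(\<lambda>k. LINT p|lborel. mix (c k) (\<lambda>j. spacetime (n j) (rate j) p) * \<eta> p)
      \<longlonglongrightarrow> - (LINT p|?L. U p * ?\<theta> p)"
    unfolding mix_cmult(2)[symmetric] mix_integral(2)[OF sd(2)] by simp
  have \<eta>2: "integrable lborel (\<lambda>p. (\<eta> p)\<^sup>2)"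
  proof (rule cpt_int[where b = "B\<^sup>2"])
    show "\<bar>(\<eta> p)\<^sup>2\<bar> \<le> B\<^sup>2" for p using power_mono[OF B(2)[of p], of 2] by simp
    show "(\<eta> p)\<^sup>2 = 0" if "p \<notin> closure {p. \<eta> p \<noteq> 0}" for p
      using test_functionD(4)[OF \<eta> that] by simp
  qed measurable
  have rate2: "integrable lborel (\<lambda>p. (spacetime (n k) (rate k) p)\<^sup>2)" for k
    using rate_L2[of k] by (intro integrableI_nonneg) (auto intro: le_less_trans)
  define h where "h k p = mix (c k) (\<lambda>j. spacetime (n j) (rate j) p)" for k p
  have [measurable]: "h k \<in> borel_measurable borel" for k unfolding h_def by measurable
  have h2: "integrable lborel (\<lambda>p. (h k p)\<^sup>2)" for k
    unfolding h_def by (rule mix_square_integrable) (use rate2 in auto)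
  have hg2: "integrable lborel (\<lambda>p. (h k p - g p)\<^sup>2)" for k
    by (rule square_integrable_diff) (use h2 g_L2 in auto)
  have rhs: "(\<lambda>k. LINT p|lborel. h k p * \<eta> p) \<longlonglongrightarrow> (LINT p|lborel. g p * \<eta> p)"
  proof (rule LIM_zero_cancel, rule Lim_null_comparison)
    show "(\<lambda>k. (1/2) ^ k * sqrt (LINT p|lborel. (\<eta> p)\<^sup>2)) \<longlonglongrightarrow> 0"
      by (intro tendsto_mult_left_zero LIMSEQ_power_zero) simp
    have "norm ((LINT p|lborel. h k p * \<eta> p) - (LINT p|lborel. g p * \<eta> p))
        \<le> (1/2) ^ k * sqrt (LINT p|lborel. (\<eta> p)\<^sup>2)" for k
    proof -
      have "(LINT p|lborel. h k p * \<eta> p) - (LINT p|lborel. g p * \<eta> p) = (LINT p|lborel. (h k p - g p) * \<eta> p)"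
        unfolding left_diff_distrib
        by (rule Bochner_Integration.integral_diff[symmetric])
            (rule Cauchy_Schwarz_integral(1); use h2 g_L2 \<eta>2 in auto)+
      moreover have "\<bar>LINT p|lborel. (h k p - g p) * \<eta> p\<bar>
          \<le> sqrt (LINT p|lborel. (h k p - g p)\<^sup>2) * sqrt (LINT p|lborel. (\<eta> p)\<^sup>2)"
        by (rule Cauchy_Schwarz_integral(2)) (use hg2 \<eta>2 in auto)
      moreover have "sqrt (LINT p|lborel. (h k p - g p)\<^sup>2) \<le> (1/2) ^ k"
      proof -
        have "(LINT p|lborel. (h k p - g p)\<^sup>2) \<le> (1/4) ^ k"
          using g_close[of k] unfolding h_def[symmetric] nn_integral_eq_integral[OF hg2 AE_I2[OF
              zero_le_power2]]
          by (simp add: ennreal_le_iff)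
        also have "(1/4::real) ^ k = ((1/2) ^ k)\<^sup>2" by (simp add: power2_eq_square flip: power_mult_distrib)
        finally show ?thesis by (intro real_le_lsqrt) auto
      qed
      ultimately show ?thesis
        using mult_right_mono[of "sqrt (LINT p|lborel. (h k p - g p)\<^sup>2)" "(1/2) ^ k" "sqrt (LINT p|lborel.
            (\<eta> p)\<^sup>2)"] by auto
    qed
    then show "eventually (\<lambda>k. norm ((LINT p|lborel. h k p * \<eta> p) - (LINT p|lborel. g p * \<eta> p))
        \<le> (1/2) ^ k * sqrt (LINT p|lborel. (\<eta> p)\<^sup>2)) sequentially"
      by (intro always_eventually allI)
  qed
  have "(LINT p|lborel. g p * \<eta> p) = - (LINT p|?L. U p * ?\<theta> p)"
    using LIMSEQ_unique[OF rhs lhs[folded h_def]] .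
  moreover have "(LINT p|?L. g p * \<eta> p) = (LINT p|lborel. g p * \<eta> p)"
    by (rule on_strip) (auto simp: off)
  ultimately show ?thesis by simp
qed

end

section \<open>The limit pair is an evolution\<close>

lemma L2_norm01_triangle:
  assumes [measurable]: "f \<in> borel_measurable I01" "g \<in> borel_measurable I01"
    and f: "integrable I01 (\<lambda>x. (f x)\<^sup>2)" and g: "integrable I01 (\<lambda>x. (g x)\<^sup>2)"
  shows "L2_norm01 (\<lambda>x. f x + g x) \<le> L2_norm01 f + L2_norm01 g"
proof -
  let ?A = "LINT x|I01. (f x)\<^sup>2" and ?C = "LINT x|I01. (g x)\<^sup>2"
  have fg: "integrable I01 (\<lambda>x. f x * g x)" by (rule Cauchy_Schwarz_integral(1)) (use f g in auto)
  have "(LINT x|I01. (f x + g x)\<^sup>2) = (LINT x|I01. (f x)\<^sup>2 + (g x)\<^sup>2 + 2 * (f x * g x))"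
    by (simp add: power2_sum mult.assoc)
  also have "\<dots> = ?A + ?C + 2 * (LINT x|I01. f x * g x)"
    using f g fg by simp
  also have "\<dots> \<le> ?A + ?C + 2 * (sqrt ?A * sqrt ?C)"
    using Cauchy_Schwarz_integral(2)[OF _ _ f g] by simp
  also have "\<dots> = (sqrt ?A + sqrt ?C)\<^sup>2" by (simp add: power2_sum)
  finally show ?thesis unfolding L2_norm01_def by (intro real_le_lsqrt) auto
qed

lemma L2_norm01_minus_commute: "L2_norm01 (\<lambda>x. f x - g x) = L2_norm01 (\<lambda>x. g x - f x)"
  unfolding L2_norm01_def by (simp add: power2_commute)

text \<open>The suprema in the definition of a generalized solution say something about a single time only
    if the set
is bounded above; otherwise the supremum of a set of reals carries no information. The distance is bounded
because it is continuous in \<open>t\<close> on a compact interval.\<close>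

lemma (in semidiscrete_flow) deviation_bounded:
  assumes u: "C0_L2 u"
  shows "bdd_above ((\<lambda>t. L2_norm01 (\<lambda>x. step n (w t) x - u t x)) ` {0..T})"
proof -
  define G where "G t = L2_norm01 (\<lambda>x. step n (w t) x - u t x)" for t
  have um[measurable]: "u t \<in> borel_measurable I01" and u2: "integrable I01 (\<lambda>x. (u t x)\<^sup>2)" if "0 \<le> t" for t
    using u that by (auto simp: C0_L2_def in_L2_01_def)
  have s2: "integrable I01 (\<lambda>x. (step n a x)\<^sup>2)" for a
    unfolding step_square by (rule step_integrable[OF n_pos])
  define E where "E s t = L2_norm01 (step n (\<lambda>i. w s i - w t i)) + L2_norm01 (\<lambda>x. u s x - u t x)" for s t
  have one: "G s \<le> G t + E s t" if st: "0 \<le> s" "0 \<le> t" for s t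
  proof -
    note [measurable] = um[OF st(1)] um[OF st(2)]
    have d1: "integrable I01 (\<lambda>x. (step n (w t) x - u t x)\<^sup>2)" and d2: "integrable I01 (\<lambda>x. (u t x - u s
        x)\<^sup>2)"
      by (rule square_integrable_diff; use u2 st s2 in auto)+
    have d3: "integrable I01 (\<lambda>x. (step n (\<lambda>i. w s i - w t i) x + (u t x - u s x))\<^sup>2)"
      by (rule square_integrable_add) (use d2 s2 in auto)
    have "G s = L2_norm01 (\<lambda>x. (step n (w t) x - u t x) + (step n (\<lambda>i. w s i - w t i) x + (u t x - u s x)))"
      unfolding G_def by (simp add: step_def algebra_simps)
    also have "\<dots> \<le> G t + L2_norm01 (\<lambda>x. step n (\<lambda>i. w s i - w t i) x + (u t x - u s x))"
      unfolding G_def by (rule L2_norm01_triangle) (use d1 d3 in auto)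
    also have "L2_norm01 (\<lambda>x. step n (\<lambda>i. w s i - w t i) x + (u t x - u s x))
        \<le> L2_norm01 (step n (\<lambda>i. w s i - w t i)) + L2_norm01 (\<lambda>x. u t x - u s x)"
      by (rule L2_norm01_triangle) (use d2 s2 in auto)
    also have "L2_norm01 (\<lambda>x. u t x - u s x) = L2_norm01 (\<lambda>x. u s x - u t x)"
      by (rule L2_norm01_minus_commute)
    finally show ?thesis by (simp add: E_def)
  qed
  have E_sym: "E s t = E t s" for s t
  proof -
    have "L2_norm01 (step n (\<lambda>i. w s i - w t i)) = L2_norm01 (step n (\<lambda>i. w t i - w s i))"
      using L2_norm01_minus_commute[of "step n (w s)" "step n (w t)"] by (simp add: step_def[abs_def])
    then show ?thesis unfolding E_def using L2_norm01_minus_commute[of "u s" "u t"] by simp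
  qed
  have E_lim: "((\<lambda>s. E s t) \<longlongrightarrow> 0) (at t within {0..})" if t: "0 \<le> t" for t
  proof -
    have "((\<lambda>s. sqrt ((\<Sum>i=1..int n. (w s i - w t i)\<^sup>2) / real n)) \<longlongrightarrow> sqrt ((\<Sum>i=1..int n. (w t i - w t i)\<^sup>2)
        / real n)) (at t within {0..})"
      using continuous_w t n_pos by (intro tendsto_intros) (auto simp: continuous_on)
    moreover have "L2_norm01 (step n (\<lambda>i. w s i - w t i))
        = sqrt ((\<Sum>i=1..int n. (w s i - w t i)\<^sup>2) / real n)" for s
      unfolding L2_norm01_def step_square integral_step[OF n_pos] ..
    moreover have "((\<lambda>s. L2_norm01 (\<lambda>x. u s x - u t x)) \<longlongrightarrow> 0) (at t within {0..})"
      using u t by (simp add: C0_L2_def)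
    ultimately show ?thesis unfolding E_def by (auto intro: tendsto_add_zero)
  qed
  have "continuous_on {0..} G"
    unfolding continuous_on
  proof (rule ballI, rule LIM_zero_cancel)
    fix t :: real assume t: "t \<in> {0..}"
    have "eventually (\<lambda>s. norm (G s - G t) \<le> E s t) (at t within {0..})"
      unfolding eventually_at_filter
    proof (intro always_eventually allI impI)
      fix s :: real assume "s \<in> {0..}"
      then show "norm (G s - G t) \<le> E s t"
        using one[of s t] one[of t s] t E_sym[of s t] by auto
    qed
    then show "((\<lambda>s. G s - G t) \<longlongrightarrow> 0) (at t within {0..})"
      by (rule Lim_null_comparison[OF _ E_lim]) (use t in simp)
  qed
  then have "compact (G ` {0..T})"
    by (intro compact_continuous_image) (auto intro: continuous_on_subset)
  then show ?thesis unfolding G_def by (intro bounded_imp_bdd_above compact_imp_bounded)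
qed

text \<open>Convergence uniform on compact time intervals allows any accuracy to be prescribed on \<open>{0..k}\<close>. The
    property
\<open>k \<le> s k\<close> carries limits over to the selected indices.\<close>

lemma approximating_subsequence:
  assumes adm: "admissible_phi \<phi>" and sol: "generalized_solution \<phi> n uk u"
  obtains s M C where "approximating_sequence \<phi> (\<lambda>k. n (s k)) (\<lambda>k. uk (s k)) u M C" "\<And>k::nat. k \<le> s k"
proof -
  have u: "C0_L2 u" and mono: "strict_mono n" and pos: "\<And>k. 0 < n k"
    and lim: "\<And>T. 0 < T \<Longrightarrow> (\<lambda>k. SUP t\<in>{0..T}. L2_norm01 (\<lambda>x. uk k t \<lceil>real (n k) * x\<rceil> - u t x)) \<longlonglongrightarrow> 0"
    using sol by (auto simp: generalized_solution_def)
  obtain M where M: "\<And>k. sup_norm (n k) (uk k 0) + TV (n k) (uk k 0) \<le> M"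
    using sol by (auto simp: generalized_solution_def)
  obtain C where C: "\<And>s. \<bar>deriv \<phi> s\<bar> \<le> C" by (rule admissible_phi_deriv_bounds[OF adm]) (rule that)
  have flow: "semidiscrete_flow \<phi> (n k) (uk k)" for k
    by unfold_locales (use adm pos sol in \<open>simp_all add: generalized_solution_def\<close>)
  define S where "S T k = (SUP t\<in>{0..T}. L2_norm01 (\<lambda>x. step (n k) (uk k t) x - u t x))" for T k
  have le_S: "L2_norm01 (\<lambda>x. step (n k) (uk k t) x - u t x) \<le> S T k" if "0 \<le> t" "t \<le> T" for t T k
    unfolding S_def
    by (rule cSUP_upper) (use that semidiscrete_flow.deviation_bounded[OF flow u] in auto)
  \<comment> \<open>The interval is \<open>{0..k + 1}\<close> and not \<open>{0..k}\<close>, since convergence is only assumed for positive \<open>T\<close>.\<close>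
  have "\<exists>m\<ge>k. S (real k + 1) m < (1/2) ^ k \<and> 4 ^ k \<le> n m" for k
  proof -
    have "S (real k + 1) \<longlonglongrightarrow> 0"
      using lim[of "real k + 1"] by (simp add: S_def[abs_def] step_def)
    then have "eventually (\<lambda>m. S (real k + 1) m < (1/2) ^ k) sequentially"
      by (rule order_tendstoD) simp
    then have "eventually (\<lambda>m. S (real k + 1) m < (1/2) ^ k \<and> k \<le> m \<and> 4 ^ k \<le> m) sequentially"
      using eventually_ge_at_top[of k] eventually_ge_at_top[of "4 ^ k"] by eventually_elim simp
    then obtain m where "S (real k + 1) m < (1/2) ^ k" "k \<le> m" "4 ^ k \<le> m"
      by (auto simp: eventually_sequentially)
    then show ?thesis using strict_mono_imp_increasing[OF mono, of m] by (intro exI[of _ m]) auto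
  qed
  then obtain s where s: "\<And>k. k \<le> s k" "\<And>k. S (real k + 1) (s k) < (1/2) ^ k" "\<And>k. 4 ^ k \<le> n (s k)"
    by metis
  have "approximating_sequence \<phi> (\<lambda>k. n (s k)) (\<lambda>k. uk (s k)) u M C"
  proof (rule approximating_sequence.intro)
    show "L2_norm01 (\<lambda>x. step (n (s k)) (uk (s k) t) x - u t x) \<le> (1/2) ^ k" if "0 \<le> t" "t \<le> real k" for k t
      using le_S[of t "real k + 1" "s k"] that s(2)[of k] by linarith
  qed (use flow M C s(3) u in \<open>auto simp: C0_L2_def\<close>)
  with s(1) show thesis by (intro that)
qed

context approximating_sequence
begin

definition ulim :: "real \<times> real \<Rightarrow> real" where
  "ulim p = lim (\<lambda>k. spacetime (n k) (w k) p)"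

lemma ulim_measurable[measurable]: "ulim \<in> borel_measurable borel"
  unfolding ulim_def by measurable

lemma AE_slices_ulim:
  "AE t in J0. AE x in I01. (\<lambda>k. spacetime (n k) (w k) (t, x)) \<longlonglongrightarrow> u t x \<and> ulim (t, x) = u t x"
proof (rule AE_I2)
  fix t :: real assume "t \<in> space J0"
  then have t: "0 < t" by simp
  show "AE x in I01. (\<lambda>k. spacetime (n k) (w k) (t, x)) \<longlonglongrightarrow> u t x \<and> ulim (t, x) = u t x"
    using slices_converge[OF less_imp_le[OF t]] AE_space
  proof eventually_elim
    case (elim x)
    then have "(\<lambda>k. spacetime (n k) (w k) (t, x)) \<longlonglongrightarrow> u t x" using t by (simp add: spacetime_def)
    then show ?case by (auto simp: ulim_def dest: limI)
  qed
qed

lemma spacetime_rep_ulim: "spacetime_rep u (\<lambda>t x. ulim (t, x))"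
proof -
  have "AE t in J0. AE x in I01. ulim (t, x) = u t x"
    using AE_slices_ulim by eventually_elim (auto elim: eventually_mono)
  then show ?thesis
    unfolding spacetime_rep_def using borel_measurable_strip[OF ulim_measurable] by simp
qed

text \<open>Any representative agrees with the pointwise limit \<open>ulim\<close> on almost every slice, hence almost
    everywhere in
the strip.\<close>

lemma spacetime_rep_limit:
  assumes U: "spacetime_rep u U"
  shows "AE p in lebesgue_on strip. (\<lambda>k. spacetime (n k) (w k) p) \<longlonglongrightarrow> case_prod U p"
proof -
  have [measurable]: "case_prod U \<in> borel_measurable (lebesgue_on strip)"
    and ae: "AE t in J0. AE x in I01. U t x = u t x"
    using U by (auto simp: spacetime_rep_def)
  have [measurable]: "ulim \<in> borel_measurable (lebesgue_on strip)"
    by (rule borel_measurable_strip[OF ulim_measurable])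
  have "AE p in lebesgue_on strip. ulim p = case_prod U p"
  proof (rule AE_slices_strip)
    have "{p \<in> space (lebesgue_on strip). ulim p \<noteq> case_prod U p} \<in> sets (lebesgue_on strip)"
      by measurable
    then have "{p \<in> space (lebesgue_on strip). ulim p \<noteq> case_prod U p} \<in> sets lebesgue"
      by (subst (asm) sets_restrict_space_iff) auto
    moreover have "{p. ulim p \<noteq> case_prod U p} \<inter> strip
        = {p \<in> space (lebesgue_on strip). ulim p \<noteq> case_prod U p}"
      by auto
    ultimately show "{p. ulim p \<noteq> case_prod U p} \<inter> strip \<in> sets lebesgue" by simp
    show "AE t in J0. AE x in I01. ulim (t, x) = case_prod U (t, x)"
      using ae AE_slices_ulim
    proof eventually_elim
      case (elim t)
      from elim show ?case by eventually_elim simp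
    qed
  qed
  moreover have "AE p in lebesgue_on strip. convergent (\<lambda>k. spacetime (n k) (w k) p)"
  proof (rule AE_slices_convergent)
    show "AE t in J0. AE x in I01. convergent (\<lambda>k. spacetime (n k) (w k) (t, x))"
      using AE_slices_ulim
    proof eventually_elim
      case (elim t)
      from elim show ?case by eventually_elim (rule convergentI, erule conjunct1)
    qed
  qed measurable
  ultimately show ?thesis
  proof eventually_elim
    case (elim p)
    from elim(2) have "(\<lambda>k. spacetime (n k) (w k) p) \<longlonglongrightarrow> ulim p"
      by (simp only: ulim_def convergent_LIMSEQ_iff)
    then show ?case by (simp only: elim(1))
  qed
qed

end

context mixed_sequence
begin

text \<open>The continuous representative of the flux is the primitive of \<open>g (t, \<cdot>)\<close>, and the measures come from
\<open>bounded_variation_limit\<close>; the sign condition is \<open>regular_time_sign\<close> read through \<open>BV_pairing\<close>.\<close>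

lemma slice_structure:
  assumes t: "regular_time t" and U: "AE x in I01. U x = u t x" and V: "AE x in I01. V x
      = prim (\<lambda>x. g (t, x)) x"
  shows "weak_deriv {0<..<1} 1 V (\<lambda>x. g (t, x))" and "W11 0 1 V" and "BV 0 1 U"
    and "\<exists>z. cont_rep 0 1 V z \<and> z 0 = 0 \<and> z 1 = 0"
    and "\<exists>z P N. cont_rep 0 1 V z \<and> distr_deriv 0 1 U P N \<and>
        (\<forall>E\<in>sets (restrict_space borel {0<..<1}). (LINT x:E|P. z x) - (LINT x:E|N. z x) \<ge> 0)"
proof -
  have t0: "0 \<le> t" using t by (simp add: regular_time_def)
  define gt where "gt x = g (t, x)" for x
  have gt: "integrable I01 gt"
    unfolding gt_def by (rule I01_L2_imp_L1) (use t in \<open>auto simp: regular_time_def\<close>)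
  have gt1: "prim gt 1 = 0" unfolding gt_def by (rule regular_time_flux(1)[OF t])
  note V' = V[folded gt_def]
  note wd = weak_deriv_prim[OF gt gt1 V']
  show "weak_deriv {0<..<1} 1 V (\<lambda>x. g (t, x))" using wd(1) by (simp add: gt_def)
  show "W11 0 1 V" unfolding W11_def using wd gt by auto
  have rep: "cont_rep 0 1 V (prim gt)"
    unfolding cont_rep_def using continuous_prim[OF gt] V' by simp
  then show "\<exists>z. cont_rep 0 1 V z \<and> z 0 = 0 \<and> z 1 = 0"
    using gt1 prim_0 by auto
  note [measurable] = u_measurable[OF t0]
  have Um[measurable]: "U \<in> borel_measurable I01" by (rule AE_eq_measurable_I01[OF u_measurable[OF t0] U])
  obtain P N b where P: "borel01_measure P" and N: "borel01_measure N"
    and ub: "AE x in I01. u t x = b + borel01_measure.cumul P x - borel01_measure.cumul N x"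
    by (rule bounded_variation_limit[OF n_pos TV_bound[OF t0] slices_converge[OF t0]])
  interpret P: borel01_measure P by fact
  interpret N: borel01_measure N by fact
  note pairing = BV_pairing[OF P N u_measurable[OF t0] ub]
  have dd: "distr_deriv 0 1 U P N"
    unfolding distr_deriv_def
  proof (intro conjI allI impI)
    fix \<eta> :: "real \<Rightarrow> real" assume \<eta>: "test_function {0<..<1} \<eta>"
    obtain \<rho> R where \<rho>: "\<And>x. deriv \<eta> x = \<rho> x" "integrable I01 \<rho>"
      "\<rho> \<in> borel_measurable I01" "\<And>x. \<lbrakk>0 \<le> x; x \<le> 1\<rbrakk> \<Longrightarrow> prim \<rho> x = \<eta> x" "prim \<rho> 1 = 0"
      using test_function_interval[OF \<eta>] by metis
    have "(LINT x|I01. U x * deriv \<eta> x) = (LINT x|I01. u t x * \<rho> x)"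
      by (rule integral_cong_AE) (use U \<rho> in \<open>auto elim!: eventually_mono\<close>)
    also have "\<dots> = - ((LINT x|P. prim \<rho> x) - (LINT x|N. prim \<rho> x))"
      by (rule pairing[OF \<rho>(2,5)])
    also have "(LINT x|P. prim \<rho> x) = (LINT x|P. \<eta> x)"
      by (rule Bochner_Integration.integral_cong) (auto simp: P.space_P \<rho>(4))
    also have "(LINT x|N. prim \<rho> x) = (LINT x|N. \<eta> x)"
      by (rule Bochner_Integration.integral_cong) (auto simp: N.space_P \<rho>(4))
    finally show "(LINT x|I01. U x * deriv \<eta> x) = - ((LINT x|P. \<eta> x) - (LINT x|N. \<eta> x))" .
  qed (use P.sets_P N.sets_P P.finite_measure_axioms N.finite_measure_axioms in auto)
  have "integrable I01 (u t)" by (rule I01_L2_imp_L1) (use u_square[OF t0] in auto)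
  then have "integrable I01 U" using U by (subst integrable_cong_AE[where g = "u t"]) auto
  with dd show "BV 0 1 U" unfolding BV_def by auto
  \<comment> \<open>A nonnegative \<open>prim \<rho>\<close> times the flux \<open>prim gt\<close> is again a primitive, so the pairing applies to it.\<close>
  have sign: "0 \<le> (LINT x|P. indicator E x * prim gt x) - (LINT x|N. indicator E x * prim gt x)"
    if E: "E \<in> sets borel" for E
  proof (rule signed_measure_nonneg[OF P N prim_measurable[OF gt] prim_bound[OF gt] _ E])
    fix \<rho> R
    assume \<rho>: "\<rho> \<in> borel_measurable I01" "\<And>x. \<lbrakk>0 < x; x < 1\<rbrakk> \<Longrightarrow> \<bar>\<rho> x\<bar> \<le> R"
      "\<And>x. \<lbrakk>0 < x; x < 1\<rbrakk> \<Longrightarrow> 0 \<le> prim \<rho> x"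
    have \<rho>i: "integrable I01 \<rho>" by (rule I01_bounded_integrable[OF \<rho>(1,2)])
    define q where "q x = prim \<rho> x * gt x + \<rho> x * prim gt x" for x
    have q: "integrable I01 q" "\<And>x. prim q x = prim \<rho> x * prim gt x"
      unfolding q_def using prim_product[OF \<rho>i gt] by auto
    have "prim q 1 = 0" using q(2) gt1 by simp
    from pairing[OF q(1) this] regular_time_sign[OF t \<rho>]
    show "0 \<le> (LINT x|P. prim \<rho> x * prim gt x) - (LINT x|N. prim \<rho> x * prim gt x)"
      unfolding q(2) by (simp add: q_def gt_def[abs_def])
  qed
  have "(LINT x:E|P. prim gt x) - (LINT x:E|N. prim gt x) \<ge> 0"
    if "E \<in> sets (restrict_space borel {0<..<1})" for E
  proof -
    have "E \<in> sets borel" using that by (subst (asm) sets_restrict_space_iff) auto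
    from sign[OF this] show ?thesis by (simp add: set_lebesgue_integral_def)
  qed
  with rep dd show "\<exists>z P N. cont_rep 0 1 V z \<and> distr_deriv 0 1 U P N \<and>
        (\<forall>E\<in>sets (restrict_space borel {0<..<1}). (LINT x:E|P. z x) - (LINT x:E|N. z x) \<ge> 0)"
    by blast
qed

lemma weak_deriv_time:
  assumes U: "U \<in> borel_measurable (lebesgue_on strip)"
    and lim: "AE p in lebesgue_on strip. (\<lambda>k. spacetime (n k) (w k) p) \<longlonglongrightarrow> U p"
  shows "weak_deriv strip (1, 0) U g"
  unfolding weak_deriv_def
proof (intro conjI allI impI)
  have bound: "AE p in lebesgue_on strip. \<bar>U p\<bar> \<le> M"
    using lim
  proof eventually_elim
    case (elim p)
    show ?case by (rule LIMSEQ_le_const2[OF tendsto_rabs[OF elim]]) (use w_bound_spacetime in auto)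
  qed
  show "L1_loc strip U"
    unfolding L1_loc_def
  proof (intro allI impI)
    fix K :: "(real \<times> real) set" assume K: "compact K" "K \<subseteq> strip"
    have Kl: "K \<in> sets lebesgue" "emeasure lebesgue K < \<infinity>"
      using lmeasurable_compact[OF K(1)] by (auto simp: fmeasurable_def)
    interpret finite_measure "lebesgue_on K"
      by (rule finite_measureI) (use Kl in \<open>simp add: emeasure_restrict_space\<close>)
    show "integrable (lebesgue_on K) U"
    proof (rule integrable_const_bound[where B = M])
      show "U \<in> borel_measurable (lebesgue_on K)" by (rule measurable_restrict_mono[OF U K(2)])
      have "AE p in lebesgue. p \<in> strip \<longrightarrow> \<bar>U p\<bar> \<le> M"
        using bound by (subst (asm) AE_restrict_space_iff) auto
      then show "AE p in lebesgue_on K. norm (U p) \<le> M"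
        using K(2) Kl by (subst AE_restrict_space_iff) (auto elim!: eventually_mono)
    qed
  qed
  show "L1_loc strip g"
    unfolding L1_loc_def
    by (auto intro!: integrable_strip_subset g_L2 dest!: lmeasurable_compact simp: fmeasurable_def)
  show "(LINT p|lebesgue_on strip. U p * frechet_derivative \<eta> (at p) (1, 0))
      = - (LINT p|lebesgue_on strip. g p * \<eta> p)"
    if "test_function strip \<eta>" for \<eta>
    by (rule weak_time_derivative[OF that U lim])
qed

lemma limit_is_uv_evolution:
  assumes weak: "weak_star_limit strip (\<lambda>k (t, x). v k t \<lceil>real (n k) * x\<rceil>) (case_prod V)"
    and U: "spacetime_rep u U"
  shows "uv_evolution 0 1 U V"
proof -
  have Um: "case_prod U \<in> borel_measurable (lebesgue_on strip)"
    and Uu: "AE t in J0. AE x in I01. U t x = u t x"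
    using U by (auto simp: spacetime_rep_def)
  have Vm: "case_prod V \<in> borel_measurable (lebesgue_on strip)"
    using weak by (simp add: weak_star_limit_def Linfty_def)
  have Vg: "AE t in J0. regular_time t \<and> (AE x in I01. V t x = prim (\<lambda>x. g (t, x)) x)"
    using AE_strip_slices[OF weak_limit_eq[OF weak]] AE_regular_time
  proof eventually_elim
    case (elim t)
    from elim(1) AE_space have "AE x in I01. V t x = prim (\<lambda>x. g (t, x)) x"
      by eventually_elim (use vlim_slice[OF elim(2)] in auto)
    with elim(2) show ?case by simp
  qed
  have slices: "AE t in J0. regular_time t \<and> (AE x in I01. U t x = u t x) \<and> (AE x in I01. V t x
      = prim (\<lambda>x. g (t, x)) x)"
    using Vg Uu by eventually_elim auto
  define ut where "ut t x = g (t, x)" for t x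
  have ut: "case_prod ut = g" by (auto simp: ut_def)
  have "weak_deriv strip (1, 0) (case_prod U) (case_prod ut)"
    unfolding ut by (rule weak_deriv_time[OF Um spacetime_rep_limit[OF U]])
  moreover have "integrable (lebesgue_on ({0<..<T} \<times> {0<..<1})) (case_prod ut)" for T :: real
    unfolding ut
  proof (rule integrable_strip_subset[OF _ _ g_measurable g_L2])
    have op: "open ({0<..<T} \<times> {0<..<1::real})" by (intro open_Times) auto
    then show "{0<..<T} \<times> {0<..<1::real} \<in> sets lebesgue" by (simp add: borel_open)
    have "emeasure lebesgue ({0<..<T} \<times> {0<..<1::real}) = emeasure lborel ({0<..<T} \<times> {0<..<1::real})"
      using op by (simp add: borel_open)
    also have "\<dots> \<le> emeasure lborel ({0..T} \<times> {0..1::real})"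
      by (intro emeasure_mono) (auto intro!: borel_closed closed_Times)
    also have "\<dots> < \<infinity>" by (intro emeasure_compact_finite compact_Times) auto
    finally show "emeasure lebesgue ({0<..<T} \<times> {0<..<1::real}) < \<infinity>" .
  qed
  moreover have "AE t in J0. weak_deriv {0<..<1} 1 (V t) (ut t)"
    using slices by eventually_elim (auto simp: ut_def[abs_def] intro: slice_structure(1))
  moreover have "AE t in J0. BV 0 1 (U t) \<and> W11 0 1 (V t)"
    using slices by eventually_elim (auto intro: slice_structure(2,3))
  moreover have "AE t in J0. \<exists>z. cont_rep 0 1 (V t) z \<and> z 0 = 0 \<and> z 1 = 0"
    using slices by eventually_elim (auto intro: slice_structure(4))
  moreover have "AE t in J0. \<exists>z P N. cont_rep 0 1 (V t) z \<and> distr_deriv 0 1 (U t) P N \<and>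
        (\<forall>E\<in>sets (restrict_space borel {0<..<1}). (LINT x:E|P. z x) - (LINT x:E|N. z x) \<ge> 0)"
    using slices by eventually_elim (blast intro: slice_structure(5))
  ultimately show ?thesis
    unfolding uv_evolution_def using Um Vm by blast
qed

end

theorem proposition2p11:
  fixes \<phi> :: "real \<Rightarrow> real"
    and n :: "nat \<Rightarrow> nat"
    and uk :: "nat \<Rightarrow> real \<Rightarrow> int \<Rightarrow> real"
    and u v :: "real \<Rightarrow> real \<Rightarrow> real"
  assumes "admissible_phi \<phi>"
    and "generalized_solution \<phi> n uk u"
    and "weak_star_limit ({0<..} \<times> {0<..<1})
           (\<lambda>k (t, x). flux \<phi> (n k) (uk k t) \<lceil>real (n k) * x\<rceil>) (case_prod v)"
  shows "(\<exists>U. spacetime_rep u U) \<and> (\<forall>U. spacetime_rep u U \<longrightarrow> uv_evolution 0 1 U v)"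
proof -
  obtain s M C where approx: "approximating_sequence \<phi> (\<lambda>k. n (s k)) (\<lambda>k. uk (s k)) u M C"
    and s: "\<And>k::nat. k \<le> s k"
    using approximating_subsequence[OF assms(1,2)] by blast
  obtain c g where "mixed_sequence \<phi> (\<lambda>k. n (s k)) (\<lambda>k. uk (s k)) u M C c g"
    using approximating_sequence.mixed_sequence_exists[OF approx] by blast
  then interpret mixed_sequence \<phi> "\<lambda>k. n (s k)" "\<lambda>k. uk (s k)" u M C c g .
  have "filterlim s at_top sequentially"
    by (rule filterlim_at_top_mono[OF filterlim_ident]) (use s in auto)
  then have weak: "weak_star_limit strip
      (\<lambda>k (t, x). flux \<phi> (n (s k)) (uk (s k) t) \<lceil>real (n (s k)) * x\<rceil>) (case_prod v)"
    using assms(3) unfolding weak_star_limit_def by (auto intro: filterlim_compose)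
  show ?thesis
    using spacetime_rep_ulim limit_is_uv_evolution[OF weak] by blast
qed

end
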